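(* Let $A$ be a commutative ring with $1$ and let $M\in\operatorname{Sym}_n(A)$ be positive definite. Then there exist $s\in\Sigma A^2$ and $Q\in\operatorname{Mat}_{m,n}(A)$ with $m\le 2np(A)$ such that $sM=\mathrm{I}_n+Q^{t}Q$.
   Context: $\Sigma A^2$ denotes the set of finite sums of squares of elements of $A$. $\operatorname{Mat}_{m,n}(A)$ is the set of $m\times n$ matrices over $A$ and $\operatorname{Sym}_n(A)$ the set of symmetric $n\times n$ matrices over $A$. A matrix $M\in\operatorname{Sym}_n(A)$ is positive definite if for every ring homomorphism $\varphi:A\to R$ into a real closed field $R$, the matrix $\varphi(M)$ (entrywise image) is positive definite over $R$ (vacuous if there is no such $\varphi$). The Pythagoras number $p(A)$ is the smallest integer $q$ such that every element of $\Sigma A^2$ is a sum of $q$ squares in $A$; $p(A)=\infty$ if no such integer exists (then the bound on $m$ is vacuous). *)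

theory Defs
  imports "HOL-Algebra.Ring" "HOL-Library.Extended_Nat"
begin

text \<open>Matrices over a ring structure A are functions nat => nat => 'a, only entries with
  indices in range matter.\<close>

definition sum_squares_of :: "('a, 'm) ring_scheme \<Rightarrow> nat \<Rightarrow> 'a \<Rightarrow> bool" where
  "sum_squares_of A q x \<longleftrightarrow>
     (\<exists>f. f \<in> {..<q} \<rightarrow> carrier A \<and> x = (\<Oplus>\<^bsub>A\<^esub> i\<in>{..<q}. f i \<otimes>\<^bsub>A\<^esub> f i))"

definition sos :: "('a, 'm) ring_scheme \<Rightarrow> 'a set" where
  "sos A = {x. \<exists>q. sum_squares_of A q x}"

definition pythagoras_number :: "('a, 'm) ring_scheme \<Rightarrow> enat" where
  "pythagoras_number A =
     (if \<exists>q. \<forall>x\<in>sos A. sum_squares_of A q x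
      then enat (LEAST q. \<forall>x\<in>sos A. sum_squares_of A q x) else \<infinity>)"

text \<open>Real closed field (Artin--Schreier characterisation): a formally real field in which
  every element or its negative is a square and every odd-degree polynomial has a root.\<close>
definition real_closed_field :: "('b, 'n) ring_scheme \<Rightarrow> bool" where
  "real_closed_field R \<longleftrightarrow> field R
     \<and> \<ominus>\<^bsub>R\<^esub> \<one>\<^bsub>R\<^esub> \<notin> sos R
     \<and> (\<forall>x\<in>carrier R. \<exists>y\<in>carrier R. x = y \<otimes>\<^bsub>R\<^esub> y \<or> \<ominus>\<^bsub>R\<^esub> x = y \<otimes>\<^bsub>R\<^esub> y)
     \<and> (\<forall>(d::nat) c. odd d \<longrightarrow> c \<in> {..d} \<rightarrow> carrier R \<longrightarrow> c d \<noteq> \<zero>\<^bsub>R\<^esub> \<longrightarrow>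
          (\<exists>x\<in>carrier R. (\<Oplus>\<^bsub>R\<^esub> i\<in>{..d}. c i \<otimes>\<^bsub>R\<^esub> x [^]\<^bsub>R\<^esub> i) = \<zero>\<^bsub>R\<^esub>))"

text \<open>Strict positivity in a real closed field (its unique ordering: positives are the nonzero squares).\<close>
definition rcf_pos :: "('b, 'n) ring_scheme \<Rightarrow> 'b \<Rightarrow> bool" where
  "rcf_pos R x \<longleftrightarrow> x \<noteq> \<zero>\<^bsub>R\<^esub> \<and> (\<exists>y\<in>carrier R. x = y \<otimes>\<^bsub>R\<^esub> y)"

definition sym_mat :: "('a, 'm) ring_scheme \<Rightarrow> nat \<Rightarrow> (nat \<Rightarrow> nat \<Rightarrow> 'a) \<Rightarrow> bool" where
  "sym_mat A n M \<longleftrightarrow> (\<forall>i<n. \<forall>j<n. M i j \<in> carrier A \<and> M i j = M j i)"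

definition pos_def_over :: "('b, 'n) ring_scheme \<Rightarrow> nat \<Rightarrow> (nat \<Rightarrow> nat \<Rightarrow> 'b) \<Rightarrow> bool" where
  "pos_def_over R n N \<longleftrightarrow> (\<forall>v. v \<in> {..<n} \<rightarrow> carrier R \<longrightarrow> (\<exists>i<n. v i \<noteq> \<zero>\<^bsub>R\<^esub>) \<longrightarrow>
      rcf_pos R (\<Oplus>\<^bsub>R\<^esub> i\<in>{..<n}. \<Oplus>\<^bsub>R\<^esub> j\<in>{..<n}. v i \<otimes>\<^bsub>R\<^esub> N i j \<otimes>\<^bsub>R\<^esub> v j))"

definition pos_def :: "('a, 'm) ring_scheme \<Rightarrow> nat \<Rightarrow> (nat \<Rightarrow> nat \<Rightarrow> 'a) \<Rightarrow> bool" where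
  "pos_def A n M \<longleftrightarrow> sym_mat A n M \<and>
     (\<forall>(R :: ('a \<times> nat) set ring). \<forall>\<phi>\<in>ring_hom A R. real_closed_field R \<longrightarrow>
        pos_def_over R n (\<lambda>i j. \<phi> (M i j)))"

end

theory Submission
  imports Defs "HOL-Algebra.Algebraic_Closure"
begin

text \<open>
  An element \<open>a\<close> that is positive at every real point satisfies \<open>s a = 1 + t\<close> with sums of squares
  \<open>s\<close>, \<open>t\<close>: otherwise \<open>-1\<close> is not a sum of squares in \<open>A[\<surd>(-a)]\<close>, and a ring in which \<open>-1\<close> is not a
  sum of squares maps to a real closed field (the residue field of an ideal maximal among those
  disjoint from \<open>1 + \<Sigma>A\<^sup>2\<close> is formally real, and a maximal formally real subfield of its algebraic
  closure is real closed).

  Let \<open>a = M\<^sub>k\<^sub>k\<close> and let \<open>x\<close> be the \<open>k\<close>-th column of \<open>M\<close>. The Schur complement \<open>M' = a M - x x\<^sup>t\<close> has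
  zero \<open>k\<close>-th row and column and is again positive definite on the other indices. Since
  \<open>s a = 1 + t\<close>, eliminating one index after the other gives \<open>u M = \<Sum> c\<^sub>l w\<^sub>l w\<^sub>l\<^sup>t\<close> with one summand
  for each index, \<open>u \<in> 1 + \<Sigma>A\<^sup>2\<close> and \<open>c\<^sub>l \<in> \<Sigma>A\<^sup>2\<close>. The same elimination, keeping the index \<open>k\<close> for
  last, shows that \<open>y M - g E\<^sub>k\<^sub>k\<close> is positive definite for some \<open>y, g \<in> 1 + \<Sigma>A\<^sup>2\<close>; repeating this for
  all \<open>k\<close>, some \<open>y M - diag d\<close> with all \<open>d\<^sub>i \<in> 1 + \<Sigma>A\<^sup>2\<close> is positive definite. Diagonalizing it,
  \<open>u y M = u diag d + \<Sum> c\<^sub>l w\<^sub>l w\<^sub>l\<^sup>t\<close>, where \<open>u d\<^sub>i = 1 + b\<^sub>i\<close>. The \<open>2 n\<close> sums of squares \<open>b\<^sub>i\<close> and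
  \<open>c\<^sub>l\<close> contribute at most \<open>p(A)\<close> rows each.
\<close>

section \<open>Sums of squares\<close>

lemma (in cring) sum_squares_of_0: "sum_squares_of R 0 x \<longleftrightarrow> x = \<zero>"
  by (auto simp: sum_squares_of_def)

lemma (in cring) sum_squares_of_Suc:
  "sum_squares_of R (Suc q) x \<longleftrightarrow>
     (\<exists>a y. a \<in> carrier R \<and> sum_squares_of R q y \<and> x = a \<otimes> a \<oplus> y)"
proof
  assume "sum_squares_of R (Suc q) x"
  then obtain f where f: "f \<in> {..<Suc q} \<rightarrow> carrier R" and x: "x = (\<Oplus>i\<in>{..<Suc q}. f i \<otimes> f i)"
    unfolding sum_squares_of_def by blast
  from f have "x = f q \<otimes> f q \<oplus> (\<Oplus>i\<in>{..<q}. f i \<otimes> f i)"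
    unfolding x lessThan_Suc by (subst finsum_insert) auto
  moreover have "sum_squares_of R q (\<Oplus>i\<in>{..<q}. f i \<otimes> f i)"
    using f unfolding sum_squares_of_def by (intro exI[of _ f]) auto
  ultimately show "\<exists>a y. a \<in> carrier R \<and> sum_squares_of R q y \<and> x = a \<otimes> a \<oplus> y"
    using f by blast
next
  assume "\<exists>a y. a \<in> carrier R \<and> sum_squares_of R q y \<and> x = a \<otimes> a \<oplus> y"
  then obtain a f where a: "a \<in> carrier R" and f: "f \<in> {..<q} \<rightarrow> carrier R"
    and x: "x = a \<otimes> a \<oplus> (\<Oplus>i\<in>{..<q}. f i \<otimes> f i)"
    unfolding sum_squares_of_def by blast
  have "(\<Oplus>i\<in>{..<Suc q}. (f(q := a)) i \<otimes> (f(q := a)) i)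
      = a \<otimes> a \<oplus> (\<Oplus>i\<in>{..<q}. (f(q := a)) i \<otimes> (f(q := a)) i)"
    unfolding lessThan_Suc using a f by (subst finsum_insert) (auto simp: Pi_def)
  also have "(\<Oplus>i\<in>{..<q}. (f(q := a)) i \<otimes> (f(q := a)) i) = (\<Oplus>i\<in>{..<q}. f i \<otimes> f i)"
    using f by (intro finsum_cong') auto
  finally show "sum_squares_of R (Suc q) x"
    unfolding sum_squares_of_def x using a f by (intro exI[of _ "f(q := a)"]) (auto simp: Pi_def)
qed

lemma (in cring) sum_squares_of_closed: "sum_squares_of R q x \<Longrightarrow> x \<in> carrier R"
  unfolding sum_squares_of_def by (auto intro!: finsum_closed)

text \<open>Zero squares pad a shorter sum, so the count in \<open>sum_squares_of\<close> acts as an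
  upper bound.\<close>

lemma (in cring) sum_squares_of_mono: "sum_squares_of R q x \<Longrightarrow> q \<le> q' \<Longrightarrow> sum_squares_of R q' x"
proof (induction q' rule: nat_induct)
  case (Suc q')
  show ?case
  proof (cases "q = Suc q'")
    case False
    with Suc have "sum_squares_of R q' x" by simp
    then show ?thesis
      unfolding sum_squares_of_Suc using sum_squares_of_closed[of q' x] by (intro exI[of _ \<zero>] exI[of _ x]) auto
  qed (use Suc in auto)
qed auto

context cring
begin

lemma sos_closed: "x \<in> sos R \<Longrightarrow> x \<in> carrier R"
  unfolding sos_def using sum_squares_of_closed by blast

lemma sos_zero: "\<zero> \<in> sos R"
  unfolding sos_def using sum_squares_of_0 by blast

lemma sos_square_add: "a \<in> carrier R \<Longrightarrow> y \<in> sos R \<Longrightarrow> a \<otimes> a \<oplus> y \<in> sos R"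
  unfolding sos_def using sum_squares_of_Suc by blast

text \<open>Induction on the number of squares, stated without that number. The arguments about
  residue fields, subfields and quadratic extensions use it as well.\<close>

lemma sos_induct [consumes 1, case_names zero square_add]:
  assumes "x \<in> sos R" and "P \<zero>"
    and step: "\<And>a y. a \<in> carrier R \<Longrightarrow> y \<in> sos R \<Longrightarrow> P y \<Longrightarrow> P (a \<otimes> a \<oplus> y)"
  shows "P x"
proof -
  from assms(1) obtain q where "sum_squares_of R q x" unfolding sos_def by blast
  then show ?thesis
  proof (induction q arbitrary: x)
    case 0 then show ?case using assms(2) by (simp add: sum_squares_of_0)
  next
    case (Suc q)
    then obtain a y where a: "a \<in> carrier R" and y: "sum_squares_of R q y" and x: "x = a \<otimes> a \<oplus> y"
      unfolding sum_squares_of_Suc by blast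
    show ?case unfolding x using step[OF a] y Suc.IH[OF y] unfolding sos_def by blast
  qed
qed

lemma sos_square: "a \<in> carrier R \<Longrightarrow> a \<otimes> a \<in> sos R"
  using sos_square_add[OF _ sos_zero, of a] by simp

lemma sos_one: "\<one> \<in> sos R"
  using sos_square[of \<one>] by simp

lemma sos_add: "x \<in> sos R \<Longrightarrow> y \<in> sos R \<Longrightarrow> x \<oplus> y \<in> sos R"
proof (induction x rule: sos_induct)
  case zero then show ?case by (simp add: sos_closed)
next
  case (square_add a z)
  then have "a \<otimes> a \<oplus> z \<oplus> y = a \<otimes> a \<oplus> (z \<oplus> y)"
    by (intro a_assoc) (auto simp: sos_closed)
  with square_add show ?case by (auto intro: sos_square_add)
qed

lemma sos_square_mult: "x \<in> sos R \<Longrightarrow> b \<in> carrier R \<Longrightarrow> b \<otimes> b \<otimes> x \<in> sos R"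
proof (induction x rule: sos_induct)
  case zero then show ?case by (simp add: sos_zero)
next
  case (square_add a z)
  then have "b \<otimes> b \<otimes> (a \<otimes> a \<oplus> z) = (b \<otimes> a) \<otimes> (b \<otimes> a) \<oplus> b \<otimes> b \<otimes> z"
    using sos_closed[of z] by algebra
  with square_add show ?case by (auto intro: sos_square_add)
qed

lemma sos_mult: "x \<in> sos R \<Longrightarrow> y \<in> sos R \<Longrightarrow> x \<otimes> y \<in> sos R"
proof (induction x rule: sos_induct)
  case zero then show ?case by (simp add: sos_zero sos_closed)
next
  case (square_add a z)
  then have "(a \<otimes> a \<oplus> z) \<otimes> y = a \<otimes> a \<otimes> y \<oplus> z \<otimes> y"
    using sos_closed[of z] sos_closed[of y] by algebra
  with square_add show ?case by (auto intro: sos_add sos_square_mult)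
qed

end

lemma (in ring_hom_cring) hom_sos: "x \<in> sos R \<Longrightarrow> h x \<in> sos S"
proof (induction x rule: R.sos_induct)
  case (square_add a y)
  then show ?case using R.sos_closed[of y] by (auto intro!: S.sos_square_add)
qed (simp add: S.sos_zero)

text \<open>Used for all commutative rings and not only for fields. The zero ring is excluded, since
  there -1 is 0, the empty sum.\<close>

definition formally_real :: "('a, 'm) ring_scheme \<Rightarrow> bool" where
  "formally_real R \<longleftrightarrow> \<ominus>\<^bsub>R\<^esub> \<one>\<^bsub>R\<^esub> \<notin> sos R"

text \<open>In \<open>R\<lparr>carrier := F\<rparr>\<close> addition, one and zero are inherited,
  whereas additive inverses are defined through the carrier. A criterion without
  \<open>\<ominus>\<close> therefore compares subrings with the ambient ring directly.\<close>

lemma (in cring) formally_real_iff: "formally_real R \<longleftrightarrow> (\<forall>s\<in>sos R. \<one> \<oplus> s \<noteq> \<zero>)"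
proof
  assume fr: "formally_real R"
  show "\<forall>s\<in>sos R. \<one> \<oplus> s \<noteq> \<zero>"
  proof (intro ballI notI)
    fix s assume s: "s \<in> sos R" "\<one> \<oplus> s = \<zero>"
    then have "s \<oplus> \<one> = \<zero>" using sos_closed[OF s(1)] by (simp only: a_comm one_closed)
    then have "\<ominus> \<one> = s" by (rule minus_equality) (use s sos_closed in auto)
    with s fr show False by (simp add: formally_real_def)
  qed
qed (auto simp: formally_real_def r_neg)

text \<open>If \<open>x\<close> were invertible, then \<open>y = -x\<close>, and
  \<open>inv x \<otimes> inv x \<otimes> (x \<otimes> y)\<close> would be a sum of squares equal to
  -1.\<close>

lemma (in field) formally_real_add_eq_zero:
  assumes "formally_real R" "x \<in> sos R" "y \<in> sos R" "x \<oplus> y = \<zero>"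
  shows "x = \<zero>"
proof (rule ccontr)
  assume "x \<noteq> \<zero>"
  have c: "x \<in> carrier R" "y \<in> carrier R" using assms sos_closed by auto
  with \<open>x \<noteq> \<zero>\<close> have i: "inv x \<in> carrier R" "inv x \<otimes> x = \<one>"
    by (auto simp: field_Units)
  have y: "y = \<ominus> x" using assms(4) c by (metis a_comm minus_equality)
  have "(inv x) \<otimes> (inv x) \<otimes> (x \<otimes> y) = \<ominus> ((inv x \<otimes> x) \<otimes> (inv x \<otimes> x))"
    unfolding y using c i(1) by algebra
  also have "\<dots> = \<ominus> \<one>" by (simp add: i)
  finally have "\<ominus> \<one> \<in> sos R"
    using sos_square_mult[OF sos_mult[OF assms(2,3)] i(1)] by simp
  with assms(1) show False by (simp add: formally_real_def)
qed

section \<open>Cardinality of the algebraic closure\<close>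

lemma infinite_imp_ex_pairing:
  assumes "infinite (UNIV :: 'u set)"
  shows "\<exists>p :: 'u \<times> 'u \<Rightarrow> 'u. inj p"
proof -
  from card_of_Times_same_infinite[OF assms]
  obtain p where "bij_betw p ((UNIV :: 'u set) \<times> (UNIV :: 'u set)) (UNIV :: 'u set)"
    unfolding card_of_ordIso[symmetric] by blast
  then show ?thesis by (auto simp: bij_betw_def)
qed

lemma infinite_imp_ex_inj_list:
  assumes inf: "infinite (UNIV :: 'u set)"
  shows "\<exists>e :: 'u list \<Rightarrow> 'u. inj e"
proof -
  obtain p :: "'u \<times> 'u \<Rightarrow> 'u" where p: "inj p" using infinite_imp_ex_pairing[OF inf] by blast
  \<comment> \<open>Folding the pairing over a list does not show where the list ends, because the
    starting value \<open>undefined\<close> may itself be a code. The length, coded through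
    \<open>i\<close>, is recorded for this reason.\<close>
  obtain i :: "nat \<Rightarrow> 'u" where i: "inj i" using infinite_countable_subset[OF inf] by blast
  define e where "e xs = p (i (length xs), foldr (\<lambda>x r. p (x, r)) xs undefined)" for xs
  have *: "length xs = length ys \<Longrightarrow>
    foldr (\<lambda>x r. p (x, r)) xs undefined = foldr (\<lambda>x r. p (x, r)) ys undefined \<Longrightarrow> xs = ys" for xs ys
    by (induction xs ys rule: list_induct2) (auto dest: injD[OF p])
  have "inj e"
    by (rule injI) (use * in \<open>auto simp: e_def dest!: injD[OF p] injD[OF i]\<close>)
  then show ?thesis by blast
qed

text \<open>Each multiset is sent to a chosen enumeration of it; \<open>mset\<close> is a left
  inverse of this choice.\<close>

lemma ex_inj_mset: "\<exists>e :: 'x multiset \<Rightarrow> 'x list. inj e"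
proof -
  have "mset (SOME xs. mset xs = M) = M" for M :: "'x multiset"
    by (rule someI_ex) (rule ex_mset)
  then have "inj (\<lambda>M :: 'x multiset. SOME xs. mset xs = M)"
    by (intro inj_on_inverseI)
  then show ?thesis by blast
qed

text \<open>The type on the left is the one in which the library places the algebraic closure of a field
  with elements of type \<open>'k\<close>.\<close>
lemma ex_inj_closure_type:
  fixes e :: "'k \<Rightarrow> 'u"
  assumes inf: "infinite (UNIV :: 'u set)" and e: "inj e"
  shows "\<exists>g :: (('k list \<times> nat) multiset \<Rightarrow> 'k) \<Rightarrow> 'u set. inj g"
proof -
  obtain p :: "'u \<times> 'u \<Rightarrow> 'u" where p: "inj p" using infinite_imp_ex_pairing[OF inf] by blast
  obtain i :: "nat \<Rightarrow> 'u" where i: "inj i" using infinite_countable_subset[OF inf] by blast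
  obtain l :: "'u list \<Rightarrow> 'u" where l: "inj l" using infinite_imp_ex_inj_list[OF inf] by blast
  obtain m :: "('k list \<times> nat) multiset \<Rightarrow> ('k list \<times> nat) list" where m: "inj m"
    using ex_inj_mset by blast
  define a where "a = (\<lambda>(xs, n). p (l (map e xs), i n))"
  have a: "inj a"
    by (rule injI) (auto simp: a_def dest!: injD[OF p] injD[OF l] injD[OF i] simp: inj_map_eq_map[OF e])
  define b where "b M = l (map a (m M))" for M
  have b: "inj b"
    by (rule injI) (auto simp: b_def dest!: injD[OF l] simp: inj_map_eq_map[OF a] dest: injD[OF m])
  \<comment> \<open>A function is coded by its graph, a set of elements of \<open>'u\<close>. This
    is why the target consists of sets over \<open>'u\<close>.\<close>
  define g where "g f = range (\<lambda>x. p (b x, e (f x)))" for f :: "('k list \<times> nat) multiset \<Rightarrow> 'k"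
  have "inj g"
  proof (rule injI, rule ext)
    fix f f' x
    assume "g f = g f'"
    then have "p (b x, e (f x)) \<in> g f'" by (auto simp: g_def)
    then show "f x = f' x"
      by (auto simp: g_def dest!: injD[OF p] injD[OF b] injD[OF e])
  qed
  then show ?thesis by blast
qed

section \<open>The residue field of a real prime ideal\<close>

text \<open>A fraction is stored as one chosen pair from its class instead of the class itself, so
  that the field lives on \<open>'a \<times> 'a\<close> and the size of the types stays under
  control. For a prime ideal \<open>I\<close>, the relation is equality of fractions over
  \<open>R / I\<close>.\<close>

definition frac_rep :: "('a, 'm) ring_scheme \<Rightarrow> 'a set \<Rightarrow> 'a \<times> 'a \<Rightarrow> 'a \<times> 'a" where
  "frac_rep R I z = (SOME w. w \<in> carrier R \<times> (carrier R - I) \<and>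
     fst z \<otimes>\<^bsub>R\<^esub> snd w \<ominus>\<^bsub>R\<^esub> fst w \<otimes>\<^bsub>R\<^esub> snd z \<in> I)"

text \<open>For a prime ideal \<open>I\<close> this is the field of fractions of
  \<open>R / I\<close>. Quotient and fractions are formed in one step, with denominators outside
  \<open>I\<close>.\<close>

definition residue_field :: "('a, 'm) ring_scheme \<Rightarrow> 'a set \<Rightarrow> ('a \<times> 'a) ring" where
  "residue_field R I =
    \<lparr>carrier = frac_rep R I ` (carrier R \<times> (carrier R - I)),
     monoid.mult = (\<lambda>z w. frac_rep R I (fst z \<otimes>\<^bsub>R\<^esub> fst w, snd z \<otimes>\<^bsub>R\<^esub> snd w)),
     one = frac_rep R I (\<one>\<^bsub>R\<^esub>, \<one>\<^bsub>R\<^esub>),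
     zero = frac_rep R I (\<zero>\<^bsub>R\<^esub>, \<one>\<^bsub>R\<^esub>),
     add = (\<lambda>z w. frac_rep R I
       (fst z \<otimes>\<^bsub>R\<^esub> snd w \<oplus>\<^bsub>R\<^esub> fst w \<otimes>\<^bsub>R\<^esub> snd z, snd z \<otimes>\<^bsub>R\<^esub> snd w))\<rparr>"

context primeideal
begin

abbreviation D where "D \<equiv> carrier R - I"

lemma D_mult: "y \<in> D \<Longrightarrow> y' \<in> D \<Longrightarrow> y \<otimes> y' \<in> D"
  using I_prime by blast

lemma D_one: "\<one> \<in> D"
  using one_imp_carrier I_notcarr by auto

text \<open>The middle denominator \<open>y'\<close> times the difference is a combination of the
  two given members of \<open>I\<close>; as \<open>y'\<close> lies outside the prime ideal, it
  cancels.\<close>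

lemma frac_trans:
  assumes "x \<in> carrier R" "y \<in> D" "x' \<in> carrier R" "y' \<in> D" "x'' \<in> carrier R" "y'' \<in> D"
    and "x \<otimes> y' \<ominus> x' \<otimes> y \<in> I" "x' \<otimes> y'' \<ominus> x'' \<otimes> y' \<in> I"
  shows "x \<otimes> y'' \<ominus> x'' \<otimes> y \<in> I"
proof -
  have c: "x \<in> carrier R" "y \<in> carrier R" "x' \<in> carrier R" "y' \<in> carrier R" "x'' \<in> carrier R"
    "y'' \<in> carrier R" using assms by auto
  have "y' \<otimes> (x \<otimes> y'' \<ominus> x'' \<otimes> y) = y'' \<otimes> (x \<otimes> y' \<ominus> x' \<otimes> y) \<oplus> y \<otimes> (x' \<otimes> y'' \<ominus> x'' \<otimes> y')"
    using c by algebra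
  also have "\<dots> \<in> I" using assms(7,8) c by (auto intro: I_l_closed)
  finally show ?thesis using I_prime[of y' "x \<otimes> y'' \<ominus> x'' \<otimes> y"] assms c by auto
qed

lemma frac_sym:
  assumes "x \<in> carrier R" "y \<in> D" "x' \<in> carrier R" "y' \<in> D" "x \<otimes> y' \<ominus> x' \<otimes> y \<in> I"
  shows "x' \<otimes> y \<ominus> x \<otimes> y' \<in> I"
proof -
  have "x' \<otimes> y \<ominus> x \<otimes> y' = \<ominus> (x \<otimes> y' \<ominus> x' \<otimes> y)"
    using assms by (simp add: minus_add a_minus_def a_comm)
  with assms show ?thesis using a_inv_closed by simp
qed

lemma frac_rep_mem:
  assumes "x \<in> carrier R" "y \<in> D"
  obtains x' y' where "frac_rep R I (x, y) = (x', y')" "x' \<in> carrier R" "y' \<in> D"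
    "x \<otimes> y' \<ominus> x' \<otimes> y \<in> I"
proof -
  have "\<exists>w. w \<in> carrier R \<times> D \<and> fst (x, y) \<otimes> snd w \<ominus> fst w \<otimes> snd (x, y) \<in> I"
    using assms by (intro exI[of _ "(x, y)"]) (auto simp: a_minus_def r_neg)
  from someI_ex[OF this] have "frac_rep R I (x, y) \<in> carrier R \<times> D \<and>
      fst (x, y) \<otimes> snd (frac_rep R I (x, y)) \<ominus> fst (frac_rep R I (x, y)) \<otimes> snd (x, y) \<in> I"
    unfolding frac_rep_def .
  then show thesis using that[of "fst (frac_rep R I (x, y))" "snd (frac_rep R I (x, y))"] by auto
qed

text \<open>By symmetry and transitivity, equivalent pairs satisfy the same condition under
  \<open>SOME\<close> and so receive the same choice. Conversely, both pairs are equivalent to their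
  common choice.\<close>

lemma frac_rep_eq:
  assumes "x \<in> carrier R" "y \<in> D" "x' \<in> carrier R" "y' \<in> D"
  shows "frac_rep R I (x, y) = frac_rep R I (x', y') \<longleftrightarrow> x \<otimes> y' \<ominus> x' \<otimes> y \<in> I"
proof
  assume eq: "frac_rep R I (x, y) = frac_rep R I (x', y')"
  obtain u v where "frac_rep R I (x, y) = (u, v)" "u \<in> carrier R" "v \<in> D" "x \<otimes> v \<ominus> u \<otimes> y \<in> I"
    using frac_rep_mem[OF assms(1,2)] .
  moreover obtain u' v' where "frac_rep R I (x', y') = (u', v')" "u' \<in> carrier R" "v' \<in> D"
    "x' \<otimes> v' \<ominus> u' \<otimes> y' \<in> I"
    using frac_rep_mem[OF assms(3,4)] .
  ultimately have uv: "u \<in> carrier R" "v \<in> D" "x \<otimes> v \<ominus> u \<otimes> y \<in> I" "x' \<otimes> v \<ominus> u \<otimes> y' \<in> I"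
    using eq by auto
  from frac_sym[OF assms(3,4) uv(1,2,4)] show "x \<otimes> y' \<ominus> x' \<otimes> y \<in> I"
    using frac_trans[OF assms(1,2) uv(1,2) assms(3,4) uv(3)] by blast
next
  assume h: "x \<otimes> y' \<ominus> x' \<otimes> y \<in> I"
  have "x \<otimes> v \<ominus> u \<otimes> y \<in> I \<longleftrightarrow> x' \<otimes> v \<ominus> u \<otimes> y' \<in> I" if "u \<in> carrier R" "v \<in> D" for u v
    using frac_trans[OF assms(3,4) assms(1,2) that] frac_trans[OF assms(1,2) assms(3,4) that]
      h frac_sym[OF assms h] by blast
  then have "(\<lambda>w. w \<in> carrier R \<times> D \<and> fst (x, y) \<otimes> snd w \<ominus> fst w \<otimes> snd (x, y) \<in> I) =
    (\<lambda>w. w \<in> carrier R \<times> D \<and> fst (x', y') \<otimes> snd w \<ominus> fst w \<otimes> snd (x', y') \<in> I)"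
    by (intro ext) (auto simp: split_beta)
  then show "frac_rep R I (x, y) = frac_rep R I (x', y')" unfolding frac_rep_def by simp
qed

lemma residue_field_carrierE:
  assumes "z \<in> carrier (residue_field R I)"
  obtains x y where "x \<in> carrier R" "y \<in> D" "z = frac_rep R I (x, y)"
  using assms unfolding residue_field_def by auto

lemma frac_rep_closed: "x \<in> carrier R \<Longrightarrow> y \<in> D \<Longrightarrow> frac_rep R I (x, y) \<in> carrier (residue_field R I)"
  by (auto simp: residue_field_def)

text \<open>The operations of \<open>residue_field\<close> act on the chosen pairs. This lemma and
  the one for addition show independence of the choice, so later computations may use any
  pair.\<close>

lemma frac_rep_mult:
  assumes "x \<in> carrier R" "y \<in> D" "x' \<in> carrier R" "y' \<in> D"
  shows "frac_rep R I (x, y) \<otimes>\<^bsub>residue_field R I\<^esub> frac_rep R I (x', y')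
    = frac_rep R I (x \<otimes> x', y \<otimes> y')"
proof -
  obtain u v where uv: "frac_rep R I (x, y) = (u, v)" "u \<in> carrier R" "v \<in> D" "x \<otimes> v \<ominus> u \<otimes> y \<in> I"
    using frac_rep_mem[OF assms(1,2)] .
  obtain u' v' where uv': "frac_rep R I (x', y') = (u', v')" "u' \<in> carrier R" "v' \<in> D"
    "x' \<otimes> v' \<ominus> u' \<otimes> y' \<in> I"
    using frac_rep_mem[OF assms(3,4)] .
  have c: "y \<in> carrier R" "y' \<in> carrier R" "v \<in> carrier R" "v' \<in> carrier R" using assms uv uv' by auto
  have "(x \<otimes> x') \<otimes> (v \<otimes> v') \<ominus> (u \<otimes> u') \<otimes> (y \<otimes> y')
    = (x' \<otimes> v') \<otimes> (x \<otimes> v \<ominus> u \<otimes> y) \<oplus> (u \<otimes> y) \<otimes> (x' \<otimes> v' \<ominus> u' \<otimes> y')"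
    using assms(1,3) c uv(2) uv'(2) by algebra
  also have "\<dots> \<in> I" using uv uv' assms c by (auto intro!: I_l_closed)
  finally have "frac_rep R I (x \<otimes> x', y \<otimes> y') = frac_rep R I (u \<otimes> u', v \<otimes> v')"
    using frac_rep_eq[of "x \<otimes> x'" "y \<otimes> y'" "u \<otimes> u'" "v \<otimes> v'"] assms uv uv' D_mult by auto
  then show ?thesis using uv uv' by (simp add: residue_field_def)
qed

lemma frac_rep_add:
  assumes "x \<in> carrier R" "y \<in> D" "x' \<in> carrier R" "y' \<in> D"
  shows "frac_rep R I (x, y) \<oplus>\<^bsub>residue_field R I\<^esub> frac_rep R I (x', y')
    = frac_rep R I (x \<otimes> y' \<oplus> x' \<otimes> y, y \<otimes> y')"
proof -
  obtain u v where uv: "frac_rep R I (x, y) = (u, v)" "u \<in> carrier R" "v \<in> D" "x \<otimes> v \<ominus> u \<otimes> y \<in> I"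
    using frac_rep_mem[OF assms(1,2)] .
  obtain u' v' where uv': "frac_rep R I (x', y') = (u', v')" "u' \<in> carrier R" "v' \<in> D"
    "x' \<otimes> v' \<ominus> u' \<otimes> y' \<in> I"
    using frac_rep_mem[OF assms(3,4)] .
  have c: "y \<in> carrier R" "y' \<in> carrier R" "v \<in> carrier R" "v' \<in> carrier R" using assms uv uv' by auto
  have "(x \<otimes> y' \<oplus> x' \<otimes> y) \<otimes> (v \<otimes> v') \<ominus> (u \<otimes> v' \<oplus> u' \<otimes> v) \<otimes> (y \<otimes> y')
    = (y' \<otimes> v') \<otimes> (x \<otimes> v \<ominus> u \<otimes> y) \<oplus> (y \<otimes> v) \<otimes> (x' \<otimes> v' \<ominus> u' \<otimes> y')"
    using assms(1,3) c uv(2) uv'(2) by algebra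
  also have "\<dots> \<in> I" using uv uv' assms c by (auto intro!: I_l_closed)
  finally have "frac_rep R I (x \<otimes> y' \<oplus> x' \<otimes> y, y \<otimes> y') = frac_rep R I (u \<otimes> v' \<oplus> u' \<otimes> v, v \<otimes> v')"
    using frac_rep_eq[of "x \<otimes> y' \<oplus> x' \<otimes> y" "y \<otimes> y'" "u \<otimes> v' \<oplus> u' \<otimes> v" "v \<otimes> v'"] assms uv uv' c D_mult
    by auto
  then show ?thesis using uv uv' by (simp add: residue_field_def)
qed

lemma frac_rep_eqI:
  assumes "x \<in> carrier R" "y \<in> D" "x' \<in> carrier R" "y' \<in> D" "x \<otimes> y' = x' \<otimes> y"
  shows "frac_rep R I (x, y) = frac_rep R I (x', y')"
  using assms by (subst frac_rep_eq) (auto simp: a_minus_def r_neg)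

lemma residue_field_one: "\<one>\<^bsub>residue_field R I\<^esub> = frac_rep R I (\<one>, \<one>)"
  and residue_field_zero: "\<zero>\<^bsub>residue_field R I\<^esub> = frac_rep R I (\<zero>, \<one>)"
  by (simp_all add: residue_field_def)

lemma residue_field_is_cring: "cring (residue_field R I)"
proof (rule cringI)
  let ?K = "residue_field R I"
  show "abelian_group ?K"
  proof (rule abelian_groupI)
    fix z w assume "z \<in> carrier ?K" "w \<in> carrier ?K"
    then obtain x y x' y' where e: "x \<in> carrier R" "y \<in> D" "z = frac_rep R I (x, y)"
      "x' \<in> carrier R" "y' \<in> D" "w = frac_rep R I (x', y')" by (metis residue_field_carrierE)
    then show "z \<oplus>\<^bsub>?K\<^esub> w \<in> carrier ?K"
      using D_mult[of y y'] by (simp add: frac_rep_add frac_rep_closed)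
    show "z \<oplus>\<^bsub>?K\<^esub> w = w \<oplus>\<^bsub>?K\<^esub> z"
      using e by (simp add: frac_rep_add a_comm m_comm)
    fix u assume "u \<in> carrier ?K"
    then obtain x'' y'' where f: "x'' \<in> carrier R" "y'' \<in> D" "u = frac_rep R I (x'', y'')"
      by (metis residue_field_carrierE)
    have c: "y \<in> carrier R" "y' \<in> carrier R" "y'' \<in> carrier R" using e f by auto
    have "(x \<otimes> y' \<oplus> x' \<otimes> y) \<otimes> y'' \<oplus> x'' \<otimes> (y \<otimes> y') = x \<otimes> (y' \<otimes> y'') \<oplus> (x' \<otimes> y'' \<oplus> x'' \<otimes> y') \<otimes> y"
      using c e(1,4) f(1) by algebra
    then show "z \<oplus>\<^bsub>?K\<^esub> w \<oplus>\<^bsub>?K\<^esub> u = z \<oplus>\<^bsub>?K\<^esub> (w \<oplus>\<^bsub>?K\<^esub> u)"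
      using e f c D_mult[of y y'] D_mult[of y' y''] by (simp add: frac_rep_add m_assoc)
  next
    fix z assume "z \<in> carrier ?K"
    then obtain x y where e: "x \<in> carrier R" "y \<in> D" "z = frac_rep R I (x, y)"
      by (metis residue_field_carrierE)
    show "\<zero>\<^bsub>?K\<^esub> \<oplus>\<^bsub>?K\<^esub> z = z"
      using e D_one by (simp add: residue_field_zero frac_rep_add)
    have "frac_rep R I (\<ominus> x, y) \<oplus>\<^bsub>?K\<^esub> z = frac_rep R I (\<ominus> x \<otimes> y \<oplus> x \<otimes> y, y \<otimes> y)"
      using e by (simp add: frac_rep_add)
    also have "\<dots> = \<zero>\<^bsub>?K\<^esub>" unfolding residue_field_zero
      using e D_one D_mult[of y y] by (intro frac_rep_eqI) (auto simp: l_minus l_neg)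
    finally show "\<exists>w\<in>carrier ?K. w \<oplus>\<^bsub>?K\<^esub> z = \<zero>\<^bsub>?K\<^esub>"
      using frac_rep_closed[of "\<ominus> x" y] e by blast
  qed (use D_one in \<open>auto simp: residue_field_zero frac_rep_closed\<close>)
  show "comm_monoid ?K"
  proof (rule comm_monoidI)
    fix z w assume "z \<in> carrier ?K" "w \<in> carrier ?K"
    then obtain x y x' y' where e: "x \<in> carrier R" "y \<in> D" "z = frac_rep R I (x, y)"
      "x' \<in> carrier R" "y' \<in> D" "w = frac_rep R I (x', y')" by (metis residue_field_carrierE)
    then show "z \<otimes>\<^bsub>?K\<^esub> w \<in> carrier ?K"
      using D_mult[of y y'] by (simp add: frac_rep_mult frac_rep_closed)
    show "z \<otimes>\<^bsub>?K\<^esub> w = w \<otimes>\<^bsub>?K\<^esub> z"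
      using e by (simp add: frac_rep_mult m_comm)
    fix u assume "u \<in> carrier ?K"
    then obtain x'' y'' where f: "x'' \<in> carrier R" "y'' \<in> D" "u = frac_rep R I (x'', y'')"
      by (metis residue_field_carrierE)
    show "z \<otimes>\<^bsub>?K\<^esub> w \<otimes>\<^bsub>?K\<^esub> u = z \<otimes>\<^bsub>?K\<^esub> (w \<otimes>\<^bsub>?K\<^esub> u)"
      using e f D_mult[of y y'] D_mult[of y' y''] by (simp add: frac_rep_mult m_assoc)
  next
    fix z assume "z \<in> carrier ?K"
    then obtain x y where e: "x \<in> carrier R" "y \<in> D" "z = frac_rep R I (x, y)"
      by (metis residue_field_carrierE)
    show "\<one>\<^bsub>?K\<^esub> \<otimes>\<^bsub>?K\<^esub> z = z"
      using e D_one by (simp add: residue_field_one frac_rep_mult)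
  qed (use D_one in \<open>auto simp: residue_field_one frac_rep_closed\<close>)
  fix z w u assume "z \<in> carrier ?K" "w \<in> carrier ?K" "u \<in> carrier ?K"
  then obtain x y x' y' x'' y'' where e: "x \<in> carrier R" "y \<in> D" "z = frac_rep R I (x, y)"
    "x' \<in> carrier R" "y' \<in> D" "w = frac_rep R I (x', y')"
    "x'' \<in> carrier R" "y'' \<in> D" "u = frac_rep R I (x'', y'')" by (metis residue_field_carrierE)
  have c: "y \<in> carrier R" "y' \<in> carrier R" "y'' \<in> carrier R" using e by auto
  note d = D_mult[of y y'] D_mult[of y y''] D_mult[of y' y''] D_mult[of "y \<otimes> y'" y'']
    D_mult[of "y \<otimes> y''" "y' \<otimes> y''"]
  have "(x \<otimes> y' \<oplus> x' \<otimes> y) \<otimes> x'' \<otimes> (y \<otimes> y'' \<otimes> (y' \<otimes> y'')) =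
    (x \<otimes> x'' \<otimes> (y' \<otimes> y'') \<oplus> x' \<otimes> x'' \<otimes> (y \<otimes> y'')) \<otimes> (y \<otimes> y' \<otimes> y'')"
    using c e(1,4,7) by algebra
  then have "frac_rep R I ((x \<otimes> y' \<oplus> x' \<otimes> y) \<otimes> x'', y \<otimes> y' \<otimes> y'') =
    frac_rep R I (x \<otimes> x'' \<otimes> (y' \<otimes> y'') \<oplus> x' \<otimes> x'' \<otimes> (y \<otimes> y''), y \<otimes> y'' \<otimes> (y' \<otimes> y''))"
    using c e d by (intro frac_rep_eqI) auto
  then show "(z \<oplus>\<^bsub>?K\<^esub> w) \<otimes>\<^bsub>?K\<^esub> u = z \<otimes>\<^bsub>?K\<^esub> u \<oplus>\<^bsub>?K\<^esub> w \<otimes>\<^bsub>?K\<^esub> u"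
    using e c d by (simp add: frac_rep_add frac_rep_mult)
qed

lemma residue_field_is_field: "field (residue_field R I)"
proof -
  let ?K = "residue_field R I"
  interpret K: cring ?K by (rule residue_field_is_cring)
  have ne: "\<one>\<^bsub>?K\<^esub> \<noteq> \<zero>\<^bsub>?K\<^esub>"
    unfolding residue_field_one residue_field_zero using D_one by (subst frac_rep_eq) (auto simp: a_minus_def)
  show ?thesis
  proof (rule K.cring_fieldI2[OF ne[symmetric]])
    fix z assume "z \<in> carrier ?K" "z \<noteq> \<zero>\<^bsub>?K\<^esub>"
    then obtain x y where e: "x \<in> carrier R" "y \<in> D" "z = frac_rep R I (x, y)"
      by (metis residue_field_carrierE)
    \<comment> \<open>A numerator in \<open>I\<close> would make the fraction zero, so the flipped
      pair \<open>(y, x)\<close> is admissible and gives the inverse.\<close>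
    have "x \<in> D"
      using \<open>z \<noteq> \<zero>\<^bsub>?K\<^esub>\<close> e D_one frac_rep_eq[of x y \<zero> \<one>] by (auto simp: residue_field_zero a_minus_def)
    then have "z \<otimes>\<^bsub>?K\<^esub> frac_rep R I (y, x) = \<one>\<^bsub>?K\<^esub>"
      unfolding residue_field_one e(3) using e D_one D_mult[of y x]
      by (subst frac_rep_mult) (auto intro!: frac_rep_eqI simp: m_comm)
    then show "\<exists>b\<in>carrier ?K. z \<otimes>\<^bsub>?K\<^esub> b = \<one>\<^bsub>?K\<^esub>"
      using frac_rep_closed[of y x] e \<open>x \<in> D\<close> by blast
  qed
qed

lemma residue_field_hom: "(\<lambda>x. frac_rep R I (x, \<one>)) \<in> ring_hom R (residue_field R I)"
  using D_one by (intro ring_hom_memI)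
    (auto simp: frac_rep_closed frac_rep_mult frac_rep_add residue_field_one)

text \<open>The common denominator can be kept a square:
  \<open>u^2 / v^2 + s / y^2 = (u^2 y^2 + s v^2) / (v y)^2\<close>, and the new numerator is again a
  sum of squares.\<close>

lemma sos_residue_field:
  assumes "z \<in> sos (residue_field R I)"
  shows "\<exists>s\<in>sos R. \<exists>y\<in>D. z = frac_rep R I (s, y \<otimes> y)"
proof -
  interpret K: field "residue_field R I" by (rule residue_field_is_field)
  from assms show ?thesis
  proof (induction z rule: K.sos_induct)
    case zero
    have "\<zero>\<^bsub>residue_field R I\<^esub> = frac_rep R I (\<zero>, \<one> \<otimes> \<one>)" by (simp add: residue_field_zero)
    then show ?case using sos_zero D_one by blast
  next
    case (square_add a z)
    then obtain s y where s: "s \<in> sos R" "y \<in> D" "z = frac_rep R I (s, y \<otimes> y)" by blast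
    obtain u v where uv: "u \<in> carrier R" "v \<in> D" "a = frac_rep R I (u, v)"
      using square_add(1) residue_field_carrierE by metis
    have c: "s \<in> carrier R" "y \<in> carrier R" "v \<in> carrier R" using s uv sos_closed by auto
    have "a \<otimes>\<^bsub>residue_field R I\<^esub> a \<oplus>\<^bsub>residue_field R I\<^esub> z
      = frac_rep R I (u \<otimes> u \<otimes> (y \<otimes> y) \<oplus> s \<otimes> (v \<otimes> v), v \<otimes> v \<otimes> (y \<otimes> y))"
      using s uv c D_mult[of y y] D_mult[of v v] by (simp add: frac_rep_mult frac_rep_add)
    moreover have "v \<otimes> v \<otimes> (y \<otimes> y) = (v \<otimes> y) \<otimes> (v \<otimes> y)" using c by algebra
    moreover have "u \<otimes> u \<otimes> (y \<otimes> y) \<oplus> s \<otimes> (v \<otimes> v) \<in> sos R"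
      using s uv c by (intro sos_add sos_mult sos_square) auto
    ultimately show ?case using D_mult[of v y] s uv by metis
  qed
qed

end

section \<open>A formally real residue field of a formally real ring\<close>

context cring
begin

text \<open>Zorn's lemma gives an ideal \<open>I\<close> maximal among those disjoint from 1 plus
  sums of squares. For \<open>d\<close> outside \<open>I\<close>, the larger ideal generated by
  \<open>I\<close> and \<open>d\<close> meets that set, so \<open>d\<close> divides one of its
  elements modulo \<open>I\<close>. The last clause keeps this fact for the residue field.\<close>

lemma ex_maximal_real_ideal:
  assumes "formally_real R"
  shows "\<exists>I. primeideal I R \<and> (\<forall>s\<in>sos R. \<one> \<oplus> s \<notin> I) \<and>
    (\<forall>d\<in>carrier R - I. \<exists>b\<in>carrier R. \<exists>s\<in>sos R. \<one> \<oplus> s \<ominus> b \<otimes> d \<in> I)"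
proof -
  let ?A = "{I. ideal I R \<and> (\<forall>s\<in>sos R. \<one> \<oplus> s \<notin> I)}"
  have z: "{\<zero>} \<in> ?A"
    using assms zeroideal by (simp add: formally_real_iff)
  have "\<exists>I\<in>?A. \<forall>J\<in>?A. I \<subseteq> J \<longrightarrow> J = I"
  proof (rule subset_Zorn_nonempty)
    fix C assume C: "C \<noteq> {}" "subset.chain ?A C"
    then have "subset.chain {I. ideal I R} C" by (auto simp: subset.chain_def)
    from chain_Union_is_ideal[OF this] C(1) have "ideal (\<Union>C) R" by simp
    moreover have "C \<subseteq> ?A" using C(2) unfolding subset.chain_def by blast
    ultimately show "\<Union>C \<in> ?A" by blast
  qed (use z in blast)
  then obtain I where IA: "I \<in> ?A" and max: "\<forall>J\<in>?A. I \<subseteq> J \<longrightarrow> J = I"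
    by (rule bexE)
  have I: "ideal I R" "\<And>s. s \<in> sos R \<Longrightarrow> \<one> \<oplus> s \<notin> I" using IA by simp_all
  interpret I: ideal I R by fact
  have ex: "\<exists>b\<in>carrier R. \<exists>s\<in>sos R. \<one> \<oplus> s \<ominus> b \<otimes> d \<in> I" if d: "d \<in> carrier R" "d \<notin> I" for d
  proof -
    let ?J = "I <+>\<^bsub>R\<^esub> PIdl d"
    have J: "ideal ?J R" by (intro add_ideals cgenideal_ideal I d)
    interpret P: ideal "PIdl d" R by (rule cgenideal_ideal[OF d(1)])
    have mem: "i \<oplus> j \<in> ?J" if "i \<in> I" "j \<in> PIdl d" for i j
      unfolding set_add_def' using that by (intro UN_I) auto
    have "i \<in> ?J" if "i \<in> I" for i
      using mem[OF that P.zero_closed] I.Icarr[OF that] by simp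
    then have "I \<subseteq> ?J" by blast
    moreover have "d \<in> ?J"
      using mem[OF I.zero_closed cgenideal_self[OF d(1)]] d(1) by simp
    ultimately have "?J \<notin> ?A" using bspec[OF max, of ?J] d by auto
    then obtain s where s: "s \<in> sos R" "\<one> \<oplus> s \<in> ?J" using J by blast
    then obtain i b where i: "i \<in> I" "b \<in> carrier R" "\<one> \<oplus> s = i \<oplus> b \<otimes> d"
      unfolding set_add_def' cgenideal_def by (elim UN_E) blast
    then have "\<one> \<oplus> s \<ominus> b \<otimes> d = i"
      using d I.Icarr[of i] by (simp add: a_minus_def a_assoc r_neg)
    with i(1) have "\<one> \<oplus> s \<ominus> b \<otimes> d \<in> I" by simp
    with i(2) s(1) show ?thesis by blast
  qed
  have "primeideal I R"
  proof (rule primeidealI[OF I(1) is_cring])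
    show "carrier R \<noteq> I" using I(2)[OF sos_zero] by auto
    fix a b assume ab: "a \<in> carrier R" "b \<in> carrier R" "a \<otimes> b \<in> I"
    show "a \<in> I \<or> b \<in> I"
    proof (rule ccontr)
      assume "\<not> ?thesis"
      then have "a \<notin> I" "b \<notin> I" by auto
      from ex[OF ab(1) this(1)] ex[OF ab(2) this(2)] obtain c s c' s'
        where c: "c \<in> carrier R" "s \<in> sos R" "\<one> \<oplus> s \<ominus> c \<otimes> a \<in> I"
          "c' \<in> carrier R" "s' \<in> sos R" "\<one> \<oplus> s' \<ominus> c' \<otimes> b \<in> I" by blast
      have sc: "s \<in> carrier R" "s' \<in> carrier R" using c sos_closed by auto
      \<comment> \<open>Modulo \<open>I\<close>, \<open>1 + s\<close> is \<open>c a\<close> and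
        \<open>1 + s'\<close> is \<open>c' b\<close>. Their product is a multiple of
        \<open>a b\<close> and falls into \<open>I\<close>, although it is again 1 plus a sum of
        squares.\<close>
      have "\<one> \<oplus> (s \<oplus> s' \<oplus> s \<otimes> s') = (\<one> \<oplus> s') \<otimes> (\<one> \<oplus> s \<ominus> c \<otimes> a) \<oplus>
        ((c \<otimes> a) \<otimes> (\<one> \<oplus> s' \<ominus> c' \<otimes> b) \<oplus> (c \<otimes> c') \<otimes> (a \<otimes> b))"
        using sc c(1,4) ab(1,2) by algebra
      also have "\<dots> \<in> I" using sc c ab
        by (intro I.a_closed I.I_l_closed[OF c(3)] I.I_l_closed[OF c(6)] I.I_l_closed[OF ab(3)]) auto
      finally show False using I(2)[of "s \<oplus> s' \<oplus> s \<otimes> s'"] c sos_add sos_mult by blast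
    qed
  qed
  with I(2) ex show ?thesis by auto
qed

lemma ex_hom_formally_real_field:
  assumes "formally_real R"
  shows "\<exists>(K :: ('a \<times> 'a) ring) h. field K \<and> formally_real K \<and> h \<in> ring_hom R K"
proof -
  obtain I where I: "primeideal I R" "\<And>s. s \<in> sos R \<Longrightarrow> \<one> \<oplus> s \<notin> I"
    "\<And>d. d \<in> carrier R - I \<Longrightarrow> \<exists>b\<in>carrier R. \<exists>s\<in>sos R. \<one> \<oplus> s \<ominus> b \<otimes> d \<in> I"
    using ex_maximal_real_ideal[OF assms] by blast
  interpret I: primeideal I R by fact
  let ?K = "residue_field R I"
  interpret K: field ?K by (rule I.residue_field_is_field)
  have "formally_real ?K"
    unfolding formally_real_def
  proof
    assume "\<ominus>\<^bsub>?K\<^esub> \<one>\<^bsub>?K\<^esub> \<in> sos ?K"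
    then obtain s d where s: "s \<in> sos R" "d \<in> carrier R - I"
      and e: "\<ominus>\<^bsub>?K\<^esub> \<one>\<^bsub>?K\<^esub> = frac_rep R I (s, d \<otimes> d)" using I.sos_residue_field by blast
    have c: "s \<in> carrier R" "d \<in> carrier R" using s sos_closed by auto
    have "\<zero>\<^bsub>?K\<^esub> = \<one>\<^bsub>?K\<^esub> \<oplus>\<^bsub>?K\<^esub> frac_rep R I (s, d \<otimes> d)"
      unfolding e[symmetric] by (simp add: K.r_neg)
    also have "\<dots> = frac_rep R I (d \<otimes> d \<oplus> s, d \<otimes> d)"
      using I.D_one I.D_mult[of d d] s c by (simp add: I.residue_field_one I.frac_rep_add)
    finally have "d \<otimes> d \<oplus> s \<in> I"
      using I.frac_rep_eq[of "d \<otimes> d \<oplus> s" "d \<otimes> d" \<zero> \<one>] I.D_one I.D_mult[of d d] s c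
      by (simp add: I.residue_field_zero a_minus_def)
    moreover obtain b t where b: "b \<in> carrier R" "t \<in> sos R" "\<one> \<oplus> t \<ominus> b \<otimes> d \<in> I"
      using I(3)[OF s(2)] by blast
    have tc: "t \<in> carrier R" using b sos_closed by auto
    \<comment> \<open>The equation \<open>-1 = s / d^2\<close> has put \<open>d^2 + s\<close> into
      \<open>I\<close>. Multiplied by \<open>b^2\<close>, where \<open>b d\<close> is
      \<open>1 + t\<close> modulo \<open>I\<close>, it becomes \<open>(1 + t)^2 + b^2 s\<close>,
      which is 1 plus a sum of squares and cannot lie in \<open>I\<close>.\<close>
    have "\<one> \<oplus> (t \<oplus> t \<oplus> t \<otimes> t \<oplus> b \<otimes> b \<otimes> s) =
      (\<one> \<oplus> t \<oplus> b \<otimes> d) \<otimes> (\<one> \<oplus> t \<ominus> b \<otimes> d) \<oplus> (b \<otimes> b) \<otimes> (d \<otimes> d \<oplus> s)"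
      using tc c b(1) by algebra
    ultimately have "\<one> \<oplus> (t \<oplus> t \<oplus> t \<otimes> t \<oplus> b \<otimes> b \<otimes> s) \<in> I"
      using b c tc by (auto intro!: I.a_closed I.I_l_closed)
    moreover have "t \<oplus> t \<oplus> t \<otimes> t \<oplus> b \<otimes> b \<otimes> s \<in> sos R"
      using b s by (intro sos_add sos_mult sos_square) auto
    ultimately show False using I(2) by blast
  qed
  then show ?thesis using K.field_axioms I.residue_field_hom by blast
qed

end

section \<open>Maximal formally real subfields of an algebraically closed field\<close>

lemma (in cring) sos_subring_mono:
  assumes "subcring F R" "subcring F' R" "F \<subseteq> F'" "x \<in> sos (R\<lparr>carrier := F\<rparr>)"
  shows "x \<in> sos (R\<lparr>carrier := F'\<rparr>)"
proof -
  interpret S: cring "R\<lparr>carrier := F\<rparr>" using subcring_iff assms(1) subcringE(1) by blast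
  interpret S': cring "R\<lparr>carrier := F'\<rparr>" using subcring_iff assms(2) subcringE(1) by blast
  from assms(4) show ?thesis
  proof (induction x rule: S.sos_induct)
    case zero then show ?case using S'.sos_zero by simp
  next
    case (square_add a y)
    then show ?case using S'.sos_square_add[of a y] assms(3) by auto
  qed
qed

definition maximal_real_subfield :: "('a, 'm) ring_scheme \<Rightarrow> 'a set \<Rightarrow> bool" where
  "maximal_real_subfield R F \<longleftrightarrow> subfield F R \<and> formally_real (R\<lparr>carrier := F\<rparr>) \<and>
     (\<forall>F'. subfield F' R \<longrightarrow> F \<subseteq> F' \<longrightarrow> formally_real (R\<lparr>carrier := F'\<rparr>) \<longrightarrow> F' = F)"

lemma (in field) subfield_Union_chain:
  assumes C: "C \<noteq> {}" "\<And>F. F \<in> C \<Longrightarrow> subfield F R" "\<And>F G. F \<in> C \<Longrightarrow> G \<in> C \<Longrightarrow> F \<subseteq> G \<or> G \<subseteq> F"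
  shows "subfield (\<Union>C) R"
proof -
  have two: "\<exists>G\<in>C. x \<in> G \<and> y \<in> G" if "x \<in> \<Union>C" "y \<in> \<Union>C" for x y
    using that C(3) by (meson UnionE subsetD)
  have sr: "subring F R" if "F \<in> C" for F using C(2)[OF that] subfieldE(1) by blast
  show ?thesis
  proof (rule subfieldI')
    show "subring (\<Union>C) R"
    proof (rule subringI)
      show "\<Union>C \<subseteq> carrier R" using subringE(1)[OF sr] by blast
      show "\<one> \<in> \<Union>C" using subringE(3)[OF sr] C(1) by blast
      show "\<ominus> h \<in> \<Union>C" if "h \<in> \<Union>C" for h using subringE(5)[OF sr] that by blast
      show "h1 \<otimes> h2 \<in> \<Union>C" if "h1 \<in> \<Union>C" "h2 \<in> \<Union>C" for h1 h2
        using two[OF that] subringE(6)[OF sr] by blast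
      show "h1 \<oplus> h2 \<in> \<Union>C" if "h1 \<in> \<Union>C" "h2 \<in> \<Union>C" for h1 h2
        using two[OF that] subringE(7)[OF sr] by blast
    qed
    show "inv k \<in> \<Union>C" if "k \<in> \<Union>C - {\<zero>}" for k
    proof -
      from that obtain F where F: "F \<in> C" "k \<in> F - {\<zero>}" by blast
      with subfield_m_inv(1)[OF C(2)[OF F(1)] F(2)] show ?thesis by blast
    qed
  qed
qed

text \<open>Zorn's lemma applies because a sum of squares in the union of a chain involves finitely
  many elements, all of them in one member of the chain; a failure of formal reality would already
  occur there.\<close>

lemma (in field) ex_maximal_real_subfield:
  assumes K: "subfield K R" "formally_real (R\<lparr>carrier := K\<rparr>)"
  shows "\<exists>F. K \<subseteq> F \<and> maximal_real_subfield R F"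
proof -
  let ?A = "{F. subfield F R \<and> K \<subseteq> F \<and> formally_real (R\<lparr>carrier := F\<rparr>)}"
  have "\<exists>F\<in>?A. \<forall>G\<in>?A. F \<subseteq> G \<longrightarrow> G = F"
  proof (rule subset_Zorn_nonempty)
    show "?A \<noteq> {}" using K by auto
    fix C assume C: "C \<noteq> {}" "subset.chain ?A C"
    have mem: "subfield F R" "K \<subseteq> F" "formally_real (R\<lparr>carrier := F\<rparr>)" if "F \<in> C" for F
      using C(2) that unfolding subset.chain_def by auto
    have ch: "F \<subseteq> G \<or> G \<subseteq> F" if "F \<in> C" "G \<in> C" for F G
      using C(2) that unfolding subset_chain_def by blast
    have U: "subfield (\<Union>C) R" by (rule subfield_Union_chain[OF C(1) mem(1) ch])
    interpret U: field "R\<lparr>carrier := \<Union>C\<rparr>" using subfield_iff(2)[OF U] .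
    have *: "\<exists>F\<in>C. x \<in> sos (R\<lparr>carrier := F\<rparr>)" if "x \<in> sos (R\<lparr>carrier := \<Union>C\<rparr>)" for x
      using that
    proof (induction x rule: U.sos_induct)
      case zero
      obtain F where F: "F \<in> C" using C(1) by blast
      interpret F: field "R\<lparr>carrier := F\<rparr>" using subfield_iff(2)[OF mem(1)[OF F]] .
      show ?case using F.sos_zero F by auto
    next
      case (square_add a y)
      then obtain F G where F: "F \<in> C" "y \<in> sos (R\<lparr>carrier := F\<rparr>)" and G: "G \<in> C" "a \<in> G" by auto
      obtain H where H: "H \<in> C" "F \<subseteq> H" "G \<subseteq> H" using ch[OF F(1) G(1)] F(1) G(1) by auto
      interpret H: field "R\<lparr>carrier := H\<rparr>" using subfield_iff(2)[OF mem(1)[OF H(1)]] .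
      have "y \<in> sos (R\<lparr>carrier := H\<rparr>)"
        using sos_subring_mono[OF _ _ H(2) F(2)] mem(1) F(1) H(1) subfieldE(2) by blast
      then have "a \<otimes> a \<oplus> y \<in> sos (R\<lparr>carrier := H\<rparr>)"
        using H.sos_square_add[of a y] G(2) H(3) by auto
      then show ?case using H(1) by auto
    qed
    have "formally_real (R\<lparr>carrier := \<Union>C\<rparr>)"
      unfolding U.formally_real_iff
    proof
      fix s assume "s \<in> sos (R\<lparr>carrier := \<Union>C\<rparr>)"
      then obtain F where F: "F \<in> C" "s \<in> sos (R\<lparr>carrier := F\<rparr>)" using * by blast
      interpret F: field "R\<lparr>carrier := F\<rparr>" using subfield_iff(2)[OF mem(1)[OF F(1)]] .
      show "\<one>\<^bsub>R\<lparr>carrier := \<Union> C\<rparr>\<^esub> \<oplus>\<^bsub>R\<lparr>carrier := \<Union> C\<rparr>\<^esub> s \<noteq> \<zero>\<^bsub>R\<lparr>carrier := \<Union> C\<rparr>\<^esub>"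
        using mem(3)[OF F(1)] F(2) unfolding F.formally_real_iff by auto
    qed
    moreover have "K \<subseteq> \<Union>C" using mem(2) C(1) by blast
    ultimately show "\<Union>C \<in> ?A" using U by auto
  qed
  then obtain F where "F \<in> ?A" and max: "\<forall>G\<in>?A. F \<subseteq> G \<longrightarrow> G = F" by (rule bexE)
  then have F: "subfield F R" "K \<subseteq> F" "formally_real (R\<lparr>carrier := F\<rparr>)" by simp_all
  have "F' = F" if "subfield F' R" "F \<subseteq> F'" "formally_real (R\<lparr>carrier := F'\<rparr>)" for F'
    using bspec[OF max, of F'] that F(2) by auto
  with F show ?thesis unfolding maximal_real_subfield_def by blast
qed

text \<open>The assumption \<open>ex_root\<close> says that the ambient field is algebraically
  closed. The lemmas in this locale lead to the real closedness of \<open>F\<close>.\<close>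

locale real_maximal = field R for R (structure) +
  fixes F
  assumes maximal: "maximal_real_subfield R F"
    and ex_root: "\<And>p. p \<in> carrier (poly_ring R) \<Longrightarrow> degree p > 0 \<Longrightarrow> \<exists>r\<in>carrier R. eval p r = \<zero>"
begin

abbreviation S where "S \<equiv> R\<lparr>carrier := F\<rparr>"

lemma subfield_F: "subfield F R"
  using maximal by (simp add: maximal_real_subfield_def)

lemmas subring_F = subfieldE(1)[OF subfield_F]

lemma F_carrier: "x \<in> F \<Longrightarrow> x \<in> carrier R"
  using subringE(1)[OF subring_F] by blast

sublocale S: field S
  by (rule subfield_iff(2)[OF subfield_F])

lemma formally_real_S: "formally_real S"
  using maximal by (simp add: maximal_real_subfield_def)

lemma sos_S_nonzero_add:
  assumes "x \<in> sos S" "x \<noteq> \<zero>" "y \<in> sos S"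
  shows "x \<oplus> y \<in> sos S" "x \<oplus> y \<noteq> \<zero>"
  using assms S.sos_add[of x y] S.formally_real_add_eq_zero[OF formally_real_S, of x y] by auto

lemma one_sos_S_nonzero: "s \<in> sos S \<Longrightarrow> \<one> \<oplus> s \<noteq> \<zero>"
  using formally_real_S unfolding S.formally_real_iff by simp

lemma eval_F: "p \<in> carrier (F[X]) \<Longrightarrow> x \<in> F \<Longrightarrow> eval p x \<in> F"
  using S.eval_in_carrier[of p x] eval_consistent[OF subring_F]
  by (auto simp: univ_poly_carrier[symmetric] polynomial_def)

lemma poly_set: "p \<in> carrier (F[X]) \<Longrightarrow> set p \<subseteq> carrier R"
  using polynomial_in_carrier[OF subring_F] univ_poly_carrier by blast

lemma eval_add_F:
  "p \<in> carrier (F[X]) \<Longrightarrow> q \<in> carrier (F[X]) \<Longrightarrow> x \<in> carrier R \<Longrightarrow>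
    eval (p \<oplus>\<^bsub>F[X]\<^esub> q) x = eval p x \<oplus> eval q x"
  unfolding univ_poly_add by (intro eval_poly_add poly_set)

lemma eval_mult_F:
  "p \<in> carrier (F[X]) \<Longrightarrow> q \<in> carrier (F[X]) \<Longrightarrow> x \<in> carrier R \<Longrightarrow>
    eval (p \<otimes>\<^bsub>F[X]\<^esub> q) x = eval p x \<otimes> eval q x"
  unfolding univ_poly_mult by (intro eval_poly_mult poly_set)

text \<open>Even degree at most \<open>n\<close>, with a nonzero sum of squares as leading
  coefficient. The form with \<open>coeff\<close> suits addition: coefficients add up, while the
  degree of a sum is known only once cancellation is excluded.\<close>

definition sos_led :: "nat \<Rightarrow> 'a list \<Rightarrow> bool" where
  "sos_led n p \<longleftrightarrow> (\<exists>e. even e \<and> e \<le> n \<and> coeff p e \<in> sos S \<and> coeff p e \<noteq> \<zero> \<and> (\<forall>i>e. coeff p i = \<zero>))"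

text \<open>Leading terms cannot cancel: in equal degree, both leading coefficients are nonzero sums
  of squares in a formally real field.\<close>

lemma sos_led_add:
  assumes "p \<in> carrier (F[X])" "q \<in> carrier (F[X])" "sos_led n p" "sos_led n q"
  shows "sos_led n (p \<oplus>\<^bsub>F[X]\<^esub> q)"
proof -
  have cf: "coeff (p \<oplus>\<^bsub>F[X]\<^esub> q) i = coeff p i \<oplus> coeff q i" for i
    using poly_add_coeff[OF poly_set poly_set] assms by (simp add: univ_poly_add)
  have c: "coeff p i \<in> carrier R" "coeff q i \<in> carrier R" for i
    using poly_set assms coeff_in_carrier by auto
  obtain d where d: "even d" "d \<le> n" "coeff p d \<in> sos S" "coeff p d \<noteq> \<zero>" "\<And>i. i > d \<Longrightarrow> coeff p i = \<zero>"
    using assms unfolding sos_led_def by blast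
  obtain e where e: "even e" "e \<le> n" "coeff q e \<in> sos S" "coeff q e \<noteq> \<zero>" "\<And>i. i > e \<Longrightarrow> coeff q i = \<zero>"
    using assms unfolding sos_led_def by blast
  consider "d < e" | "d = e" | "e < d" by linarith
  then show ?thesis
  proof cases
    case 1
    then show ?thesis unfolding sos_led_def cf using c d e by (intro exI[of _ e]) auto
  next
    case 2
    then show ?thesis unfolding sos_led_def cf
      using c d e sos_S_nonzero_add by (intro exI[of _ e]) auto
  next
    case 3
    then show ?thesis unfolding sos_led_def cf using c d e by (intro exI[of _ d]) auto
  qed
qed

lemma sos_led_square:
  assumes p: "p \<in> carrier (F[X])" "p \<noteq> []" "2 * degree p \<le> n"
  shows "sos_led n (p \<otimes>\<^bsub>F[X]\<^esub> p)"
proof -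
  have pp: "polynomial F p" using p univ_poly_carrier by blast
  have deg: "degree (p \<otimes>\<^bsub>F[X]\<^esub> p) = 2 * degree p"
    using poly_mult_degree_eq[OF subring_F pp pp] p by (simp add: univ_poly_mult)
  have lc: "lead_coeff (p \<otimes>\<^bsub>F[X]\<^esub> p) = lead_coeff p \<otimes> lead_coeff p"
    using poly_mult_lead_coeff[OF subring_F pp pp] p by (simp add: univ_poly_mult)
  have ne: "p \<otimes>\<^bsub>F[X]\<^esub> p \<noteq> []"
    using poly_mult_integral[OF subring_F pp pp] p by (auto simp: univ_poly_mult)
  have l: "lead_coeff p \<in> F" "lead_coeff p \<noteq> \<zero>" using pp p(2) by (auto simp: polynomial_def)
  have "coeff (p \<otimes>\<^bsub>F[X]\<^esub> p) (2 * degree p) = lead_coeff p \<otimes> lead_coeff p"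
    using lead_coeff_simp[OF ne] unfolding deg lc .
  moreover have "lead_coeff p \<otimes> lead_coeff p \<in> sos S" using S.sos_square[of "lead_coeff p"] l by simp
  moreover have "lead_coeff p \<otimes> lead_coeff p \<noteq> \<zero>" using l F_carrier integral by blast
  ultimately show ?thesis unfolding sos_led_def using p(3) coeff_degree[of "p \<otimes>\<^bsub>F[X]\<^esub> p"] deg
    by (intro exI[of _ "2 * degree p"]) auto
qed

text \<open>Leads back from coefficients to the degree and the head of a normalized list.\<close>

lemma sos_ledD:
  assumes "p \<in> carrier (F[X])" "sos_led n p"
  shows "p \<noteq> []" "even (degree p)" "degree p \<le> n" "lead_coeff p \<in> sos S"
proof -
  obtain e where e: "even e" "e \<le> n" "coeff p e \<in> sos S" "coeff p e \<noteq> \<zero>" "\<And>i. i > e \<Longrightarrow> coeff p i = \<zero>"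
    using assms unfolding sos_led_def by blast
  show ne: "p \<noteq> []" using e(4) by auto
  have "lead_coeff p \<noteq> \<zero>" using assms(1) ne by (simp add: univ_poly_carrier[symmetric] polynomial_def)
  then have "degree p \<le> e" using e(5)[of "degree p"] lead_coeff_simp[OF ne] by (metis leI)
  moreover have "e \<le> degree p" using e(4) coeff_degree[of p e] by (metis leI)
  ultimately have "degree p = e" by simp
  then show "even (degree p)" "degree p \<le> n" "lead_coeff p \<in> sos S"
    using e lead_coeff_simp[OF ne] by auto
qed

text \<open>By maximality, \<open>F(r)\<close> is not formally real: \<open>0 = 1 + \<Sum> p\<^sub>i(r)\<^sup>2\<close>, where the \<open>p\<^sub>i\<close> may be
  reduced modulo \<open>f\<close>. Take \<open>h = 1 + \<Sum> p\<^sub>i\<^sup>2\<close>.\<close>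
lemma ex_sos_poly:
  assumes r: "r \<in> carrier R" "r \<notin> F" and f: "f \<in> carrier (F[X])" "f \<noteq> []" "eval f r = \<zero>"
  shows "\<exists>h\<in>carrier (F[X]). eval h r = \<zero> \<and> h \<noteq> [] \<and> even (degree h) \<and> degree h \<le> 2 * (degree f - 1) \<and>
    lead_coeff h \<in> sos S \<and> (\<forall>x\<in>F. \<exists>s\<in>sos S. eval h x = \<one> \<oplus> s)"
proof -
  interpret UP: domain "F[X]" using univ_poly_is_domain[OF subring_F] .
  let ?G = "simple_extension F r"
  \<comment> \<open>Nonzero remainders modulo \<open>f\<close> have degree at most
    \<open>degree f - 1\<close>; this bounds the degree of their squares.\<close>
  let ?n = "2 * (degree f - 1)"
  have "(algebraic over F) r" using algebraicI[OF f] by (simp add: over_def)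
  then have G: "subfield ?G R" using simple_extension_is_subfield[OF subfield_F r(1)] by simp
  interpret G: field "R\<lparr>carrier := ?G\<rparr>" using subfield_iff(2)[OF G] .
  have "F \<subseteq> ?G" using simple_extension_incl[OF subringE(1)[OF subring_F] r(1)] .
  moreover have "r \<in> ?G" using simple_extension_mem[OF subring_F r(1)] .
  ultimately have "\<not> formally_real (R\<lparr>carrier := ?G\<rparr>)"
    using maximal G r(2) unfolding maximal_real_subfield_def by blast
  then obtain s where s: "s \<in> sos (R\<lparr>carrier := ?G\<rparr>)" "\<one> \<oplus> s = \<zero>"
    unfolding G.formally_real_iff by auto
  from s(1) have "\<exists>g\<in>carrier (F[X]). eval g r = s \<and> (g = [] \<or> sos_led ?n g) \<and> (\<forall>x\<in>F. eval g x \<in> sos S)"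
  proof (induction s rule: G.sos_induct)
    case zero
    then show ?case using UP.zero_closed S.sos_zero by (intro bexI[of _ "[]"]) (auto simp: univ_poly_zero)
  next
    case (square_add a y)
    then obtain g where g: "g \<in> carrier (F[X])" "eval g r = y" "g = [] \<or> sos_led ?n g"
      "\<And>x. x \<in> F \<Longrightarrow> eval g x \<in> sos S" by blast
    obtain p0 where p0: "p0 \<in> carrier (F[X])" "a = eval p0 r"
      using square_add(1) simple_extension_as_eval_img[OF subringE(1)[OF subring_F] r(1)] by auto
    define p where "p = p0 pmod f"
    have p: "p \<in> carrier (F[X])" unfolding p_def using long_division_closed[OF subfield_F p0(1) f(1)] by blast
    have q: "p0 pdiv f \<in> carrier (F[X])" using long_division_closed[OF subfield_F p0(1) f(1)] by blast
    have "a = eval ((f \<otimes>\<^bsub>F[X]\<^esub> (p0 pdiv f)) \<oplus>\<^bsub>F[X]\<^esub> p) r"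
      unfolding p_def p0(2) using pdiv_pmod[OF subfield_F p0(1) f(1)] by simp
    also have "\<dots> = eval p r"
      using p q f r poly_set eval_in_carrier by (simp add: eval_add_F eval_mult_F)
    finally have a: "a = eval p r" .
    have deg: "p = [] \<or> 2 * degree p \<le> ?n"
      using pmod_degree[OF subfield_F p0(1) f(1,2)] unfolding p_def by auto
    let ?h = "(p \<otimes>\<^bsub>F[X]\<^esub> p) \<oplus>\<^bsub>F[X]\<^esub> g"
    have h: "?h \<in> carrier (F[X])" using p g by simp
    moreover have "eval ?h r = a \<otimes> a \<oplus> y" using p g r a by (simp add: eval_add_F eval_mult_F)
    moreover have "?h = [] \<or> sos_led ?n ?h"
    proof (cases "p = []")
      case True
      then have "?h = g" using g(1) by (simp add: univ_poly_zero[symmetric, of R F])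
      with g show ?thesis by simp
    next
      case False
      then have pp: "sos_led ?n (p \<otimes>\<^bsub>F[X]\<^esub> p)" using sos_led_square p deg by blast
      show ?thesis
      proof (cases "g = []")
        case True
        then have "?h = p \<otimes>\<^bsub>F[X]\<^esub> p" using p by (simp add: univ_poly_zero[symmetric, of R F])
        with pp show ?thesis by simp
      next
        case False
        with g pp p show ?thesis using sos_led_add[of "p \<otimes>\<^bsub>F[X]\<^esub> p" g ?n] by auto
      qed
    qed
    moreover have "eval ?h x \<in> sos S" if "x \<in> F" for x
      using p g(1) g(4)[OF that] that F_carrier S.sos_square_add[of "eval p x" "eval g x"] eval_F[OF p that]
      by (simp add: eval_add_F eval_mult_F)
    ultimately show ?case by auto
  qed
  then obtain g where g: "g \<in> carrier (F[X])" "eval g r = s" "g = [] \<or> sos_led ?n g"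
    "\<And>x. x \<in> F \<Longrightarrow> eval g x \<in> sos S" by blast
  have o: "\<one>\<^bsub>F[X]\<^esub> = [\<one>]" by (simp add: univ_poly_one)
  have oc: "[\<one>] \<in> carrier (F[X])" using UP.one_closed unfolding o .
  have "sos_led ?n ([\<one>] \<otimes>\<^bsub>F[X]\<^esub> [\<one>])" by (rule sos_led_square[OF oc]) auto
  then have o1: "sos_led ?n [\<one>]" using UP.r_one[OF UP.one_closed] unfolding o by simp
  let ?h = "[\<one>] \<oplus>\<^bsub>F[X]\<^esub> g"
  have h: "?h \<in> carrier (F[X])" using oc g by simp
  have "sos_led ?n ?h"
  proof (cases "g = []")
    case True
    then have "?h = [\<one>]" using oc by (simp add: univ_poly_zero[symmetric, of R F])
    with o1 show ?thesis by simp
  next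
    case False
    with g o1 oc show ?thesis using sos_led_add[of "[\<one>]" g ?n] by auto
  qed
  note hD = sos_ledD[OF h this]
  have ev: "eval ?h x = \<one> \<oplus> eval g x" if "x \<in> carrier R" for x
    using that oc g(1) by (simp add: eval_add_F)
  show ?thesis
    using h hD ev[OF r(1)] g(2) s(2) ev g(4) F_carrier by (intro bexI[of _ ?h]) auto
qed

text \<open>Let \<open>r\<close> be a square root of \<open>a\<close>, which lies outside
  \<open>F\<close>. The polynomial from \<open>ex_sos_poly\<close> has degree 0 or 2. A nonzero
  constant has no root, and for \<open>x X^2 + y X + z\<close> the relation
  \<open>y r = -(x a + z)\<close> forces \<open>y = 0\<close>. Then \<open>x (-a) = z\<close>, where
  \<open>x\<close> and the value \<open>z\<close> at 0 are sums of squares, and division by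
  \<open>x\<close> gives the claim.\<close>

lemma F_square_or_minus_sos:
  assumes a: "a \<in> F" "\<And>y. y \<in> F \<Longrightarrow> a \<noteq> y \<otimes> y"
  shows "\<ominus> a \<in> sos S"
proof -
  let ?f = "[\<one>, \<zero>, \<ominus> a]"
  have ac: "a \<in> carrier R" "\<ominus> a \<in> F" using a F_carrier subringE(5)[OF subring_F] by auto
  have f: "?f \<in> carrier (F[X])"
    using ac subringE(2,3)[OF subring_F] by (auto simp: univ_poly_carrier[symmetric] polynomial_def)
  then have "?f \<in> carrier (poly_ring R)" using carrier_polynomial_shell[OF subring_F] by blast
  from ex_root[OF this] obtain r where r: "r \<in> carrier R" "eval ?f r = \<zero>" by auto
  then have "r \<otimes> r \<ominus> a = \<zero>" using ac by (simp add: numeral_2_eq_2 a_minus_def)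
  then have rr: "r \<otimes> r = a" using r ac by simp
  then have "r \<notin> F" using a(2) by blast
  from ex_sos_poly[OF r(1) this f _ r(2)] obtain h where h: "h \<in> carrier (F[X])" "eval h r = \<zero>"
    "h \<noteq> []" "even (degree h)" "degree h \<le> 2" "lead_coeff h \<in> sos S"
    "\<And>x. x \<in> F \<Longrightarrow> \<exists>s\<in>sos S. eval h x = \<one> \<oplus> s" by auto
  have "degree h \<noteq> 1" using h(4) by (metis odd_one)
  then have "length h = 1 \<or> length h = 3" using h(3,5) by (cases h) (auto simp: le_Suc_eq numeral_2_eq_2)
  then show ?thesis
  proof
    assume "length h = 1"
    then obtain c where "h = [c]" by (auto simp: length_Suc_conv)
    then have "c = \<zero>" "c \<noteq> \<zero>" using h(1,2) F_carrier by (auto simp: univ_poly_carrier[symmetric] polynomial_def)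
    then show ?thesis by simp
  next
    assume "length h = 3"
    then obtain x y z where e: "h = [x, y, z]" by (auto simp: numeral_3_eq_3 length_Suc_conv)
    have c: "x \<in> F" "y \<in> F" "z \<in> F" "x \<noteq> \<zero>" "x \<in> sos S"
      using h(1,6) unfolding e by (auto simp: univ_poly_carrier[symmetric] polynomial_def)
    have cc: "x \<in> carrier R" "y \<in> carrier R" "z \<in> carrier R" using c F_carrier by auto
    have 0: "x \<otimes> a \<oplus> (y \<otimes> r \<oplus> z) = \<zero>"
      using h(2) cc r(1) unfolding e by (simp add: numeral_2_eq_2 rr)
    have "y \<otimes> r \<oplus> (x \<otimes> a \<oplus> z) = x \<otimes> a \<oplus> (y \<otimes> r \<oplus> z)" using cc r(1) ac(1) by algebra
    then have 1: "y \<otimes> r = \<ominus> (x \<otimes> a \<oplus> z)"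
      using 0 cc r(1) ac(1) by (intro minus_equality[symmetric]) auto
    have F1: "\<ominus> (x \<otimes> a \<oplus> z) \<in> F" 
      by (intro subringE(5)[OF subring_F] subringE(6)[OF subring_F] subringE(7)[OF subring_F] c a(1))
    have y0: "y = \<zero>"
    proof (rule ccontr)
      assume "y \<noteq> \<zero>"
      then have "r \<in> F" using subfield_m_inv_simprule[OF subfield_F, of y r] c r(1) F1 unfolding 1 by auto
      with \<open>r \<notin> F\<close> show False ..
    qed
    have "z \<oplus> x \<otimes> a = \<zero>" using 0 cc r(1) ac(1) unfolding y0 by (simp add: a_comm)
    then have xa: "x \<otimes> \<ominus> a = z" using minus_equality[of z "x \<otimes> a"] cc ac(1) by (simp add: r_minus)
    have "eval h \<zero> = z" unfolding e using cc by (simp add: numeral_2_eq_2)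
    with h(7)[of \<zero>] subringE(2)[OF subring_F] obtain s where s: "s \<in> sos S" "z = \<one> \<oplus> s" by auto
    have z: "z \<in> sos S" using S.sos_add[OF S.sos_one s(1)] s(2) by simp
    have i: "inv x \<in> F" "x \<otimes> inv x = \<one>" using subfield_m_inv[OF subfield_F, of x] c by auto
    have ic: "inv x \<in> carrier R" using i F_carrier by blast
    have "inv x \<otimes> inv x \<otimes> (x \<otimes> z) = (x \<otimes> inv x) \<otimes> (x \<otimes> inv x) \<otimes> \<ominus> a"
      unfolding xa[symmetric] using ic cc ac by algebra
    also have "\<dots> = \<ominus> a" using i ac by simp
    finally show ?thesis
      using S.sos_square_mult[of "x \<otimes> z" "inv x"] S.sos_mult[OF c(5) z] i by simp
  qed
qed

text \<open>If neither were a square, \<open>a\<close> and \<open>-a\<close> would both be sums of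
  squares with sum zero. Then \<open>-a\<close> vanishes and is a square after all.\<close>

lemma F_squares:
  assumes a: "a \<in> F"
  shows "\<exists>y\<in>F. a = y \<otimes> y \<or> \<ominus> a = y \<otimes> y"
proof (rule ccontr)
  assume n: "\<not> ?thesis"
  have ac: "a \<in> carrier R" "\<ominus> a \<in> F" using a F_carrier subringE(5)[OF subring_F] by auto
  have "\<ominus> a \<in> sos S" using F_square_or_minus_sos[OF a] n by blast
  moreover have "\<ominus> (\<ominus> a) \<in> sos S" using F_square_or_minus_sos[OF ac(2)] n by blast
  moreover have "\<ominus> a \<oplus> \<ominus> (\<ominus> a) = \<zero>" using ac by (simp add: l_neg)
  ultimately have "\<ominus> a = \<zero>" using S.formally_real_add_eq_zero[OF formally_real_S, of "\<ominus> a" "\<ominus> (\<ominus> a)"] by simp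
  then have "\<ominus> a = \<zero> \<otimes> \<zero>" by simp
  with n subringE(2)[OF subring_F] show False by blast
qed

text \<open>Induction on the degree. The minimal polynomial \<open>m\<close> of a root outside
  \<open>F\<close> divides \<open>f\<close>. If the cofactor is not constant, one of the two factors
  has smaller odd degree. Otherwise \<open>m\<close> has the degree of \<open>f\<close> and divides
  the polynomial \<open>h\<close> of \<open>ex_sos_poly\<close>; the cofactor \<open>q\<close> of
  \<open>h\<close> has odd degree below that of \<open>f\<close>, hence a root in \<open>F\<close>,
  where \<open>h\<close> takes a nonzero value \<open>1 + s\<close>.\<close>

lemma F_odd_root:
  assumes "f \<in> carrier (F[X])" "odd (degree f)"
  shows "\<exists>x\<in>F. eval f x = \<zero>"
  using assms
proof (induction "degree f" arbitrary: f rule: less_induct)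
  case less
  interpret UP: domain "F[X]" using univ_poly_is_domain[OF subring_F] .
  have "degree f \<noteq> 0" using less.prems(2) by (metis even_zero)
  then have f: "f \<in> carrier (F[X])" "f \<noteq> []" "degree f > 0" using less.prems by auto
  then have "f \<in> carrier (poly_ring R)" using carrier_polynomial_shell[OF subring_F] by blast
  from ex_root[OF this f(3)] obtain r where r: "r \<in> carrier R" "eval f r = \<zero>" by blast
  show ?case
  proof (cases "r \<in> F")
    case False
    have alg: "(algebraic over F) r" using algebraicI[OF f(1,2) r(2)] by (simp add: over_def)
    let ?m = "Irr F r"
    note m = IrrE[OF subfield_F r(1) alg]
    have mdeg: "degree ?m \<ge> 1" using pirreducible_degree[OF subfield_F m(1,2)] .
    have fac: "\<exists>k\<in>carrier (F[X]). g = ?m \<otimes>\<^bsub>F[X]\<^esub> k \<and> k \<noteq> [] \<and> degree g = degree ?m + degree k"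
      if g: "g \<in> carrier (F[X])" "g \<noteq> []" "eval g r = \<zero>" for g
    proof -
      have "?m divides\<^bsub>F[X]\<^esub> g"
        using Irr_minimal[OF subfield_F r(1) alg g(1,3)] pdivides_iff_shell[OF subfield_F m(1) g(1)] by blast
      then obtain k where k: "k \<in> carrier (F[X])" "g = ?m \<otimes>\<^bsub>F[X]\<^esub> k" by (auto simp: factor_def)
      have "k \<noteq> []" "?m \<noteq> []" using g(2) k(2) UP.r_null[OF m(1)] UP.l_null[OF k(1)]
        by (auto simp: univ_poly_zero)
      then show ?thesis using k poly_mult_degree_eq[OF subring_F, of ?m k] m(1)
        by (auto simp: univ_poly_mult univ_poly_carrier)
    qed
    from fac[OF f(1,2) r(2)] obtain k where k: "k \<in> carrier (F[X])" "f = ?m \<otimes>\<^bsub>F[X]\<^esub> k" "k \<noteq> []"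
      "degree f = degree ?m + degree k" by blast
    have ev: "eval f x = eval ?m x \<otimes> eval k x" if "x \<in> carrier R" for x
      using k m(1) that by (simp add: eval_mult_F)
    show ?thesis
    proof (cases "degree k = 0")
      case False
      have "odd (degree ?m) \<or> odd (degree k)" using k(4) less.prems(2) by auto
      moreover have "degree ?m < degree f" "degree k < degree f" using k(4) False mdeg by linarith+
      ultimately have "\<exists>x\<in>F. eval ?m x = \<zero> \<or> eval k x = \<zero>"
        using less.hyps[OF _ m(1)] less.hyps[OF _ k(1)] by blast
      then show ?thesis
        using ev F_carrier eval_in_carrier[OF poly_set[OF m(1)]] eval_in_carrier[OF poly_set[OF k(1)]]
        by (metis l_null r_null)
    next
      case True
      then have md: "degree ?m = degree f" using k(4) by simp
      from ex_sos_poly[OF r(1) False f(1,2) r(2)] obtain h where h: "h \<in> carrier (F[X])" "eval h r = \<zero>"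
        "h \<noteq> []" "even (degree h)" "degree h \<le> 2 * (degree f - 1)"
        "\<And>x. x \<in> F \<Longrightarrow> \<exists>s\<in>sos S. eval h x = \<one> \<oplus> s" by blast
      from fac[OF h(1,3,2)] obtain q where q: "q \<in> carrier (F[X])" "h = ?m \<otimes>\<^bsub>F[X]\<^esub> q"
        "degree h = degree ?m + degree q" by blast
      have "odd (degree q)" using h(4) q(3) md less.prems(2) by (metis even_add)
      moreover have "degree q < degree f" using h(5) q(3) md f(3) by linarith
      ultimately obtain x where x: "x \<in> F" "eval q x = \<zero>" using less.hyps[of q] q(1) by blast
      then have "eval h x = \<zero>"
        using q m(1) F_carrier eval_in_carrier[OF poly_set[OF m(1)]] by (simp add: eval_mult_F)
      with h(6)[OF x(1)] one_sos_S_nonzero show ?thesis by metis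
    qed
  qed (use r in blast)
qed

end

text \<open>Polynomials are lists with the leading coefficient first, hence the reversed range. This
  matches them with the finite sums in \<open>real_closed_field\<close>.\<close>

lemma (in ring) eval_map_rev_upt:
  assumes "c \<in> {..<n} \<rightarrow> carrier R" "x \<in> carrier R"
  shows "eval (map c (rev [0..<n])) x = (\<Oplus>i\<in>{..<n}. c i \<otimes> x [^] i)"
  using assms(1)
proof (induction n)
  case (Suc n)
  then have c: "c \<in> {..<n} \<rightarrow> carrier R" "c n \<in> carrier R" by auto
  then have "(\<Oplus>i\<in>{..<Suc n}. c i \<otimes> x [^] i) = c n \<otimes> x [^] n \<oplus> (\<Oplus>i\<in>{..<n}. c i \<otimes> x [^] i)"
    unfolding lessThan_Suc using assms(2) by (subst finsum_insert) auto
  then show ?case using Suc.IH[OF c(1)] by simp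
qed simp

theorem (in real_maximal) real_closed_field_F: "real_closed_field S"
  unfolding real_closed_field_def
proof (intro conjI ballI allI impI)
  show "field S" by (rule S.field_axioms)
  show "\<ominus>\<^bsub>S\<^esub> \<one>\<^bsub>S\<^esub> \<notin> sos S" using formally_real_S by (simp add: formally_real_def)
next
  fix x assume x: "x \<in> carrier S"
  then have x': "x \<in> F" "x \<in> carrier R" using F_carrier by auto
  \<comment> \<open>The additive inverse in \<open>S\<close> is defined within \<open>F\<close> and
    has to be identified with the ambient one.\<close>
  have "\<ominus>\<^bsub>S\<^esub> x = \<ominus> x"
    using x' subringE(5)[OF subring_F] by (intro S.minus_equality) (auto simp: l_neg)
  then show "\<exists>y\<in>carrier S. x = y \<otimes>\<^bsub>S\<^esub> y \<or> \<ominus>\<^bsub>S\<^esub> x = y \<otimes>\<^bsub>S\<^esub> y"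
    using F_squares[of x] x by simp
next
  fix d :: nat and c
  assume d: "odd d" "c \<in> {..d} \<rightarrow> carrier S" "c d \<noteq> \<zero>\<^bsub>S\<^esub>"
  let ?f = "map c (rev [0..<Suc d])"
  have "?f \<in> carrier (F[X])" using d(2,3) by (auto simp: univ_poly_carrier[symmetric] polynomial_def)
  then obtain x where x: "x \<in> F" "eval ?f x = \<zero>" using F_odd_root[of ?f] d(1) by auto
  have "(\<Oplus>\<^bsub>S\<^esub>i\<in>{..<Suc d}. c i \<otimes>\<^bsub>S\<^esub> x [^]\<^bsub>S\<^esub> i) = S.eval ?f x"
    using d(2) x(1) by (intro S.eval_map_rev_upt[symmetric]) (auto simp: Pi_def)
  then show "\<exists>x\<in>carrier S. (\<Oplus>\<^bsub>S\<^esub>i\<in>{..d}. c i \<otimes>\<^bsub>S\<^esub> x [^]\<^bsub>S\<^esub> i) = \<zero>\<^bsub>S\<^esub>"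
    using x eval_consistent[OF subring_F] by (auto simp: lessThan_Suc_atMost)
qed

section \<open>Homomorphisms into real closed fields\<close>

text \<open>Transport of structure, needed to bring a real closed field found in an algebraic
  closure to the type over which \<open>pos_def\<close> quantifies.\<close>

lemma real_closed_field_iso:
  assumes S: "real_closed_field S" and T: "field T" and g: "g \<in> ring_iso S T"
  shows "real_closed_field T"
proof -
  interpret S: field S using S by (simp add: real_closed_field_def)
  interpret T: field T by fact
  let ?f = "inv_into (carrier S) g"
  have f: "?f \<in> ring_iso T S" using ring_iso_set_sym[OF S.ring_axioms g] .
  have bij: "bij_betw g (carrier S) (carrier T)" using g by (simp add: ring_iso_def)
  have gf: "g (?f x) = x" if "x \<in> carrier T" for x
    using bij_betw_inv_into_right[OF bij that] .
  interpret g: ring_hom_cring S T g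
    by unfold_locales (use g in \<open>simp add: ring_iso_def\<close>)
  interpret f: ring_hom_cring T S ?f
    by unfold_locales (use f in \<open>simp add: ring_iso_def\<close>)
  show ?thesis unfolding real_closed_field_def
  proof (intro conjI ballI allI impI)
    show "\<ominus>\<^bsub>T\<^esub> \<one>\<^bsub>T\<^esub> \<notin> sos T"
      using f.hom_sos[of "\<ominus>\<^bsub>T\<^esub> \<one>\<^bsub>T\<^esub>"] S by (auto simp: real_closed_field_def)
  next
    fix x assume x: "x \<in> carrier T"
    then obtain y where y: "y \<in> carrier S" "?f x = y \<otimes>\<^bsub>S\<^esub> y \<or> \<ominus>\<^bsub>S\<^esub> ?f x = y \<otimes>\<^bsub>S\<^esub> y"
      using S unfolding real_closed_field_def by (meson f.hom_closed)
    have "g (?f x) = g y \<otimes>\<^bsub>T\<^esub> g y \<or> g (\<ominus>\<^bsub>S\<^esub> ?f x) = g y \<otimes>\<^bsub>T\<^esub> g y"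
      using y g.hom_mult[OF y(1) y(1)] by metis
    then show "\<exists>y\<in>carrier T. x = y \<otimes>\<^bsub>T\<^esub> y \<or> \<ominus>\<^bsub>T\<^esub> x = y \<otimes>\<^bsub>T\<^esub> y"
      using x y(1) gf[OF x] by auto
  next
    fix d :: nat and c
    assume d: "odd d" "c \<in> {..d} \<rightarrow> carrier T" "c d \<noteq> \<zero>\<^bsub>T\<^esub>"
    let ?c = "?f \<circ> c"
    have c: "?c \<in> {..d} \<rightarrow> carrier S" using d(2) f.hom_closed by (auto simp: Pi_def)
    have "?c d \<noteq> \<zero>\<^bsub>S\<^esub>"
    proof
      assume "?c d = \<zero>\<^bsub>S\<^esub>"
      then have "g (?f (c d)) = \<zero>\<^bsub>T\<^esub>" by simp
      with gf[of "c d"] d show False by auto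
    qed
    then obtain x where x: "x \<in> carrier S" "(\<Oplus>\<^bsub>S\<^esub>i\<in>{..d}. ?c i \<otimes>\<^bsub>S\<^esub> x [^]\<^bsub>S\<^esub> i) = \<zero>\<^bsub>S\<^esub>"
      using S d(1) c unfolding real_closed_field_def by blast
    have pw: "g (x [^]\<^bsub>S\<^esub> i) = g x [^]\<^bsub>T\<^esub> i" for i :: nat
      by (induction i) (use x in auto)
    have "(\<Oplus>\<^bsub>T\<^esub>i\<in>{..d}. c i \<otimes>\<^bsub>T\<^esub> g x [^]\<^bsub>T\<^esub> i)
        = (\<Oplus>\<^bsub>T\<^esub>i\<in>{..d}. (g \<circ> (\<lambda>i. ?c i \<otimes>\<^bsub>S\<^esub> x [^]\<^bsub>S\<^esub> i)) i)"
      using c d(2) x(1) by (intro T.finsum_cong') (auto simp: pw gf Pi_def)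
    also have "\<dots> = g (\<Oplus>\<^bsub>S\<^esub>i\<in>{..d}. ?c i \<otimes>\<^bsub>S\<^esub> x [^]\<^bsub>S\<^esub> i)"
      using c x(1) by (intro g.hom_finsum[symmetric]) (auto simp: Pi_def)
    also have "\<dots> = \<zero>\<^bsub>T\<^esub>" using x(2) by simp
    finally show "\<exists>x\<in>carrier T. (\<Oplus>\<^bsub>T\<^esub>i\<in>{..d}. c i \<otimes>\<^bsub>T\<^esub> x [^]\<^bsub>T\<^esub> i) = \<zero>\<^bsub>T\<^esub>"
      using x(1) by blast
  qed (rule T)
qed

text \<open>The copy of the field in its algebraic closure \<open>L\<close> is formally real, since
  its sums of squares lift and \<open>indexed_const\<close> is injective. A maximal formally real
  subfield of \<open>L\<close> above the copy is real closed.\<close>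

lemma (in field) ex_embedding_real_closed_field:
  assumes fr: "formally_real R"
  shows "\<exists>(S :: (('a list \<times> nat) multiset \<Rightarrow> 'a) ring) h. real_closed_field S \<and> h \<in> ring_hom R S"
proof -
  obtain L :: "(('a list \<times> nat) multiset \<Rightarrow> 'a) ring"
    where L: "algebraic_closure L (indexed_const ` carrier R)" and hom: "indexed_const \<in> ring_hom R L"
    using exists_closure by blast
  interpret L: algebraic_closure L "indexed_const ` carrier R" by fact
  let ?K = "indexed_const ` carrier R"
  interpret h: ring_hom_cring R L indexed_const by unfold_locales (rule hom)
  have K: "subfield ?K L" by (rule L.subfield_axioms)
  interpret K: field "L\<lparr>carrier := ?K\<rparr>" by (rule L.subfield_iff(2)[OF K])
  have lift: "\<exists>y\<in>sos R. x = indexed_const y" if "x \<in> sos (L\<lparr>carrier := ?K\<rparr>)" for x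
    using that
  proof (induction x rule: K.sos_induct)
    case zero
    then show ?case using sos_zero h.hom_zero by (intro bexI[of _ \<zero>]) auto
  next
    case (square_add a y)
    then obtain a' y' where "a' \<in> carrier R" "a = indexed_const a'" "y' \<in> sos R" "y = indexed_const y'" by auto
    then show ?case using sos_closed[of y'] by (intro bexI[of _ "a' \<otimes> a' \<oplus> y'"]) (auto intro: sos_square_add)
  qed
  have "formally_real (L\<lparr>carrier := ?K\<rparr>)"
    unfolding K.formally_real_iff
  proof
    fix s assume "s \<in> sos (L\<lparr>carrier := ?K\<rparr>)"
    then obtain y where y: "y \<in> sos R" "s = indexed_const y" using lift by blast
    then have "\<one> \<oplus> y \<noteq> \<zero>" using fr formally_real_iff by blast
    then have "indexed_const (\<one> \<oplus> y) \<noteq> (indexed_const \<zero> :: ('a list \<times> nat) multiset \<Rightarrow> 'a)"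
      by (simp add: inj_eq[OF indexed_const_is_inj] del: h.hom_zero)
    then show "\<one>\<^bsub>L\<lparr>carrier := ?K\<rparr>\<^esub> \<oplus>\<^bsub>L\<lparr>carrier := ?K\<rparr>\<^esub> s \<noteq> \<zero>\<^bsub>L\<lparr>carrier := ?K\<rparr>\<^esub>"
      using h.hom_add[OF one_closed sos_closed[OF y(1)]] h.hom_one h.hom_zero y(2) by simp
  qed
  then obtain F where F: "?K \<subseteq> F" "maximal_real_subfield L F"
    using L.ex_maximal_real_subfield[OF K] by blast
  interpret M: real_maximal L F
  proof
    fix p assume p: "p \<in> carrier (poly_ring L)" "degree p > 0"
    \<comment> \<open>Polynomials split over \<open>L\<close>: there are as many roots as the
      degree, so a positive degree yields a root.\<close>
    have "size (L.roots p) = degree p" using L.roots_over_carrier[OF p(1)] by (simp add: L.splitted_def)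
    then have "L.roots p \<noteq> {#}" using p(2) by auto
    then obtain r where "r \<in># L.roots p" by blast
    then show "\<exists>r\<in>carrier L. L.eval p r = \<zero>\<^bsub>L\<^esub>"
      using L.roots_mem_iff_is_root[OF p(1)] by (auto simp: L.is_root_def)
  qed (rule F(2))
  have "indexed_const \<in> ring_hom R (L\<lparr>carrier := F\<rparr>)"
    using F(1) by (intro ring_hom_memI) auto
  then show ?thesis using M.real_closed_field_F by blast
qed

text \<open>The maps to a formally real field and from there to a real closed field are composed,
  and the result is relabelled by an injection into \<open>'u set\<close>. The parameter
  \<open>e\<close> leaves the choice of a large enough type \<open>'u\<close> to the
  application.\<close>

lemma (in cring) ex_hom_real_closed_field:
  fixes e :: "'a \<times> 'a \<Rightarrow> 'u"
  assumes fr: "formally_real R" and inf: "infinite (UNIV :: 'u set)" and e: "inj e"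
  shows "\<exists>(S :: 'u set ring) h. real_closed_field S \<and> h \<in> ring_hom R S"
proof -
  obtain K :: "('a \<times> 'a) ring" and h where K: "field K" "formally_real K" "h \<in> ring_hom R K"
    using ex_hom_formally_real_field[OF fr] by blast
  obtain S :: "((('a \<times> 'a) list \<times> nat) multiset \<Rightarrow> 'a \<times> 'a) ring" and k
    where S: "real_closed_field S" "k \<in> ring_hom K S"
    using field.ex_embedding_real_closed_field[OF K(1,2)] by blast
  obtain g :: "((('a \<times> 'a) list \<times> nat) multiset \<Rightarrow> 'a \<times> 'a) \<Rightarrow> 'u set" where g: "inj g"
    using ex_inj_closure_type[OF inf e] by blast
  have gi: "g \<in> ring_iso S (image_ring g S)"
    by (rule inj_imp_image_ring_iso) (use g inj_on_subset in blast)
  have "field (image_ring g S)"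
    using S(1) g inj_on_subset unfolding real_closed_field_def
    by (intro field.inj_imp_image_ring_is_field) blast+
  from real_closed_field_iso[OF S(1) this gi] have "real_closed_field (image_ring g S)" .
  moreover have "g \<circ> (k \<circ> h) \<in> ring_hom R (image_ring g S)"
    using gi by (intro ring_hom_trans[OF ring_hom_trans[OF K(3) S(2)]]) (simp add: ring_iso_def)
  ultimately show ?thesis by blast
qed

section \<open>Elements positive at every real point\<close>

text \<open>The ring \<open>R[\<surd>(-a)]\<close>; the pair \<open>(x, y)\<close> stands for \<open>x + y \<surd>(-a)\<close>.\<close>
definition adjoin_sqrt_minus :: "('a, 'm) ring_scheme \<Rightarrow> 'a \<Rightarrow> ('a \<times> 'a) ring" where
  "adjoin_sqrt_minus R a =
    \<lparr>carrier = carrier R \<times> carrier R,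
     monoid.mult = (\<lambda>z w. (fst z \<otimes>\<^bsub>R\<^esub> fst w \<ominus>\<^bsub>R\<^esub> a \<otimes>\<^bsub>R\<^esub> (snd z \<otimes>\<^bsub>R\<^esub> snd w),
       fst z \<otimes>\<^bsub>R\<^esub> snd w \<oplus>\<^bsub>R\<^esub> snd z \<otimes>\<^bsub>R\<^esub> fst w)),
     one = (\<one>\<^bsub>R\<^esub>, \<zero>\<^bsub>R\<^esub>),
     zero = (\<zero>\<^bsub>R\<^esub>, \<zero>\<^bsub>R\<^esub>),
     add = (\<lambda>z w. (fst z \<oplus>\<^bsub>R\<^esub> fst w, snd z \<oplus>\<^bsub>R\<^esub> snd w))\<rparr>"

context cring
begin

lemma adjoin_sqrt_minus_cring:
  assumes a: "a \<in> carrier R"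
  shows "cring (adjoin_sqrt_minus R a)"
proof (rule cringI)
  let ?B = "adjoin_sqrt_minus R a"
  show "abelian_group ?B"
  proof (rule abelian_groupI)
    fix z assume "z \<in> carrier ?B"
    then show "\<exists>w\<in>carrier ?B. w \<oplus>\<^bsub>?B\<^esub> z = \<zero>\<^bsub>?B\<^esub>"
      by (intro bexI[of _ "(\<ominus> fst z, \<ominus> snd z)"]) (auto simp: adjoin_sqrt_minus_def l_neg)
  qed (auto simp: adjoin_sqrt_minus_def a_assoc, auto simp: a_comm)
  show "comm_monoid ?B"
  proof (rule comm_monoidI)
    fix z w assume zw: "z \<in> carrier ?B" "w \<in> carrier ?B"
    then show "z \<otimes>\<^bsub>?B\<^esub> w \<in> carrier ?B" using a by (auto simp: adjoin_sqrt_minus_def)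
    obtain x y x' y' where e: "z = (x, y)" "w = (x', y')" "x \<in> carrier R" "y \<in> carrier R"
      "x' \<in> carrier R" "y' \<in> carrier R" using zw by (auto simp: adjoin_sqrt_minus_def)
    show "z \<otimes>\<^bsub>?B\<^esub> w = w \<otimes>\<^bsub>?B\<^esub> z"
      using e a by (simp add: adjoin_sqrt_minus_def m_comm a_comm)
    fix u assume "u \<in> carrier ?B"
    then obtain x'' y'' where f: "u = (x'', y'')" "x'' \<in> carrier R" "y'' \<in> carrier R"
      by (auto simp: adjoin_sqrt_minus_def)
    have "(x \<otimes> x' \<ominus> a \<otimes> (y \<otimes> y')) \<otimes> x'' \<ominus> a \<otimes> ((x \<otimes> y' \<oplus> y \<otimes> x') \<otimes> y'') =
      x \<otimes> (x' \<otimes> x'' \<ominus> a \<otimes> (y' \<otimes> y'')) \<ominus> a \<otimes> (y \<otimes> (x' \<otimes> y'' \<oplus> y' \<otimes> x''))"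
      using a e(3-6) f(2,3) by algebra
    moreover have "(x \<otimes> x' \<ominus> a \<otimes> (y \<otimes> y')) \<otimes> y'' \<oplus> (x \<otimes> y' \<oplus> y \<otimes> x') \<otimes> x'' =
      x \<otimes> (x' \<otimes> y'' \<oplus> y' \<otimes> x'') \<oplus> y \<otimes> (x' \<otimes> x'' \<ominus> a \<otimes> (y' \<otimes> y''))"
      using a e(3-6) f(2,3) by algebra
    ultimately show "z \<otimes>\<^bsub>?B\<^esub> w \<otimes>\<^bsub>?B\<^esub> u = z \<otimes>\<^bsub>?B\<^esub> (w \<otimes>\<^bsub>?B\<^esub> u)"
      using e f by (simp add: adjoin_sqrt_minus_def)
  qed (use a in \<open>auto simp: adjoin_sqrt_minus_def a_minus_def\<close>)
  fix z w u assume "z \<in> carrier ?B" "w \<in> carrier ?B" "u \<in> carrier ?B"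
  then obtain x y x' y' x'' y'' where e: "z = (x, y)" "w = (x', y')" "u = (x'', y'')"
    and c: "x \<in> carrier R" "y \<in> carrier R" "x' \<in> carrier R" "y' \<in> carrier R" "x'' \<in> carrier R" "y'' \<in> carrier R"
    by (auto simp: adjoin_sqrt_minus_def)
  have "(x \<oplus> x') \<otimes> x'' \<ominus> a \<otimes> ((y \<oplus> y') \<otimes> y'') =
    x \<otimes> x'' \<ominus> a \<otimes> (y \<otimes> y'') \<oplus> (x' \<otimes> x'' \<ominus> a \<otimes> (y' \<otimes> y''))"
    using a c by algebra
  moreover have "(x \<oplus> x') \<otimes> y'' \<oplus> (y \<oplus> y') \<otimes> x'' = x \<otimes> y'' \<oplus> y \<otimes> x'' \<oplus> (x' \<otimes> y'' \<oplus> y' \<otimes> x'')"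
    using a c by algebra
  ultimately show "(z \<oplus>\<^bsub>?B\<^esub> w) \<otimes>\<^bsub>?B\<^esub> u = z \<otimes>\<^bsub>?B\<^esub> u \<oplus>\<^bsub>?B\<^esub> w \<otimes>\<^bsub>?B\<^esub> u"
    by (simp add: adjoin_sqrt_minus_def e)
qed

text \<open>The square of \<open>x + y sqrt(-a)\<close> has first component
  \<open>x^2 - a y^2\<close>, and such expressions add up.\<close>

lemma sos_adjoin_sqrt_minus:
  assumes a: "a \<in> carrier R" and z: "z \<in> sos (adjoin_sqrt_minus R a)"
  shows "\<exists>s\<in>sos R. \<exists>t\<in>sos R. fst z = s \<ominus> a \<otimes> t"
proof -
  interpret B: cring "adjoin_sqrt_minus R a" by (rule adjoin_sqrt_minus_cring[OF a])
  from z show ?thesis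
  proof (induction z rule: B.sos_induct)
    case zero
    then show ?case using sos_zero a by (intro bexI[of _ \<zero>]) (auto simp: adjoin_sqrt_minus_def a_minus_def)
  next
    case (square_add b z)
    then obtain s t where st: "s \<in> sos R" "t \<in> sos R" "fst z = s \<ominus> a \<otimes> t" by blast
    have c: "s \<in> carrier R" "t \<in> carrier R" using st sos_closed by auto
    obtain x y where b: "b = (x, y)" "x \<in> carrier R" "y \<in> carrier R"
      using square_add(1) by (auto simp: adjoin_sqrt_minus_def)
    have "x \<otimes> x \<ominus> a \<otimes> (y \<otimes> y) \<oplus> (s \<ominus> a \<otimes> t) = (x \<otimes> x \<oplus> s) \<ominus> a \<otimes> (y \<otimes> y \<oplus> t)"
      using a b(2,3) c by algebra
    then have "fst (b \<otimes>\<^bsub>adjoin_sqrt_minus R a\<^esub> b \<oplus>\<^bsub>adjoin_sqrt_minus R a\<^esub> z)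
      = (x \<otimes> x \<oplus> s) \<ominus> a \<otimes> (y \<otimes> y \<oplus> t)"
      using st(3) b(1) by (simp add: adjoin_sqrt_minus_def)
    with sos_square_add[OF b(2) st(1)] sos_square_add[OF b(3) st(2)] show ?case by blast
  qed
qed

text \<open>Without a certificate, \<open>R[sqrt(-a)]\<close> is formally real, because
  \<open>1 + s - a t = 0\<close> would be one with \<open>s\<close> and \<open>t\<close> exchanged.
  At the resulting real point, the image of \<open>a\<close> is a nonzero square and also the
  negative of a square.\<close>

theorem real_positive_imp_certificate:
  assumes a: "a \<in> carrier R"
    and pos: "\<And>(S :: ('a \<times> nat) set ring) h. real_closed_field S \<Longrightarrow> h \<in> ring_hom R S \<Longrightarrow> rcf_pos S (h a)"
  shows "\<exists>s\<in>sos R. \<exists>t\<in>sos R. s \<otimes> a = \<one> \<oplus> t"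
proof (rule ccontr)
  assume no: "\<not> ?thesis"
  let ?B = "adjoin_sqrt_minus R a"
  interpret B: cring ?B by (rule adjoin_sqrt_minus_cring[OF a])
  have "formally_real ?B"
    unfolding B.formally_real_iff
  proof (intro ballI notI)
    fix z assume z: "z \<in> sos ?B" "\<one>\<^bsub>?B\<^esub> \<oplus>\<^bsub>?B\<^esub> z = \<zero>\<^bsub>?B\<^esub>"
    obtain s t where st: "s \<in> sos R" "t \<in> sos R" "fst z = s \<ominus> a \<otimes> t"
      using sos_adjoin_sqrt_minus[OF a z(1)] by blast
    have c: "s \<in> carrier R" "t \<in> carrier R" using st sos_closed by auto
    have "\<one> \<oplus> (s \<ominus> a \<otimes> t) = \<zero>" using z(2) st(3) by (simp add: adjoin_sqrt_minus_def)
    moreover have "\<one> \<oplus> (s \<ominus> a \<otimes> t) = (\<one> \<oplus> s) \<ominus> t \<otimes> a" using a c by algebra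
    ultimately have "\<one> \<oplus> s = t \<otimes> a" using a c by simp
    with st no show False by metis
  qed
  \<comment> \<open>The type \<open>'a \<times> nat\<close> is infinite even for finite
    \<open>'a\<close>, and one of its elements can code four elements of \<open>'a\<close>. So the
    real closed field can be found over the type to which \<open>pos\<close> refers.\<close>
  moreover have inf: "infinite (UNIV :: ('a \<times> nat) set)" by (simp add: finite_prod)
  then obtain p :: "('a \<times> nat) \<times> ('a \<times> nat) \<Rightarrow> 'a \<times> nat" where p: "inj p"
    using infinite_imp_ex_pairing by blast
  have "inj (\<lambda>((x, y), (u, v)). p (p ((x, 0), (y, 0)), p ((u, 0), (v, 0))))"
    by (rule injI) (auto dest!: injD[OF p])
  ultimately obtain S :: "('a \<times> nat) set ring" and h
    where S: "real_closed_field S" and h: "h \<in> ring_hom ?B S"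
    using B.ex_hom_real_closed_field inf by blast
  interpret S: field S using S by (simp add: real_closed_field_def)
  have fr: "formally_real S" using S by (simp add: real_closed_field_def formally_real_def)
  interpret h: ring_hom_cring ?B S h by unfold_locales (rule h)
  let ?g = "\<lambda>x. h (x, \<zero>)"
  have "(\<lambda>x. (x, \<zero>)) \<in> ring_hom R ?B"
    using a by (intro ring_hom_memI) (auto simp: adjoin_sqrt_minus_def a_minus_def)
  from ring_hom_trans[OF this h] have "?g \<in> ring_hom R S" by (simp add: comp_def)
  from pos[OF S this] have ga: "?g a \<noteq> \<zero>\<^bsub>S\<^esub>" "?g a \<in> sos S"
    unfolding rcf_pos_def using S.sos_square by auto
  have c: "(a, \<zero>) \<in> carrier ?B" "(\<zero>, \<one>) \<in> carrier ?B" using a by (auto simp: adjoin_sqrt_minus_def)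
  have "(a, \<zero>) \<oplus>\<^bsub>?B\<^esub> (\<zero>, \<one>) \<otimes>\<^bsub>?B\<^esub> (\<zero>, \<one>) = \<zero>\<^bsub>?B\<^esub>"
    using a by (simp add: adjoin_sqrt_minus_def a_minus_def r_neg)
  then have "h ((a, \<zero>) \<oplus>\<^bsub>?B\<^esub> (\<zero>, \<one>) \<otimes>\<^bsub>?B\<^esub> (\<zero>, \<one>)) = \<zero>\<^bsub>S\<^esub>" by simp
  then have "?g a \<oplus>\<^bsub>S\<^esub> h (\<zero>, \<one>) \<otimes>\<^bsub>S\<^esub> h (\<zero>, \<one>) = \<zero>\<^bsub>S\<^esub>" using c by simp
  from S.formally_real_add_eq_zero[OF fr ga(2) S.sos_square this] ga(1) c show False by simp
qed

end

section \<open>Quadratic forms\<close>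

text \<open>Arbitrary index sets are allowed because the elimination removes indices one after the
  other.\<close>

definition qform :: "('a, 'm) ring_scheme \<Rightarrow> nat set \<Rightarrow> (nat \<Rightarrow> nat \<Rightarrow> 'a) \<Rightarrow> (nat \<Rightarrow> 'a) \<Rightarrow> 'a" where
  "qform R I N v = (\<Oplus>\<^bsub>R\<^esub> i\<in>I. \<Oplus>\<^bsub>R\<^esub> j\<in>I. v i \<otimes>\<^bsub>R\<^esub> N i j \<otimes>\<^bsub>R\<^esub> v j)"

definition mat_on :: "('a, 'm) ring_scheme \<Rightarrow> nat set \<Rightarrow> (nat \<Rightarrow> nat \<Rightarrow> 'a) \<Rightarrow> bool" where
  "mat_on R I N \<longleftrightarrow> (\<forall>i\<in>I. \<forall>j\<in>I. N i j \<in> carrier R)"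

definition sym_mat_on :: "('a, 'm) ring_scheme \<Rightarrow> nat set \<Rightarrow> (nat \<Rightarrow> nat \<Rightarrow> 'a) \<Rightarrow> bool" where
  "sym_mat_on R I N \<longleftrightarrow> (\<forall>i\<in>I. \<forall>j\<in>I. N i j \<in> carrier R \<and> N i j = N j i)"

text \<open>The Schur complement of the entry \<open>N k k\<close>, multiplied by that entry, so
  that it makes sense without division.\<close>

definition schur :: "('a, 'm) ring_scheme \<Rightarrow> nat \<Rightarrow> (nat \<Rightarrow> nat \<Rightarrow> 'a) \<Rightarrow> nat \<Rightarrow> nat \<Rightarrow> 'a" where
  "schur R k N i j = N k k \<otimes>\<^bsub>R\<^esub> N i j \<ominus>\<^bsub>R\<^esub> N i k \<otimes>\<^bsub>R\<^esub> N j k"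

lemma sym_mat_on_imp_mat_on: "sym_mat_on R I N \<Longrightarrow> mat_on R I N"
  by (auto simp: Pi_iff sym_mat_on_def mat_on_def)

lemma sym_mat_on_closed: "sym_mat_on R I N \<Longrightarrow> i \<in> I \<Longrightarrow> j \<in> I \<Longrightarrow> N i j \<in> carrier R"
  by (simp add: sym_mat_on_def)

lemma mat_on_mono: "mat_on R I N \<Longrightarrow> J \<subseteq> I \<Longrightarrow> mat_on R J N"
  by (auto simp: Pi_iff mat_on_def)

lemma sym_mat_on_mono: "sym_mat_on R I N \<Longrightarrow> J \<subseteq> I \<Longrightarrow> sym_mat_on R J N"
  by (auto simp: Pi_iff sym_mat_on_def)

context cring
begin

lemma qform_closed:
  "mat_on R I N \<Longrightarrow> v \<in> I \<rightarrow> carrier R \<Longrightarrow> qform R I N v \<in> carrier R"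
  unfolding qform_def mat_on_def by (intro finsum_closed) (auto simp: Pi_iff intro!: finsum_closed)

lemma qform_cong:
  assumes "mat_on R I N" "v \<in> I \<rightarrow> carrier R" "\<And>i j. i \<in> I \<Longrightarrow> j \<in> I \<Longrightarrow> P i j = N i j"
  shows "qform R I P v = qform R I N v"
  unfolding qform_def using assms(1,2) unfolding mat_on_def
  by (intro finsum_cong') (auto simp: Pi_iff intro!: finsum_closed finsum_cong' simp: assms(3))

lemma qform_add:
  assumes "mat_on R I N" "mat_on R I P" "v \<in> I \<rightarrow> carrier R"
  shows "qform R I (\<lambda>i j. N i j \<oplus> P i j) v = qform R I N v \<oplus> qform R I P v"
proof -
  have "qform R I (\<lambda>i j. N i j \<oplus> P i j) v =
      (\<Oplus>i\<in>I. (\<Oplus>j\<in>I. v i \<otimes> N i j \<otimes> v j) \<oplus> (\<Oplus>j\<in>I. v i \<otimes> P i j \<otimes> v j))"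
    unfolding qform_def
  proof (rule finsum_cong')
    fix i assume i: "i \<in> I"
    have "(\<Oplus>j\<in>I. v i \<otimes> (N i j \<oplus> P i j) \<otimes> v j) = (\<Oplus>j\<in>I. v i \<otimes> N i j \<otimes> v j \<oplus> v i \<otimes> P i j \<otimes> v j)"
      using assms i unfolding mat_on_def by (intro finsum_cong') (auto simp: Pi_iff l_distr r_distr)
    also have "\<dots> = (\<Oplus>j\<in>I. v i \<otimes> N i j \<otimes> v j) \<oplus> (\<Oplus>j\<in>I. v i \<otimes> P i j \<otimes> v j)"
      using assms i unfolding mat_on_def by (intro finsum_addf) (auto simp: Pi_iff)
    finally show "(\<Oplus>j\<in>I. v i \<otimes> (N i j \<oplus> P i j) \<otimes> v j) = \<dots>" .
  qed (use assms in \<open>auto simp: Pi_iff mat_on_def intro!: finsum_closed\<close>)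
  also have "\<dots> = qform R I N v \<oplus> qform R I P v"
    unfolding qform_def using assms unfolding mat_on_def
    by (intro finsum_addf) (auto simp: Pi_iff intro!: finsum_closed)
  finally show ?thesis .
qed

lemma qform_smult:
  assumes "finite I" "mat_on R I N" "v \<in> I \<rightarrow> carrier R" "c \<in> carrier R"
  shows "qform R I (\<lambda>i j. c \<otimes> N i j) v = c \<otimes> qform R I N v"
proof -
  have "c \<otimes> qform R I N v = (\<Oplus>i\<in>I. c \<otimes> (\<Oplus>j\<in>I. v i \<otimes> N i j \<otimes> v j))"
    unfolding qform_def using assms unfolding mat_on_def
    by (intro finsum_rdistr) (auto simp: Pi_iff intro!: finsum_closed)
  also have "\<dots> = qform R I (\<lambda>i j. c \<otimes> N i j) v"
    unfolding qform_def
  proof (rule finsum_cong')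
    fix i assume i: "i \<in> I"
    have "c \<otimes> (\<Oplus>j\<in>I. v i \<otimes> N i j \<otimes> v j) = (\<Oplus>j\<in>I. c \<otimes> (v i \<otimes> N i j \<otimes> v j))"
      using assms i unfolding mat_on_def by (intro finsum_rdistr) (auto simp: Pi_iff)
    also have "\<dots> = (\<Oplus>j\<in>I. v i \<otimes> (c \<otimes> N i j) \<otimes> v j)"
      using assms i unfolding mat_on_def by (intro finsum_cong') (auto simp: Pi_iff m_ac)
    finally show "c \<otimes> (\<Oplus>j\<in>I. v i \<otimes> N i j \<otimes> v j) = (\<Oplus>j\<in>I. v i \<otimes> (c \<otimes> N i j) \<otimes> v j)" .
  qed (use assms in \<open>auto simp: Pi_iff mat_on_def intro!: finsum_closed\<close>)
  finally show ?thesis by simp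
qed

lemma qform_diff:
  assumes "finite I" "mat_on R I N" "mat_on R I P" "v \<in> I \<rightarrow> carrier R"
  shows "qform R I (\<lambda>i j. N i j \<ominus> P i j) v = qform R I N v \<ominus> qform R I P v"
proof -
  have m: "mat_on R I (\<lambda>i j. \<ominus> \<one> \<otimes> P i j)" using assms(3) by (auto simp: Pi_iff mat_on_def)
  have "qform R I (\<lambda>i j. N i j \<ominus> P i j) v = qform R I (\<lambda>i j. N i j \<oplus> \<ominus> \<one> \<otimes> P i j) v"
    using assms by (intro qform_cong) (auto simp: Pi_iff mat_on_def a_minus_def l_minus)
  also have "\<dots> = qform R I N v \<oplus> \<ominus> \<one> \<otimes> qform R I P v"
    using qform_add[OF assms(2) m assms(4)] qform_smult[OF assms(1,3,4), of "\<ominus> \<one>"] by simp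
  finally show ?thesis using qform_closed[OF assms(3,4)] by (simp add: a_minus_def l_minus)
qed

lemma qform_rank_one:
  assumes "finite I" "x \<in> I \<rightarrow> carrier R" "v \<in> I \<rightarrow> carrier R"
  shows "qform R I (\<lambda>i j. x i \<otimes> x j) v = (\<Oplus>i\<in>I. x i \<otimes> v i) \<otimes> (\<Oplus>i\<in>I. x i \<otimes> v i)"
proof -
  let ?s = "\<Oplus>i\<in>I. x i \<otimes> v i"
  have s: "?s \<in> carrier R" using assms by (intro finsum_closed) (auto simp: Pi_iff)
  have "?s \<otimes> ?s = (\<Oplus>i\<in>I. x i \<otimes> v i \<otimes> ?s)"
    using assms s by (intro finsum_ldistr) (auto simp: Pi_iff)
  also have "\<dots> = qform R I (\<lambda>i j. x i \<otimes> x j) v"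
    unfolding qform_def
  proof (rule finsum_cong')
    fix i assume i: "i \<in> I"
    have "x i \<otimes> v i \<otimes> ?s = (\<Oplus>j\<in>I. x i \<otimes> v i \<otimes> (x j \<otimes> v j))"
      using assms i by (intro finsum_rdistr) (auto simp: Pi_iff)
    also have "\<dots> = (\<Oplus>j\<in>I. v i \<otimes> (x i \<otimes> x j) \<otimes> v j)"
      using assms i by (intro finsum_cong') (auto simp: Pi_iff m_ac)
    finally show "x i \<otimes> v i \<otimes> ?s = (\<Oplus>j\<in>I. v i \<otimes> (x i \<otimes> x j) \<otimes> v j)" .
  qed (use assms in \<open>auto simp: Pi_iff intro!: finsum_closed\<close>)
  finally show ?thesis by simp
qed

lemma qform_zero_vec:
  assumes "mat_on R I N" "\<And>i. i \<in> I \<Longrightarrow> v i = \<zero>"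
  shows "qform R I N v = \<zero>"
proof -
  have "qform R I N v = (\<Oplus>i\<in>I. \<zero>)"
    unfolding qform_def using assms unfolding mat_on_def
    by (intro finsum_cong') (auto simp: Pi_iff intro!: add.finprod_one_eqI)
  then show ?thesis by simp
qed

text \<open>By symmetry, row \<open>k\<close> and column \<open>k\<close> contribute the same mixed
  term, hence \<open>v k \<otimes> s\<close> occurs twice.\<close>

lemma qform_insert:
  assumes J: "finite J" "k \<notin> J" and N: "sym_mat_on R (insert k J) N" and v: "v \<in> insert k J \<rightarrow> carrier R"
  defines "s \<equiv> \<Oplus>j\<in>J. N j k \<otimes> v j"
  shows "qform R (insert k J) N v = qform R J N v \<oplus> (v k \<otimes> s \<oplus> v k \<otimes> s) \<oplus> v k \<otimes> N k k \<otimes> v k"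
proof -
  have c: "\<And>i j. i \<in> insert k J \<Longrightarrow> j \<in> insert k J \<Longrightarrow> N i j \<in> carrier R"
    "\<And>i. i \<in> insert k J \<Longrightarrow> v i \<in> carrier R"
    using N v by (auto simp: Pi_iff sym_mat_on_def)
  have sc: "s \<in> carrier R" unfolding s_def using c by (intro finsum_closed) (auto simp: Pi_iff)
  have qc: "qform R J N v \<in> carrier R" using c by (intro qform_closed) (auto simp: Pi_iff mat_on_def)
  have vs: "v k \<otimes> s = (\<Oplus>j\<in>J. v k \<otimes> (N j k \<otimes> v j))"
    unfolding s_def using J c by (intro finsum_rdistr) (auto simp: Pi_iff)
  have row: "(\<Oplus>j\<in>insert k J. v i \<otimes> N i j \<otimes> v j) = v i \<otimes> N i k \<otimes> v k \<oplus> (\<Oplus>j\<in>J. v i \<otimes> N i j \<otimes> v j)"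
    if "i \<in> insert k J" for i
    using J c that by (intro finsum_insert) (auto simp: Pi_iff)
  have "N k j = N j k" if "j \<in> J" for j
    using N that unfolding sym_mat_on_def by blast
  then have rk: "(\<Oplus>j\<in>J. v k \<otimes> N k j \<otimes> v j) = v k \<otimes> s"
    unfolding vs using c by (intro finsum_cong') (auto simp: Pi_iff m_assoc)
  have "qform R (insert k J) N v = (\<Oplus>j\<in>insert k J. v k \<otimes> N k j \<otimes> v j) \<oplus>
      (\<Oplus>i\<in>J. \<Oplus>j\<in>insert k J. v i \<otimes> N i j \<otimes> v j)"
    unfolding qform_def using J c by (intro finsum_insert) (auto simp: Pi_iff intro!: finsum_closed)
  also have "(\<Oplus>i\<in>J. \<Oplus>j\<in>insert k J. v i \<otimes> N i j \<otimes> v j) =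
      (\<Oplus>i\<in>J. v i \<otimes> N i k \<otimes> v k \<oplus> (\<Oplus>j\<in>J. v i \<otimes> N i j \<otimes> v j))"
    using c row by (intro finsum_cong') (auto simp: Pi_iff intro!: finsum_closed)
  also have "\<dots> = (\<Oplus>i\<in>J. v i \<otimes> N i k \<otimes> v k) \<oplus> qform R J N v"
    unfolding qform_def using c by (intro finsum_addf) (auto simp: Pi_iff intro!: finsum_closed)
  also have "(\<Oplus>i\<in>J. v i \<otimes> N i k \<otimes> v k) = v k \<otimes> s"
    unfolding vs using c by (intro finsum_cong') (auto simp: Pi_iff m_ac)
  also have "(\<Oplus>j\<in>insert k J. v k \<otimes> N k j \<otimes> v j) = v k \<otimes> N k k \<otimes> v k \<oplus> v k \<otimes> s"
    using row[of k] rk by simp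
  finally show ?thesis using sc qc c by (simp add: a_ac)
qed

lemma qform_insert_zero:
  assumes J: "finite J" "k \<notin> J" and N: "sym_mat_on R (insert k J) N" and v: "v \<in> insert k J \<rightarrow> carrier R"
    and z: "\<And>j. j \<in> insert k J \<Longrightarrow> N j k = \<zero>"
  shows "qform R (insert k J) N v = qform R J N v"
proof -
  have "(\<Oplus>j\<in>J. N j k \<otimes> v j) = \<zero>" using z v by (intro add.finprod_one_eqI) (auto simp: Pi_iff)
  moreover have "qform R J N v \<in> carrier R"
    using sym_mat_on_closed[OF N] v by (intro qform_closed) (auto simp: Pi_iff mat_on_def)
  ultimately show ?thesis unfolding qform_insert[OF J N v] using z[of k] v by (auto simp: Pi_iff)
qed

lemma schur_sym_mat_on:
  assumes N: "sym_mat_on R (insert k J) N" shows "sym_mat_on R (insert k J) (schur R k N)"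
  unfolding sym_mat_on_def
proof (intro ballI conjI)
  fix i j assume ij: "i \<in> insert k J" "j \<in> insert k J"
  have c: "N k k \<in> carrier R" "N i j \<in> carrier R" "N i k \<in> carrier R" "N j k \<in> carrier R"
    and e: "N i j = N j i"
    using N ij unfolding sym_mat_on_def by blast+
  show "schur R k N i j \<in> carrier R" using c by (simp add: schur_def)
  show "schur R k N i j = schur R k N j i" using c e by (simp add: schur_def m_comm)
qed

lemma schur_row_zero:
  assumes N: "sym_mat_on R (insert k J) N" and j: "j \<in> insert k J"
  shows "schur R k N j k = \<zero>" "schur R k N k j = \<zero>"
proof -
  have c: "N k k \<in> carrier R" "N j k \<in> carrier R" and e: "N k j = N j k"
    using N j unfolding sym_mat_on_def by blast+
  show "schur R k N j k = \<zero>" "schur R k N k j = \<zero>"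
    using c by (simp_all add: schur_def e m_comm[of "N j k" "N k k"] a_minus_def r_neg)
qed

text \<open>Completing the square in the variable \<open>v k\<close>, with \<open>N k k\<close>
  multiplied through instead of inverted.\<close>

lemma qform_schur:
  assumes J: "finite J" "k \<notin> J" and N: "sym_mat_on R (insert k J) N" and v: "v \<in> insert k J \<rightarrow> carrier R"
  defines "s \<equiv> \<Oplus>j\<in>J. N j k \<otimes> v j"
  shows "N k k \<otimes> qform R (insert k J) N v =
    (s \<oplus> N k k \<otimes> v k) \<otimes> (s \<oplus> N k k \<otimes> v k) \<oplus> qform R J (schur R k N) v"
proof -
  have c: "\<And>i j. i \<in> insert k J \<Longrightarrow> j \<in> insert k J \<Longrightarrow> N i j \<in> carrier R"
    "\<And>i. i \<in> insert k J \<Longrightarrow> v i \<in> carrier R"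
    using N v by (auto simp: Pi_iff sym_mat_on_def)
  have sc: "s \<in> carrier R" unfolding s_def using c by (intro finsum_closed) (auto simp: Pi_iff)
  have m: "mat_on R J N" "v \<in> J \<rightarrow> carrier R" using c by (auto simp: Pi_iff mat_on_def)
  have qc: "qform R J N v \<in> carrier R" using m by (intro qform_closed)
  have "qform R J (schur R k N) v = qform R J (\<lambda>i j. N k k \<otimes> N i j) v \<ominus> qform R J (\<lambda>i j. N i k \<otimes> N j k) v"
    unfolding schur_def using J m c by (intro qform_diff) (auto simp: Pi_iff mat_on_def)
  also have "\<dots> = N k k \<otimes> qform R J N v \<ominus> s \<otimes> s"
    unfolding s_def using J m c by (subst qform_smult, simp_all, subst qform_rank_one) (auto simp: Pi_iff)
  finally have e: "qform R J (schur R k N) v = N k k \<otimes> qform R J N v \<ominus> s \<otimes> s" .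
  have ck: "N k k \<in> carrier R" "v k \<in> carrier R" using c by (auto simp: Pi_iff)
  show ?thesis
    unfolding e qform_insert[OF J N v] s_def[symmetric] using sc qc ck by algebra
qed

end

section \<open>Positive definite matrices over a real closed field\<close>

definition pd_on :: "('a, 'm) ring_scheme \<Rightarrow> nat set \<Rightarrow> (nat \<Rightarrow> nat \<Rightarrow> 'a) \<Rightarrow> bool" where
  "pd_on R I N \<longleftrightarrow> (\<forall>v \<in> I \<rightarrow> carrier R. (\<exists>i\<in>I. v i \<noteq> \<zero>\<^bsub>R\<^esub>) \<longrightarrow> rcf_pos R (qform R I N v))"

lemma pd_onD:
  "pd_on R I N \<Longrightarrow> v \<in> I \<rightarrow> carrier R \<Longrightarrow> \<exists>i\<in>I. v i \<noteq> \<zero>\<^bsub>R\<^esub> \<Longrightarrow> rcf_pos R (qform R I N v)"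
  unfolding pd_on_def by blast

locale rcf = field R for R (structure) +
  assumes rcf: "real_closed_field R"
begin

lemma formally_real: "formally_real R"
  using rcf by (simp add: real_closed_field_def formally_real_def)

text \<open>In a real closed field \<open>x\<close> or \<open>-x\<close> is a square. For a nonzero
  sum of squares \<open>x\<close> the second is excluded, as \<open>x + y^2 = 0\<close> would force
  \<open>x = 0\<close>. Positivity thus inherits the closure properties of
  \<open>sos\<close>.\<close>

lemma rcf_pos_iff: "rcf_pos R x \<longleftrightarrow> x \<in> sos R \<and> x \<noteq> \<zero>"
proof
  assume x: "x \<in> sos R \<and> x \<noteq> \<zero>"
  then have xc: "x \<in> carrier R" using sos_closed by blast
  then obtain y where y: "y \<in> carrier R" "x = y \<otimes> y \<or> \<ominus> x = y \<otimes> y"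
    using rcf unfolding real_closed_field_def by blast
  have "\<ominus> x \<noteq> y \<otimes> y"
  proof
    assume "\<ominus> x = y \<otimes> y"
    then have "x \<oplus> y \<otimes> y = \<zero>" using xc by (metis r_neg)
    then show False using formally_real_add_eq_zero[OF formally_real _ sos_square[OF y(1)]] x by blast
  qed
  then show "rcf_pos R x" using x y unfolding rcf_pos_def by blast
qed (auto simp: Pi_iff rcf_pos_def sos_square)

lemma rcf_pos_add: "rcf_pos R x \<Longrightarrow> y \<in> sos R \<Longrightarrow> rcf_pos R (x \<oplus> y)"
  unfolding rcf_pos_iff using formally_real_add_eq_zero[OF formally_real] sos_add by blast

lemma rcf_pos_mult: "rcf_pos R x \<Longrightarrow> rcf_pos R y \<Longrightarrow> rcf_pos R (x \<otimes> y)"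
  unfolding rcf_pos_iff by (auto simp: sos_mult sos_closed integral_iff)

text \<open>The zero vector, which \<open>pd_on\<close> leaves out, gives the value zero, which is a
  sum of squares as well.\<close>

lemma pd_on_sos:
  assumes "pd_on R I N" "mat_on R I N" "v \<in> I \<rightarrow> carrier R"
  shows "qform R I N v \<in> sos R"
proof (cases "\<exists>i\<in>I. v i \<noteq> \<zero>")
  case True
  then show ?thesis using assms rcf_pos_iff unfolding pd_on_def by blast
next
  case False
  then have "qform R I N v = \<zero>" by (intro qform_zero_vec[OF assms(2)]) blast
  then show ?thesis by (simp add: sos_zero)
qed

text \<open>The diagonal entry is the value of the form at the \<open>k\<close>-th unit
  vector.\<close>

lemma pd_on_diag:
  assumes J: "finite J" "k \<notin> J" and N: "sym_mat_on R (insert k J) N" and pd: "pd_on R (insert k J) N"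
  shows "rcf_pos R (N k k)"
proof -
  let ?v = "\<lambda>i. if i = k then \<one> else \<zero>"
  have v: "?v \<in> insert k J \<rightarrow> carrier R" by (auto simp: Pi_iff)
  have kk: "N k k \<in> carrier R" using sym_mat_on_closed[OF N] by (auto simp: Pi_iff)
  have "(\<Oplus>j\<in>J. N j k \<otimes> ?v j) = \<zero>" using J sym_mat_on_closed[OF N] by (intro add.finprod_one_eqI) (auto simp: Pi_iff)
  moreover have "qform R J N ?v = \<zero>"
    using J sym_mat_on_closed[OF N] by (intro qform_zero_vec) (auto simp: Pi_iff mat_on_def sym_mat_on_def)
  ultimately have "qform R (insert k J) N ?v = N k k"
    using qform_insert[OF J N v] kk by simp
  moreover have "rcf_pos R (qform R (insert k J) N ?v)"
    using one_not_zero by (intro pd_onD[OF pd v] bexI[of _ k]) auto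
  ultimately show ?thesis by simp
qed

lemma pd_on_schur:
  assumes J: "finite J" "k \<notin> J" and N: "sym_mat_on R (insert k J) N" and pd: "pd_on R (insert k J) N"
  shows "pd_on R J (schur R k N)"
  unfolding pd_on_def
proof (intro ballI impI)
  fix v assume v: "v \<in> J \<rightarrow> carrier R" "\<exists>i\<in>J. v i \<noteq> \<zero>"
  have a: "rcf_pos R (N k k)" by (rule pd_on_diag[OF J N pd])
  then have ac: "N k k \<in> carrier R" "N k k \<noteq> \<zero>" unfolding rcf_pos_iff using sos_closed by (auto simp: Pi_iff)
  then have ai: "inv (N k k) \<in> carrier R" "N k k \<otimes> inv (N k k) = \<one>" by (auto simp: Pi_iff field_Units)
  let ?s = "\<Oplus>j\<in>J. N j k \<otimes> v j"
  have sc: "?s \<in> carrier R" using sym_mat_on_closed[OF N] v by (intro finsum_closed) (auto simp: Pi_iff)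
  \<comment> \<open>The coordinate at \<open>k\<close> makes the square in
    \<open>qform_schur\<close> vanish. The value of the Schur complement at \<open>v\<close> is then
    the positive entry \<open>N k k\<close> times a value of the original form.\<close>
  let ?w = "\<lambda>i. if i = k then \<ominus> (inv (N k k) \<otimes> ?s) else v i"
  have w: "?w \<in> insert k J \<rightarrow> carrier R" using v ai sc by (auto simp: Pi_iff)
  have s: "(\<Oplus>j\<in>J. N j k \<otimes> ?w j) = ?s" using v J sym_mat_on_closed[OF N] by (intro finsum_cong') (auto simp: Pi_iff)
  have "N k k \<otimes> \<ominus> (inv (N k k) \<otimes> ?s) = \<ominus> (N k k \<otimes> inv (N k k) \<otimes> ?s)"
    using ac ai(1) sc by (simp add: r_minus m_assoc)
  then have z: "?s \<oplus> N k k \<otimes> ?w k = \<zero>" using ai sc by (simp add: r_neg)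
  have m: "mat_on R J (schur R k N)"
    using mat_on_mono[OF sym_mat_on_imp_mat_on[OF schur_sym_mat_on[OF N]]] by blast
  have "qform R J (schur R k N) ?w = qform R J (schur R k N) v"
    unfolding qform_def using m v J by (intro finsum_cong') (auto simp: Pi_iff mat_on_def intro!: finsum_closed finsum_cong')
  then have "N k k \<otimes> qform R (insert k J) N ?w = qform R J (schur R k N) v"
    using qform_schur[OF J N w] unfolding s z using qform_closed[OF m v(1)] by simp
  moreover have "\<exists>i\<in>insert k J. ?w i \<noteq> \<zero>" using v(2) J by (auto simp: Pi_iff)
  then have "rcf_pos R (qform R (insert k J) N ?w)" by (rule pd_onD[OF pd w])
  ultimately show "rcf_pos R (qform R J (schur R k N) v)"
    using rcf_pos_mult[OF a] by metis
qed

text \<open>Lifts a shifted Schur complement back to the larger index set. Completing the square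
  shows that the form of \<open>x N k k N - D\<close> is \<open>x\<close> times a square plus the
  form of \<open>x\<close> times the Schur complement minus \<open>D\<close>; as row
  \<open>k\<close> of \<open>D\<close> is zero, \<open>D\<close> contributes only on
  \<open>J\<close>. Its values are sums of squares, and adding \<open>N\<close> gives strict
  positivity. The factor \<open>c^2\<close> is a parameter that later turns the coefficient of
  \<open>N\<close> into 1 plus a sum of squares.\<close>

lemma pd_on_shift:
  assumes J: "finite J" "k \<notin> J" and N: "sym_mat_on R (insert k J) N" and pd: "pd_on R (insert k J) N"
    and D: "sym_mat_on R (insert k J) D" "\<And>j. j \<in> insert k J \<Longrightarrow> D j k = \<zero>"
    and x: "x \<in> sos R" and c: "c \<in> carrier R"
    and pd': "pd_on R J (\<lambda>i j. x \<otimes> schur R k N i j \<ominus> D i j)"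
  shows "pd_on R (insert k J) (\<lambda>i j. N i j \<oplus> c \<otimes> c \<otimes> (x \<otimes> (N k k \<otimes> N i j) \<ominus> D i j))"
  unfolding pd_on_def
proof (intro ballI impI)
  fix v assume v: "v \<in> insert k J \<rightarrow> carrier R" "\<exists>i\<in>insert k J. v i \<noteq> \<zero>"
  let ?I = "insert k J"
  have fin: "finite ?I" using J by simp
  have xc: "x \<in> carrier R" using x sos_closed by blast
  have kk: "N k k \<in> carrier R" using sym_mat_on_closed[OF N] by (auto simp: Pi_iff)
  have mN: "mat_on R ?I N" and mD: "mat_on R ?I D" using N D(1) by (simp_all add: sym_mat_on_imp_mat_on)
  then have mJ: "mat_on R J N" "mat_on R J D" by (auto intro: mat_on_mono)
  have mS: "mat_on R J (schur R k N)"
    using mat_on_mono[OF sym_mat_on_imp_mat_on[OF schur_sym_mat_on[OF N]]] by blast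
  have vJ: "v \<in> J \<rightarrow> carrier R" using v by (auto simp: Pi_iff)
  have mkN: "mat_on R ?I (\<lambda>i j. N k k \<otimes> N i j)" using mN kk by (auto simp: Pi_iff mat_on_def)
  have mxkN: "mat_on R ?I (\<lambda>i j. x \<otimes> (N k k \<otimes> N i j))" using mkN xc by (auto simp: Pi_iff mat_on_def)
  have md: "mat_on R ?I (\<lambda>i j. x \<otimes> (N k k \<otimes> N i j) \<ominus> D i j)" using mxkN mD by (auto simp: Pi_iff mat_on_def)
  have mcd: "mat_on R ?I (\<lambda>i j. c \<otimes> c \<otimes> (x \<otimes> (N k k \<otimes> N i j) \<ominus> D i j))"
    using md c by (auto simp: Pi_iff mat_on_def)
  have mxS: "mat_on R J (\<lambda>i j. x \<otimes> schur R k N i j)" using mS xc by (auto simp: Pi_iff mat_on_def)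
  have mP: "mat_on R J (\<lambda>i j. x \<otimes> schur R k N i j \<ominus> D i j)" using mxS mJ(2) by (auto simp: Pi_iff mat_on_def)
  let ?L = "(\<Oplus>j\<in>J. N j k \<otimes> v j) \<oplus> N k k \<otimes> v k"
  have L: "?L \<in> carrier R" using sym_mat_on_closed[OF N] v kk by (auto simp: Pi_iff intro!: finsum_closed)
  have qS: "qform R J (schur R k N) v \<in> carrier R" by (rule qform_closed[OF mS vJ])
  have qD: "qform R J D v \<in> carrier R" by (rule qform_closed[OF mJ(2) vJ])
  have gen: "x \<otimes> (l \<otimes> l \<oplus> p) \<ominus> d = x \<otimes> (l \<otimes> l) \<oplus> (x \<otimes> p \<ominus> d)"
    if "l \<in> carrier R" "p \<in> carrier R" "d \<in> carrier R" for l p d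
    using that xc by algebra
  have "qform R ?I (\<lambda>i j. x \<otimes> (N k k \<otimes> N i j) \<ominus> D i j) v
      = x \<otimes> (N k k \<otimes> qform R ?I N v) \<ominus> qform R ?I D v"
    using qform_diff[OF fin mxkN mD v(1)] qform_smult[OF fin mkN v(1) xc] qform_smult[OF fin mN v(1) kk]
    by simp
  also have "\<dots> = x \<otimes> (?L \<otimes> ?L \<oplus> qform R J (schur R k N) v) \<ominus> qform R J D v"
    using qform_schur[OF J N v(1)] qform_insert_zero[OF J D(1) v(1) D(2)] by simp
  also have "\<dots> = x \<otimes> (?L \<otimes> ?L) \<oplus> (x \<otimes> qform R J (schur R k N) v \<ominus> qform R J D v)"
    using gen[OF L qS qD] .
  also have "x \<otimes> qform R J (schur R k N) v \<ominus> qform R J D v = qform R J (\<lambda>i j. x \<otimes> schur R k N i j \<ominus> D i j) v"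
    using qform_diff[OF J(1) mxS mJ(2) vJ] qform_smult[OF J(1) mS vJ xc] by simp
  finally have e: "qform R ?I (\<lambda>i j. x \<otimes> (N k k \<otimes> N i j) \<ominus> D i j) v
    = x \<otimes> (?L \<otimes> ?L) \<oplus> qform R J (\<lambda>i j. x \<otimes> schur R k N i j \<ominus> D i j) v" .
  have "x \<otimes> (?L \<otimes> ?L) \<oplus> qform R J (\<lambda>i j. x \<otimes> schur R k N i j \<ominus> D i j) v \<in> sos R"
    using x L by (intro sos_add sos_mult sos_square pd_on_sos[OF pd' mP vJ])
  then have "c \<otimes> c \<otimes> qform R ?I (\<lambda>i j. x \<otimes> (N k k \<otimes> N i j) \<ominus> D i j) v \<in> sos R"
    unfolding e using c by (rule sos_square_mult)
  moreover have "rcf_pos R (qform R ?I N v)" by (rule pd_onD[OF pd v])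
  moreover have "qform R ?I (\<lambda>i j. N i j \<oplus> c \<otimes> c \<otimes> (x \<otimes> (N k k \<otimes> N i j) \<ominus> D i j)) v =
     qform R ?I N v \<oplus> c \<otimes> c \<otimes> qform R ?I (\<lambda>i j. x \<otimes> (N k k \<otimes> N i j) \<ominus> D i j) v"
    using qform_add[OF mN mcd v(1)] qform_smult[OF fin md v(1), of "c \<otimes> c"] c by simp
  ultimately show "rcf_pos R (qform R ?I (\<lambda>i j. N i j \<oplus> c \<otimes> c \<otimes> (x \<otimes> (N k k \<otimes> N i j) \<ominus> D i j)) v)"
    using rcf_pos_add by simp
qed

end

lemma (in cring) pd_on_cong:
  assumes "pd_on R I N" "mat_on R I N" "\<And>i j. i \<in> I \<Longrightarrow> j \<in> I \<Longrightarrow> P i j = N i j"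
  shows "pd_on R I P"
  unfolding pd_on_def
proof (intro ballI impI)
  fix v assume v: "v \<in> I \<rightarrow> carrier R" "\<exists>i\<in>I. v i \<noteq> \<zero>"
  show "rcf_pos R (qform R I P v)"
    using pd_onD[OF assms(1) v] qform_cong[OF assms(2) v(1) assms(3)] by simp
qed

lemma (in rcf) pd_on_singleton:
  assumes "rcf_pos R (N i i)"
  shows "pd_on R {i} N"
  unfolding pd_on_def
proof (intro ballI impI)
  fix v assume v: "v \<in> {i} \<rightarrow> carrier R" "\<exists>i\<in>{i}. v i \<noteq> \<zero>"
  have c: "N i i \<in> carrier R" "v i \<in> carrier R" "v i \<noteq> \<zero>"
    using assms v unfolding rcf_pos_iff by (auto simp: sos_closed)
  have "qform R {i} N v = v i \<otimes> v i \<otimes> N i i"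
    unfolding qform_def using c by (simp add: m_ac)
  moreover have "rcf_pos R (v i \<otimes> v i)"
    using c by (auto simp: rcf_pos_def integral_iff)
  ultimately show "rcf_pos R (qform R {i} N v)" using rcf_pos_mult[OF _ assms] by simp
qed

section \<open>Positive definite matrices over a commutative ring\<close>

text \<open>The notion \<open>pos_def\<close> for any index set, so that inductions can remove
  indices.\<close>

definition posdef_on :: "('a, 'm) ring_scheme \<Rightarrow> nat set \<Rightarrow> (nat \<Rightarrow> nat \<Rightarrow> 'a) \<Rightarrow> bool" where
  "posdef_on R I M \<longleftrightarrow> sym_mat_on R I M \<and>
     (\<forall>(S :: ('a \<times> nat) set ring) h. real_closed_field S \<longrightarrow> h \<in> ring_hom R S \<longrightarrow>
        pd_on S I (\<lambda>i j. h (M i j)))"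

text \<open>A multiplicative set whose elements are strictly positive at every real point.\<close>

definition one_plus_sos :: "('a, 'm) ring_scheme \<Rightarrow> 'a set" where
  "one_plus_sos R = {\<one>\<^bsub>R\<^esub> \<oplus>\<^bsub>R\<^esub> t | t. t \<in> sos R}"

definition unit_mat :: "('a, 'm) ring_scheme \<Rightarrow> nat \<Rightarrow> nat \<Rightarrow> nat \<Rightarrow> 'a" where
  "unit_mat R k i j = (if i = k \<and> j = k then \<one>\<^bsub>R\<^esub> else \<zero>\<^bsub>R\<^esub>)"

locale real_point = ring_hom_cring R S h + S: rcf S for R (structure) and S (structure) and h

context real_point
begin

lemma hom_sym_mat_on: "sym_mat_on R I M \<Longrightarrow> sym_mat_on S I (\<lambda>i j. h (M i j))"
  unfolding sym_mat_on_def by auto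

lemma hom_schur:
  assumes "sym_mat_on R (insert k J) M" "i \<in> insert k J" "j \<in> insert k J"
  shows "h (schur R k M i j) = schur S k (\<lambda>i j. h (M i j)) i j"
proof -
  have "M k k \<in> carrier R" "M i j \<in> carrier R" "M i k \<in> carrier R" "M j k \<in> carrier R"
    using sym_mat_on_closed[OF assms(1)] assms(2,3) by auto
  then show ?thesis by (simp add: schur_def a_minus_def)
qed

end

lemma (in cring) real_pointI:
  assumes "real_closed_field S" "h \<in> ring_hom R S"
  shows "real_point R S h"
proof -
  interpret S: field S using assms(1) by (simp add: real_closed_field_def)
  interpret ring_hom_cring R S h by unfold_locales (rule assms(2))
  interpret S: rcf S by unfold_locales (rule assms(1))
  show ?thesis by unfold_locales
qed

context cring
begin

lemma posdef_onI:
  assumes "sym_mat_on R I M"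
    and "\<And>(S :: ('a \<times> nat) set ring) h. real_point R S h \<Longrightarrow> pd_on S I (\<lambda>i j. h (M i j))"
  shows "posdef_on R I M"
  using assms real_pointI unfolding posdef_on_def by blast

lemma posdef_onD:
  assumes "posdef_on R I M" "real_point R (S :: ('a \<times> nat) set ring) h"
  shows "pd_on S I (\<lambda>i j. h (M i j))"
proof -
  interpret h: real_point R S h by fact
  show ?thesis using assms(1) h.S.rcf h.homh unfolding posdef_on_def by blast
qed

lemma posdef_on_sym: "posdef_on R I M \<Longrightarrow> sym_mat_on R I M"
  by (simp add: posdef_on_def)

lemma posdef_on_cong:
  assumes M: "posdef_on R I M" and eq: "\<And>i j. i \<in> I \<Longrightarrow> j \<in> I \<Longrightarrow> P i j = M i j"
  shows "posdef_on R I P"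
proof (rule posdef_onI)
  show "sym_mat_on R I P" using posdef_on_sym[OF M] unfolding sym_mat_on_def by (metis eq)
  fix S :: "('a \<times> nat) set ring" and h
  assume rp: "real_point R S h"
  interpret h: real_point R S h by fact
  show "pd_on S I (\<lambda>i j. h (P i j))"
    using sym_mat_on_imp_mat_on[OF h.hom_sym_mat_on[OF posdef_on_sym[OF M]]] eq
    by (intro h.S.pd_on_cong[OF posdef_onD[OF M rp]]) auto
qed

text \<open>Entries of the Schur complement are polynomials in the entries of \<open>M\<close>, so
  homomorphisms commute with it and the claim can be checked at each real point.\<close>

lemma posdef_on_schur:
  assumes J: "finite J" "k \<notin> J" and M: "posdef_on R (insert k J) M"
  shows "posdef_on R J (schur R k M)"
proof (rule posdef_onI)
  note sym = posdef_on_sym[OF M]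
  show "sym_mat_on R J (schur R k M)"
    using sym_mat_on_mono[OF schur_sym_mat_on[OF sym]] by blast
  fix S :: "('a \<times> nat) set ring" and h
  assume rp: "real_point R S h"
  interpret h: real_point R S h by fact
  note sS = h.hom_sym_mat_on[OF sym]
  have "mat_on S J (schur S k (\<lambda>i j. h (M i j)))"
    using mat_on_mono[OF sym_mat_on_imp_mat_on[OF h.S.schur_sym_mat_on[OF sS]]] by blast
  then show "pd_on S J (\<lambda>i j. h (schur R k M i j))"
    using h.hom_schur[OF sym] by (intro h.S.pd_on_cong[OF h.S.pd_on_schur[OF J sS posdef_onD[OF M rp]]]) auto
qed

text \<open>The entry is positive at every real point and so has a certificate. These identities
  replace division by the pivots.\<close>

lemma posdef_on_diag:
  assumes J: "finite J" "k \<notin> J" and M: "posdef_on R (insert k J) M"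
  shows "\<exists>s\<in>sos R. \<exists>t\<in>sos R. s \<otimes> M k k = \<one> \<oplus> t"
proof (rule real_positive_imp_certificate)
  show "M k k \<in> carrier R" using sym_mat_on_closed[OF posdef_on_sym[OF M]] by simp
  fix S :: "('a \<times> nat) set ring" and h
  assume "real_closed_field S" "h \<in> ring_hom R S"
  then have rp: "real_point R S h" by (rule real_pointI)
  interpret h: real_point R S h by fact
  show "rcf_pos S (h (M k k))"
    using h.S.pd_on_diag[OF J h.hom_sym_mat_on[OF posdef_on_sym[OF M]] posdef_onD[OF M rp]] .
qed

lemma posdef_on_shift:
  assumes J: "finite J" "k \<notin> J" and M: "posdef_on R (insert k J) M"
    and D: "sym_mat_on R (insert k J) D" "\<And>j. j \<in> insert k J \<Longrightarrow> D j k = \<zero>"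
    and x: "x \<in> sos R" and c: "c \<in> carrier R"
    and P: "posdef_on R J (\<lambda>i j. x \<otimes> schur R k M i j \<ominus> D i j)"
  shows "posdef_on R (insert k J) (\<lambda>i j. M i j \<oplus> c \<otimes> c \<otimes> (x \<otimes> (M k k \<otimes> M i j) \<ominus> D i j))"
    (is "posdef_on R ?I ?P")
proof (rule posdef_onI)
  note sym = posdef_on_sym[OF M]
  have xc: "x \<in> carrier R" by (rule sos_closed[OF x])
  note cl = sym_mat_on_closed[OF sym] sym_mat_on_closed[OF D(1)]
  show symP: "sym_mat_on R ?I ?P"
    unfolding sym_mat_on_def
  proof (intro ballI conjI)
    fix i j assume ij: "i \<in> ?I" "j \<in> ?I"
    have "M i j = M j i" "D i j = D j i" using sym D(1) ij unfolding sym_mat_on_def by blast+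
    then show "?P i j = ?P j i" by simp
    show "?P i j \<in> carrier R" using ij cl xc c by simp
  qed
  fix S :: "('a \<times> nat) set ring" and h
  assume rp: "real_point R S h"
  interpret h: real_point R S h by fact
  note sS = h.hom_sym_mat_on[OF sym] and sD = h.hom_sym_mat_on[OF D(1)]
  have zD: "h (D j k) = \<zero>\<^bsub>S\<^esub>" if "j \<in> ?I" for j using D(2)[OF that] by simp
  have m: "mat_on S J (\<lambda>i j. h (x \<otimes> schur R k M i j \<ominus> D i j))"
    by (intro sym_mat_on_imp_mat_on h.hom_sym_mat_on posdef_on_sym[OF P])
  have pdP: "pd_on S J (\<lambda>i j. h x \<otimes>\<^bsub>S\<^esub> schur S k (\<lambda>i j. h (M i j)) i j \<ominus>\<^bsub>S\<^esub> h (D i j))"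
  proof (rule h.S.pd_on_cong[OF posdef_onD[OF P rp] m])
    fix i j assume "i \<in> J" "j \<in> J"
    then have ij: "i \<in> ?I" "j \<in> ?I" by auto
    show "h x \<otimes>\<^bsub>S\<^esub> schur S k (\<lambda>i j. h (M i j)) i j \<ominus>\<^bsub>S\<^esub> h (D i j) = h (x \<otimes> schur R k M i j \<ominus> D i j)"
      using h.hom_schur[OF sym ij] sym_mat_on_closed[OF schur_sym_mat_on[OF sym] ij] cl(2)[OF ij] xc
      by (simp add: a_minus_def)
  qed
  note pd = h.S.pd_on_shift[OF J sS posdef_onD[OF M rp] sD zD h.hom_sos[OF x] h.hom_closed[OF c] pdP]
  have e: "h (?P i j) = h (M i j) \<oplus>\<^bsub>S\<^esub> h c \<otimes>\<^bsub>S\<^esub> h c \<otimes>\<^bsub>S\<^esub>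
      (h x \<otimes>\<^bsub>S\<^esub> (h (M k k) \<otimes>\<^bsub>S\<^esub> h (M i j)) \<ominus>\<^bsub>S\<^esub> h (D i j))"
    if "i \<in> ?I" "j \<in> ?I" for i j
    using cl(1)[OF that] cl(2)[OF that] cl(1)[of k k] xc c by (simp add: a_minus_def)
  have "mat_on S ?I (\<lambda>i j. h (?P i j))"
    by (intro sym_mat_on_imp_mat_on h.hom_sym_mat_on symP)
  then have "mat_on S ?I (\<lambda>i j. h (M i j) \<oplus>\<^bsub>S\<^esub> h c \<otimes>\<^bsub>S\<^esub> h c \<otimes>\<^bsub>S\<^esub>
      (h x \<otimes>\<^bsub>S\<^esub> (h (M k k) \<otimes>\<^bsub>S\<^esub> h (M i j)) \<ominus>\<^bsub>S\<^esub> h (D i j)))"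
    unfolding mat_on_def using e by auto
  from h.S.pd_on_cong[OF pd this e] show "pd_on S ?I (\<lambda>i j. h (?P i j))" .
qed

section \<open>Elimination with factors in 1 plus sums of squares\<close>

lemma one_plus_sos_sos: "x \<in> one_plus_sos R \<Longrightarrow> x \<in> sos R"
  unfolding one_plus_sos_def using sos_add[OF sos_one] by blast

lemma one_plus_sos_closed: "x \<in> one_plus_sos R \<Longrightarrow> x \<in> carrier R"
  using one_plus_sos_sos sos_closed by blast

lemma one_plus_sosI: "t \<in> sos R \<Longrightarrow> \<one> \<oplus> t \<in> one_plus_sos R"
  unfolding one_plus_sos_def by blast

lemma one_plus_sos_one: "\<one> \<in> one_plus_sos R"
  using one_plus_sosI[OF sos_zero] by simp

lemma one_plus_sos_mult:
  assumes "x \<in> one_plus_sos R" "y \<in> one_plus_sos R"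
  shows "x \<otimes> y \<in> one_plus_sos R"
proof -
  obtain t u where t: "t \<in> sos R" "x = \<one> \<oplus> t" and u: "u \<in> sos R" "y = \<one> \<oplus> u"
    using assms unfolding one_plus_sos_def by blast
  have "t \<in> carrier R" "u \<in> carrier R" using t u sos_closed by auto
  then have "(\<one> \<oplus> t) \<otimes> (\<one> \<oplus> u) = \<one> \<oplus> (t \<oplus> u \<oplus> t \<otimes> u)" by algebra
  with t u show ?thesis by (auto intro!: one_plus_sosI sos_add sos_mult)
qed

lemma unit_mat_closed: "unit_mat R k i j \<in> carrier R"
  by (simp add: unit_mat_def)

text \<open>Induction over the indices other than \<open>k\<close>, so that \<open>k\<close> is left
  for last. The result for the Schur complement at \<open>l\<close> is lifted to \<open>M\<close> by
  \<open>posdef_on_shift\<close> with \<open>c = s a\<close>, where \<open>a = M l l\<close> and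
  \<open>s a = 1 + t\<close>.\<close>

lemma posdef_on_subtract_unit:
  assumes "finite J" "k \<notin> J" "posdef_on R (insert k J) M"
  shows "\<exists>x\<in>one_plus_sos R. \<exists>g\<in>one_plus_sos R.
    posdef_on R (insert k J) (\<lambda>i j. x \<otimes> M i j \<ominus> g \<otimes> unit_mat R k i j)"
  using assms
proof (induction J arbitrary: M rule: finite_induct)
  case empty
  note sym = posdef_on_sym[OF empty(2)]
  obtain s t where st: "s \<in> sos R" "t \<in> sos R" "s \<otimes> M k k = \<one> \<oplus> t"
    using posdef_on_diag[OF finite.emptyI _ empty(2)] by auto
  have c: "s \<in> carrier R" "t \<in> carrier R" "M k k \<in> carrier R"
    using st sos_closed sym_mat_on_closed[OF sym] by auto
  \<comment> \<open>With the factor \<open>1 + s\<close> instead of \<open>s\<close>, the 1 to be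
    subtracted is supplied by \<open>s M k k = 1 + t\<close>, and the positive
    \<open>M k k + t\<close> remains.\<close>
  let ?P = "\<lambda>i j. (\<one> \<oplus> s) \<otimes> M i j \<ominus> \<one> \<otimes> unit_mat R k i j"
  have "?P k k = M k k \<oplus> s \<otimes> M k k \<ominus> \<one>" using c by (simp add: unit_mat_def l_distr)
  also have "\<dots> = M k k \<oplus> (\<one> \<oplus> t) \<ominus> \<one>" by (simp add: st(3))
  also have "\<dots> = M k k \<oplus> t" using c by algebra
  finally have e: "?P k k = M k k \<oplus> t" .
  have "posdef_on R {k} ?P"
  proof (rule posdef_onI)
    show "sym_mat_on R {k} ?P" using c e by (simp add: sym_mat_on_def)
    fix S :: "('a \<times> nat) set ring" and h
    assume rp: "real_point R S h"
    interpret h: real_point R S h by fact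
    have "rcf_pos S (h (M k k))"
      using h.S.pd_on_diag[OF finite.emptyI _ h.hom_sym_mat_on[OF sym] posdef_onD[OF empty(2) rp]] by simp
    then have "rcf_pos S (h (?P k k))" unfolding e using h.S.rcf_pos_add h.hom_sos[OF st(2)] c by simp
    then show "pd_on S {k} (\<lambda>i j. h (?P i j))" by (rule h.S.pd_on_singleton)
  qed
  then show ?case using one_plus_sosI[OF st(1)] one_plus_sos_one by blast
next
  case (insert l J)
  let ?J = "insert k J" and ?I = "insert l (insert k J)"
  have swap: "insert k (insert l J) = ?I" by auto
  have M: "posdef_on R ?I M" using insert.prems(2) unfolding swap .
  have lJ: "finite ?J" "l \<notin> ?J" "k \<notin> J" "k \<noteq> l" using insert by auto
  note sym = posdef_on_sym[OF M]
  obtain x g where x: "x \<in> one_plus_sos R" and g: "g \<in> one_plus_sos R"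
    and P: "posdef_on R ?J (\<lambda>i j. x \<otimes> schur R l M i j \<ominus> g \<otimes> unit_mat R k i j)"
    using insert.IH[OF lJ(3) posdef_on_schur[OF lJ(1,2) M]] by blast
  obtain s t where st: "s \<in> sos R" "t \<in> sos R" "s \<otimes> M l l = \<one> \<oplus> t"
    using posdef_on_diag[OF lJ(1,2) M] by auto
  let ?a = "M l l"
  let ?u = "s \<otimes> ?a"
  have c: "s \<in> carrier R" "x \<in> carrier R" "g \<in> carrier R" "?a \<in> carrier R"
    using st x g sos_closed one_plus_sos_closed sym_mat_on_closed[OF sym] by auto
  have u: "?u \<in> one_plus_sos R" unfolding st(3) by (rule one_plus_sosI[OF st(2)])
  let ?D = "\<lambda>i j. g \<otimes> unit_mat R k i j"
  have D: "sym_mat_on R ?I ?D" using c by (auto simp: sym_mat_on_def unit_mat_def)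
  have zD: "?D j l = \<zero>" if "j \<in> ?I" for j using c lJ(4) by (auto simp: unit_mat_def)
  have uc: "?u \<in> carrier R" using c by simp
  note sh = posdef_on_shift[OF lJ(1,2) M D zD one_plus_sos_sos[OF x] uc P]
  \<comment> \<open>With \<open>u = s a\<close>, the coefficient \<open>u^2 x a\<close> of
    \<open>M\<close> is written as \<open>u s a^2 x\<close>, which is a sum of squares even if
    \<open>a\<close> is not. As \<open>u\<close> is \<open>1 + t\<close>, the factor
    \<open>u^2 g\<close> stays in \<open>one_plus_sos R\<close>.\<close>
  let ?x = "\<one> \<oplus> ?u \<otimes> (s \<otimes> (?a \<otimes> ?a)) \<otimes> x" and ?g = "?u \<otimes> ?u \<otimes> g"
  have "posdef_on R ?I (\<lambda>i j. ?x \<otimes> M i j \<ominus> ?g \<otimes> unit_mat R k i j)"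
  proof (rule posdef_on_cong[OF sh])
    fix i j assume "i \<in> ?I" "j \<in> ?I"
    then have "M i j \<in> carrier R" using sym_mat_on_closed[OF sym] by blast
    moreover have "(\<one> \<oplus> s \<otimes> a \<otimes> (s \<otimes> (a \<otimes> a)) \<otimes> x) \<otimes> m \<ominus> s \<otimes> a \<otimes> (s \<otimes> a) \<otimes> g \<otimes> e =
      m \<oplus> s \<otimes> a \<otimes> (s \<otimes> a) \<otimes> (x \<otimes> (a \<otimes> m) \<ominus> g \<otimes> e)"
      if "a \<in> carrier R" "m \<in> carrier R" "e \<in> carrier R" for a m e
      using that c(1-3) by algebra
    ultimately show "?x \<otimes> M i j \<ominus> ?g \<otimes> unit_mat R k i j =
      M i j \<oplus> ?u \<otimes> ?u \<otimes> (x \<otimes> (?a \<otimes> M i j) \<ominus> ?D i j)"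
      using c(4) unit_mat_closed by blast
  qed
  moreover have "?x \<in> one_plus_sos R"
    by (rule one_plus_sosI[OF sos_mult[OF sos_mult[OF one_plus_sos_sos[OF u]
      sos_mult[OF st(1) sos_square[OF c(4)]]] one_plus_sos_sos[OF x]]])
  moreover have "?g \<in> one_plus_sos R" by (rule one_plus_sos_mult[OF one_plus_sos_mult[OF u u] g])
  ultimately show ?case unfolding swap by blast
qed

text \<open>The indices of \<open>J\<close> are treated one at a time. Each new factor
  \<open>y\<close> multiplies the earlier entries of \<open>d\<close>, which stay in the
  multiplicative set \<open>one_plus_sos R\<close>.\<close>

lemma posdef_on_subtract_diag:
  assumes I: "finite I" and M: "posdef_on R I M" and "finite J" "J \<subseteq> I"
  shows "\<exists>x\<in>one_plus_sos R. \<exists>d. (\<forall>i\<in>J. d i \<in> one_plus_sos R) \<and> (\<forall>i\<in>I - J. d i = \<zero>) \<and>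
    posdef_on R I (\<lambda>i j. x \<otimes> M i j \<ominus> (if i = j then d i else \<zero>))"
  using assms(3,4)
proof (induction J rule: finite_induct)
  case empty
  have "posdef_on R I (\<lambda>i j. \<one> \<otimes> M i j \<ominus> (if i = j then \<zero> else \<zero>))"
    using sym_mat_on_closed[OF posdef_on_sym[OF M]] by (intro posdef_on_cong[OF M]) (simp add: a_minus_def)
  then show ?case using one_plus_sos_one by (intro bexI[of _ \<one>] exI[of _ "\<lambda>_. \<zero>"]) auto
next
  case (insert k J)
  have "J \<subseteq> I" using insert.prems by blast
  from insert.IH[OF this] obtain x d where x: "x \<in> one_plus_sos R"
    and d': "\<forall>i\<in>J. d i \<in> one_plus_sos R" "\<forall>i\<in>I - J. d i = \<zero>"
    and P: "posdef_on R I (\<lambda>i j. x \<otimes> M i j \<ominus> (if i = j then d i else \<zero>))"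
    by (elim bexE exE conjE)
  note d = bspec[OF d'(1)] bspec[OF d'(2)]
  have k: "insert k (I - {k}) = I" "k \<in> I" using insert.prems by auto
  obtain y g where y: "y \<in> one_plus_sos R" and g: "g \<in> one_plus_sos R"
    and Q: "posdef_on R I (\<lambda>i j. y \<otimes> (x \<otimes> M i j \<ominus> (if i = j then d i else \<zero>)) \<ominus> g \<otimes> unit_mat R k i j)"
    using posdef_on_subtract_unit[of "I - {k}" k "\<lambda>i j. x \<otimes> M i j \<ominus> (if i = j then d i else \<zero>)"] I P
    unfolding k(1) by auto
  have c: "x \<in> carrier R" "y \<in> carrier R" "g \<in> carrier R" using x y g one_plus_sos_closed by auto
  \<comment> \<open>The old entry at \<open>k\<close> is zero, so the subtracted unit matrix
    supplies exactly \<open>g\<close> there.\<close>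
  have dk: "d k = \<zero>" using d(2) k(2) insert.hyps by auto
  have dc: "d i \<in> carrier R" if "i \<in> I" for i
    using d[of i] that one_plus_sos_closed by (cases "i \<in> J") auto
  let ?d = "\<lambda>i. if i = k then g else y \<otimes> d i"
  have "posdef_on R I (\<lambda>i j. (y \<otimes> x) \<otimes> M i j \<ominus> (if i = j then ?d i else \<zero>))"
  proof (rule posdef_on_cong[OF Q])
    fix i j assume ij: "i \<in> I" "j \<in> I"
    have m: "M i j \<in> carrier R" using sym_mat_on_closed[OF posdef_on_sym[OF M] ij] .
    have "y \<otimes> x \<otimes> m \<ominus> y \<otimes> e = y \<otimes> (x \<otimes> m \<ominus> e) \<ominus> \<zero>"
      if "m \<in> carrier R" "e \<in> carrier R" for m e
      using that c by algebra
    note 1 = this[OF m dc[OF ij(1)]] this[OF m zero_closed]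
    show "(y \<otimes> x) \<otimes> M i j \<ominus> (if i = j then ?d i else \<zero>) =
      y \<otimes> (x \<otimes> M i j \<ominus> (if i = j then d i else \<zero>)) \<ominus> g \<otimes> unit_mat R k i j"
      using 1 c m dk by (auto simp: unit_mat_def a_minus_def m_assoc)
  qed
  moreover have "\<forall>i\<in>insert k J. ?d i \<in> one_plus_sos R"
    using g d(1) one_plus_sos_mult[OF y] by auto
  moreover have "\<forall>i\<in>I - insert k J. ?d i = \<zero>" using d(2) c by auto
  ultimately show ?case using one_plus_sos_mult[OF y x]
    by (intro bexI[of _ "y \<otimes> x"] exI[of _ ?d]) auto
qed

text \<open>Let \<open>a = M k k\<close>, let \<open>x\<close> be column \<open>k\<close> and
  \<open>M'\<close> the Schur complement, so \<open>a M = x x^t + M'\<close>. With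
  \<open>s a = 1 + t\<close> and \<open>u M'\<close> already diagonalized,
  \<open>s a u M = s u x x^t + s (u M')\<close> adds one summand for the new index.\<close>

lemma posdef_on_diagonalize:
  assumes "finite I" "posdef_on R I M"
  shows "\<exists>u\<in>one_plus_sos R. \<exists>c w. (\<forall>l\<in>I. c l \<in> sos R) \<and> (\<forall>l\<in>I. \<forall>i\<in>I. w l i \<in> carrier R) \<and>
    (\<forall>i\<in>I. \<forall>j\<in>I. u \<otimes> M i j = (\<Oplus>l\<in>I. c l \<otimes> (w l i \<otimes> w l j)))"
  using assms
proof (induction I arbitrary: M rule: finite_induct)
  case empty
  then show ?case using one_plus_sos_one by auto
next
  case (insert k J)
  note sym = posdef_on_sym[OF insert.prems]
  obtain u c w where u: "u \<in> one_plus_sos R" and c: "\<And>l. l \<in> J \<Longrightarrow> c l \<in> sos R"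
    and w: "\<And>l i. l \<in> J \<Longrightarrow> i \<in> J \<Longrightarrow> w l i \<in> carrier R"
    and e: "\<And>i j. i \<in> J \<Longrightarrow> j \<in> J \<Longrightarrow> u \<otimes> schur R k M i j = (\<Oplus>l\<in>J. c l \<otimes> (w l i \<otimes> w l j))"
    using insert.IH[OF posdef_on_schur[OF insert.hyps insert.prems]] by blast
  obtain s t where st: "s \<in> sos R" "t \<in> sos R" "s \<otimes> M k k = \<one> \<oplus> t"
    using posdef_on_diag[OF insert.hyps insert.prems] by blast
  have cl: "s \<in> carrier R" "u \<in> carrier R" "M k k \<in> carrier R"
    using st u sos_closed one_plus_sos_closed sym_mat_on_closed[OF sym] by auto
  have cc: "c l \<in> carrier R" if "l \<in> J" for l using c[OF that] by (rule sos_closed)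
  \<comment> \<open>The new vector is column \<open>k\<close> with coefficient \<open>s u\<close>.
    The old coefficients are multiplied by \<open>s\<close>, and the old vectors are extended by
    zero at \<open>k\<close>, where the Schur complement vanishes.\<close>
  define c' where "c' l = (if l = k then s \<otimes> u else s \<otimes> c l)" for l
  define w' where "w' l i = (if l = k then M i k else if i = k then \<zero> else w l i)" for l i
  have c'_sos: "\<forall>l\<in>insert k J. c' l \<in> sos R"
    using c st(1) one_plus_sos_sos[OF u] by (auto simp: c'_def intro: sos_mult)
  have w'_cl: "\<forall>l\<in>insert k J. \<forall>i\<in>insert k J. w' l i \<in> carrier R"
    using w sym_mat_on_closed[OF sym] by (auto simp: w'_def)
  have main: "s \<otimes> M k k \<otimes> u \<otimes> M i j = (\<Oplus>l\<in>insert k J. c' l \<otimes> (w' l i \<otimes> w' l j))"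
    if ij: "i \<in> insert k J" "j \<in> insert k J" for i j
  proof -
    have m: "M i j \<in> carrier R" "M i k \<in> carrier R" "M j k \<in> carrier R"
      using ij sym_mat_on_closed[OF sym] by auto
    have sc: "schur R k M i j \<in> carrier R" using sym_mat_on_closed[OF schur_sym_mat_on[OF sym] ij] .
    have J: "(\<Oplus>l\<in>J. c' l \<otimes> (w' l i \<otimes> w' l j)) = s \<otimes> (u \<otimes> schur R k M i j)"
    proof (cases "i = k \<or> j = k")
      case True
      then have "schur R k M i j = \<zero>" using schur_row_zero[OF sym] ij by auto
      moreover have "(\<Oplus>l\<in>J. c' l \<otimes> (w' l i \<otimes> w' l j)) = \<zero>"
      proof (rule add.finprod_one_eqI)
        fix l assume l: "l \<in> J"
        then have "w' l k = \<zero>" using insert.hyps by (auto simp: w'_def)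
        moreover have "w' l i \<in> carrier R" "w' l j \<in> carrier R" using w'_cl ij l by blast+
        moreover have "c' l \<in> carrier R" using c'_sos l sos_closed by blast
        ultimately show "c' l \<otimes> (w' l i \<otimes> w' l j) = \<zero>" using True by auto
      qed
      ultimately show ?thesis using cl by simp
    next
      case False
      then have ij': "i \<in> J" "j \<in> J" using ij by auto
      have "s \<otimes> (u \<otimes> schur R k M i j) = (\<Oplus>l\<in>J. s \<otimes> (c l \<otimes> (w l i \<otimes> w l j)))"
        unfolding e[OF ij'] using insert.hyps(1) cl cc w ij' by (intro finsum_rdistr) auto
      also have "\<dots> = (\<Oplus>l\<in>J. c' l \<otimes> (w' l i \<otimes> w' l j))"
      proof (rule finsum_cong')
        fix l assume l: "l \<in> J"
        then have "l \<noteq> k" using insert.hyps by auto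
        then show "s \<otimes> (c l \<otimes> (w l i \<otimes> w l j)) = c' l \<otimes> (w' l i \<otimes> w' l j)"
          using False l cl cc w ij' by (simp add: c'_def w'_def m_assoc)
      qed (use c'_sos w'_cl ij sos_closed in auto)
      finally show ?thesis by simp
    qed
    have "(\<Oplus>l\<in>insert k J. c' l \<otimes> (w' l i \<otimes> w' l j)) =
        c' k \<otimes> (w' k i \<otimes> w' k j) \<oplus> (\<Oplus>l\<in>J. c' l \<otimes> (w' l i \<otimes> w' l j))"
      using insert.hyps c'_sos w'_cl ij sos_closed by (intro finsum_insert) auto
    also have "\<dots> = s \<otimes> u \<otimes> (M i k \<otimes> M j k) \<oplus> s \<otimes> (u \<otimes> schur R k M i j)"
      unfolding J by (simp add: c'_def w'_def)
    also have "\<dots> = s \<otimes> M k k \<otimes> u \<otimes> M i j"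
      unfolding schur_def using cl m by algebra
    finally show ?thesis by simp
  qed
  have "s \<otimes> M k k \<otimes> u \<in> one_plus_sos R"
    unfolding st(3) by (intro one_plus_sos_mult one_plus_sosI st(2) u)
  then show ?case using main c'_sos w'_cl by blast
qed

end

section \<open>Counting the squares\<close>

text \<open>The number \<open>m\<close> of rows of the factor is a parameter, so that the final
  bound results from adding up rows.\<close>

definition gram :: "('a, 'm) ring_scheme \<Rightarrow> nat \<Rightarrow> nat \<Rightarrow> (nat \<Rightarrow> nat \<Rightarrow> 'a) \<Rightarrow> bool" where
  "gram R n m P \<longleftrightarrow> (\<exists>Q. (\<forall>k<m. \<forall>j<n. Q k j \<in> carrier R) \<and>
     (\<forall>i<n. \<forall>j<n. P i j = (\<Oplus>\<^bsub>R\<^esub>k\<in>{..<m}. Q k i \<otimes>\<^bsub>R\<^esub> Q k j)))"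

context cring
begin

lemma gram_zero: "gram R n 0 (\<lambda>i j. \<zero>)"
  by (auto simp: gram_def)

lemma finsum_lessThan_add:
  fixes m m' :: nat
  assumes "f \<in> {..<m} \<rightarrow> carrier R" "g \<in> {..<m'} \<rightarrow> carrier R"
  shows "(\<Oplus>k\<in>{..<m + m'}. if k < m then f k else g (k - m)) = (\<Oplus>k\<in>{..<m}. f k) \<oplus> (\<Oplus>k\<in>{..<m'}. g k)"
  using assms(2)
proof (induction m')
  case 0
  have "(\<Oplus>k\<in>{..<m}. if k < m then f k else g (k - m)) = (\<Oplus>k\<in>{..<m}. f k)"
    using assms(1) by (intro finsum_cong') auto
  moreover have "(\<Oplus>k\<in>{..<m}. f k) \<in> carrier R" using assms(1) by (rule finsum_closed)
  ultimately show ?case by simp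
next
  case (Suc m')
  let ?h = "\<lambda>k. if k < m then f k else g (k - m)"
  have g: "g \<in> {..<m'} \<rightarrow> carrier R" "g m' \<in> carrier R" using Suc.prems by auto
  have h: "?h k \<in> carrier R" if "k < m + Suc m'" for k
    using assms(1) Suc.prems that by (auto simp: Pi_iff)
  have "(\<Oplus>k\<in>{..<m + Suc m'}. ?h k) = ?h (m + m') \<oplus> (\<Oplus>k\<in>{..<m + m'}. ?h k)"
    unfolding add_Suc_right lessThan_Suc using h h[of "m + m'"] by (intro finsum_insert) (auto simp: Pi_iff)
  also have "\<dots> = g m' \<oplus> ((\<Oplus>k\<in>{..<m}. f k) \<oplus> (\<Oplus>k\<in>{..<m'}. g k))"
    using Suc.IH[OF g(1)] by simp
  also have "\<dots> = (\<Oplus>k\<in>{..<m}. f k) \<oplus> (g m' \<oplus> (\<Oplus>k\<in>{..<m'}. g k))"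
    using g assms(1) by (simp add: a_lcomm finsum_closed)
  also have "g m' \<oplus> (\<Oplus>k\<in>{..<m'}. g k) = (\<Oplus>k\<in>{..<Suc m'}. g k)"
    unfolding lessThan_Suc using g by (intro finsum_insert[symmetric]) auto
  finally show ?case .
qed

text \<open>Stacking the two factors on top of each other adds their Gram matrices.\<close>

lemma gram_add:
  assumes "gram R n m P" "gram R n m' P'"
  shows "gram R n (m + m') (\<lambda>i j. P i j \<oplus> P' i j)"
proof -
  obtain Q where "\<forall>k<m. \<forall>j<n. Q k j \<in> carrier R"
    "\<forall>i<n. \<forall>j<n. P i j = (\<Oplus>k\<in>{..<m}. Q k i \<otimes> Q k j)"
    using assms(1) unfolding gram_def by (elim exE conjE)
  then have Q: "\<And>k j. k < m \<Longrightarrow> j < n \<Longrightarrow> Q k j \<in> carrier R"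
    "\<And>i j. i < n \<Longrightarrow> j < n \<Longrightarrow> P i j = (\<Oplus>k\<in>{..<m}. Q k i \<otimes> Q k j)" by simp_all
  obtain Q' where "\<forall>k<m'. \<forall>j<n. Q' k j \<in> carrier R"
    "\<forall>i<n. \<forall>j<n. P' i j = (\<Oplus>k\<in>{..<m'}. Q' k i \<otimes> Q' k j)"
    using assms(2) unfolding gram_def by (elim exE conjE)
  then have Q': "\<And>k j. k < m' \<Longrightarrow> j < n \<Longrightarrow> Q' k j \<in> carrier R"
    "\<And>i j. i < n \<Longrightarrow> j < n \<Longrightarrow> P' i j = (\<Oplus>k\<in>{..<m'}. Q' k i \<otimes> Q' k j)" by simp_all
  let ?Q = "\<lambda>k j. if k < m then Q k j else Q' (k - m) j"
  have "P i j \<oplus> P' i j = (\<Oplus>k\<in>{..<m + m'}. ?Q k i \<otimes> ?Q k j)" if "i < n" "j < n" for i j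
  proof -
    have "P i j \<oplus> P' i j =
        (\<Oplus>k\<in>{..<m + m'}. if k < m then Q k i \<otimes> Q k j else Q' (k - m) i \<otimes> Q' (k - m) j)"
      unfolding Q(2)[OF that] Q'(2)[OF that] using Q(1) Q'(1) that
      by (intro finsum_lessThan_add[symmetric]) auto
    also have "\<dots> = (\<Oplus>k\<in>{..<m + m'}. ?Q k i \<otimes> ?Q k j)"
      using Q(1) Q'(1) that by (intro finsum_cong') auto
    finally show ?thesis .
  qed
  moreover have "\<forall>k<m + m'. \<forall>j<n. ?Q k j \<in> carrier R" using Q(1) Q'(1) by auto
  ultimately show ?thesis unfolding gram_def by (intro exI[of _ ?Q]) auto
qed

text \<open>If \<open>c\<close> is the sum of the squares of the \<open>f k\<close>, the multiples
  of \<open>w\<close> by the \<open>f k\<close> serve as rows.\<close>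

lemma gram_rank_one:
  assumes "sum_squares_of R p c" "\<And>i. i < n \<Longrightarrow> w i \<in> carrier R"
  shows "gram R n p (\<lambda>i j. c \<otimes> (w i \<otimes> w j))"
proof -
  obtain f where f: "f \<in> {..<p} \<rightarrow> carrier R" "c = (\<Oplus>k\<in>{..<p}. f k \<otimes> f k)"
    using assms(1) unfolding sum_squares_of_def by blast
  have "c \<otimes> (w i \<otimes> w j) = (\<Oplus>k\<in>{..<p}. (f k \<otimes> w i) \<otimes> (f k \<otimes> w j))" if "i < n" "j < n" for i j
  proof -
    have "c \<otimes> (w i \<otimes> w j) = (\<Oplus>k\<in>{..<p}. f k \<otimes> f k \<otimes> (w i \<otimes> w j))"
      unfolding f(2) using f(1) assms(2) that by (intro finsum_ldistr) auto
    also have "\<dots> = (\<Oplus>k\<in>{..<p}. (f k \<otimes> w i) \<otimes> (f k \<otimes> w j))"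
      using f(1) assms(2) that by (intro finsum_cong') (auto simp: Pi_iff m_ac)
    finally show ?thesis .
  qed
  then show ?thesis unfolding gram_def using f(1) assms(2)
    by (intro exI[of _ "\<lambda>k j. f k \<otimes> w j"]) auto
qed

lemma gram_finsum:
  assumes "finite L" "\<And>l. l \<in> L \<Longrightarrow> sum_squares_of R p (c l)" "\<And>l i. l \<in> L \<Longrightarrow> i < n \<Longrightarrow> w l i \<in> carrier R"
  shows "gram R n (card L * p) (\<lambda>i j. \<Oplus>l\<in>L. c l \<otimes> (w l i \<otimes> w l j))"
  using assms
proof (induction L rule: finite_induct)
  case empty
  then show ?case by (simp add: gram_zero)
next
  case (insert l L)
  have "gram R n (p + card L * p)
      (\<lambda>i j. c l \<otimes> (w l i \<otimes> w l j) \<oplus> (\<Oplus>l\<in>L. c l \<otimes> (w l i \<otimes> w l j)))"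
    using insert by (intro gram_add gram_rank_one insert.IH) auto
  moreover have "(\<Oplus>l\<in>insert l L. c l \<otimes> (w l i \<otimes> w l j)) =
      c l \<otimes> (w l i \<otimes> w l j) \<oplus> (\<Oplus>l\<in>L. c l \<otimes> (w l i \<otimes> w l j))" if "i < n" "j < n" for i j
    using insert.hyps sum_squares_of_closed[OF insert.prems(1)] insert.prems(2) that
    by (intro finsum_insert) (auto simp: Pi_iff)
  ultimately show ?case using insert.hyps unfolding gram_def by auto
qed

text \<open>A finite Pythagoras number serves itself. In the infinite case, finitely many elements
  still share some number of squares, by padding with zeros. The row count then needs no case
  distinction.\<close>

lemma ex_uniform_sum_squares:
  assumes "finite Y" "Y \<subseteq> sos R"
  shows "\<exists>p. (\<forall>x\<in>Y. sum_squares_of R p x) \<and> (case pythagoras_number R of enat q \<Rightarrow> p = q | \<infinity> \<Rightarrow> True)"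
proof (cases "\<exists>q. \<forall>x\<in>sos R. sum_squares_of R q x")
  case True
  let ?q = "LEAST q. \<forall>x\<in>sos R. sum_squares_of R q x"
  have "\<forall>x\<in>sos R. sum_squares_of R ?q x" by (rule LeastI_ex[OF True])
  moreover have "pythagoras_number R = enat ?q" using True by (simp add: pythagoras_number_def)
  ultimately show ?thesis using assms(2) by (intro exI[of _ ?q]) auto
next
  case False
  have "\<exists>p. \<forall>x\<in>Y. sum_squares_of R p x"
    using assms
  proof (induction Y rule: finite_induct)
    case (insert x Y)
    then obtain p q where "\<forall>y\<in>Y. sum_squares_of R p y" "sum_squares_of R q x"
      by (auto simp: sos_def)
    then show ?case using sum_squares_of_mono[of p _ "max p q"] sum_squares_of_mono[of q _ "max p q"]
      by (intro exI[of _ "max p q"]) auto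
  qed auto
  moreover have "pythagoras_number R = \<infinity>" using False by (simp add: pythagoras_number_def)
  ultimately show ?thesis by auto
qed

end

section \<open>Translation to index sets and assembly of the identity\<close>

lemma pos_def_over_iff_pd_on: "pos_def_over R n N \<longleftrightarrow> pd_on R {..<n} N"
  by (simp add: pos_def_over_def pd_on_def qform_def Ball_def Bex_def)

lemma sym_mat_iff_sym_mat_on: "sym_mat R n M \<longleftrightarrow> sym_mat_on R {..<n} M"
  by (simp add: sym_mat_def sym_mat_on_def Ball_def)

lemma pos_def_iff_posdef_on: "pos_def R n M \<longleftrightarrow> posdef_on R {..<n} M"
  unfolding pos_def_def posdef_on_def pos_def_over_iff_pd_on sym_mat_iff_sym_mat_on by blast

theorem theorem3p14:
  fixes A :: "('a, 'm) ring_scheme" and n :: nat and M :: "nat \<Rightarrow> nat \<Rightarrow> 'a"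
  assumes "cring A"
    and "sym_mat A n M"
    and "pos_def A n M"
  shows "\<exists>s m (Q :: nat \<Rightarrow> nat \<Rightarrow> 'a).
     s \<in> sos A \<and>
     (\<forall>k<m. \<forall>j<n. Q k j \<in> carrier A) \<and>
     (case pythagoras_number A of enat p \<Rightarrow> m \<le> 2 * n * p | \<infinity> \<Rightarrow> True) \<and>
     (\<forall>i<n. \<forall>j<n. s \<otimes>\<^bsub>A\<^esub> M i j =
        (if i = j then \<one>\<^bsub>A\<^esub> else \<zero>\<^bsub>A\<^esub>) \<oplus>\<^bsub>A\<^esub> (\<Oplus>\<^bsub>A\<^esub> k\<in>{..<m}. Q k i \<otimes>\<^bsub>A\<^esub> Q k j))"
proof -
  interpret A: cring A by fact
  have M: "posdef_on A {..<n} M" using assms(3) by (simp add: pos_def_iff_posdef_on)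
  note symM = A.posdef_on_sym[OF M]
  obtain x d where x: "x \<in> one_plus_sos A" and d: "\<And>i. i < n \<Longrightarrow> d i \<in> one_plus_sos A"
    and P: "posdef_on A {..<n} (\<lambda>i j. x \<otimes>\<^bsub>A\<^esub> M i j \<ominus>\<^bsub>A\<^esub> (if i = j then d i else \<zero>\<^bsub>A\<^esub>))"
    using A.posdef_on_subtract_diag[OF finite_lessThan M finite_lessThan subset_refl] by auto
  from A.posdef_on_diagonalize[OF finite_lessThan P] obtain u c w where u: "u \<in> one_plus_sos A"
    and c': "\<forall>l\<in>{..<n}. c l \<in> sos A" and w': "\<forall>l\<in>{..<n}. \<forall>i\<in>{..<n}. w l i \<in> carrier A"
    and e': "\<forall>i\<in>{..<n}. \<forall>j\<in>{..<n}.
      u \<otimes>\<^bsub>A\<^esub> (x \<otimes>\<^bsub>A\<^esub> M i j \<ominus>\<^bsub>A\<^esub> (if i = j then d i else \<zero>\<^bsub>A\<^esub>))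
      = (\<Oplus>\<^bsub>A\<^esub>l\<in>{..<n}. c l \<otimes>\<^bsub>A\<^esub> (w l i \<otimes>\<^bsub>A\<^esub> w l j))"
    by (elim bexE exE conjE)
  have c: "c l \<in> sos A" if "l < n" for l using c' that by simp
  have w: "w l i \<in> carrier A" if "l < n" "i < n" for l i using w' that by simp
  note e = e'[rule_format, unfolded lessThan_iff]
  \<comment> \<open>The products \<open>u d i\<close> stay in \<open>one_plus_sos A\<close>. Their
    parts 1 make up the identity matrix, and the parts \<open>b i\<close> go into
    \<open>Q\<close>.\<close>
  have "\<exists>b. b \<in> sos A \<and> u \<otimes>\<^bsub>A\<^esub> d i = \<one>\<^bsub>A\<^esub> \<oplus>\<^bsub>A\<^esub> b" if "i < n" for i
    using A.one_plus_sos_mult[OF u d[OF that]] unfolding one_plus_sos_def by blast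
  then obtain b where b: "\<And>i. i < n \<Longrightarrow> b i \<in> sos A"
    "\<And>i. i < n \<Longrightarrow> u \<otimes>\<^bsub>A\<^esub> d i = \<one>\<^bsub>A\<^esub> \<oplus>\<^bsub>A\<^esub> b i" by metis
  have "finite (b ` {..<n} \<union> c ` {..<n})" "b ` {..<n} \<union> c ` {..<n} \<subseteq> sos A"
    using b(1) c by auto
  from A.ex_uniform_sum_squares[OF this]
  obtain p where p: "\<forall>y\<in>b ` {..<n} \<union> c ` {..<n}. sum_squares_of A p y"
    and pyth: "case pythagoras_number A of enat q \<Rightarrow> p = q | \<infinity> \<Rightarrow> True"
    by (elim exE conjE)
  \<comment> \<open>\<open>?e l\<close> is the \<open>l\<close>-th unit vector. It writes the
    diagonal matrix of the \<open>b l\<close> as \<open>n\<close> rank one terms, of the same shape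
    as those with the \<open>c l\<close>; each of the \<open>2 n\<close> terms takes
    \<open>p\<close> rows.\<close>
  let ?e = "\<lambda>l i. if i = l then \<one>\<^bsub>A\<^esub> else \<zero>\<^bsub>A\<^esub>"
  have "gram A n (card {..<n} * p + card {..<n} * p)
    (\<lambda>i j. (\<Oplus>\<^bsub>A\<^esub>l\<in>{..<n}. b l \<otimes>\<^bsub>A\<^esub> (?e l i \<otimes>\<^bsub>A\<^esub> ?e l j)) \<oplus>\<^bsub>A\<^esub>
      (\<Oplus>\<^bsub>A\<^esub>l\<in>{..<n}. c l \<otimes>\<^bsub>A\<^esub> (w l i \<otimes>\<^bsub>A\<^esub> w l j)))"
    using p w by (intro A.gram_add A.gram_finsum) auto
  moreover have "card {..<n} * p + card {..<n} * p = 2 * n * p" by simp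
  ultimately obtain Q where "\<forall>k<2 * n * p. \<forall>j<n. Q k j \<in> carrier A"
    and "\<forall>i<n. \<forall>j<n. (\<Oplus>\<^bsub>A\<^esub>l\<in>{..<n}. b l \<otimes>\<^bsub>A\<^esub> (?e l i \<otimes>\<^bsub>A\<^esub> ?e l j)) \<oplus>\<^bsub>A\<^esub>
      (\<Oplus>\<^bsub>A\<^esub>l\<in>{..<n}. c l \<otimes>\<^bsub>A\<^esub> (w l i \<otimes>\<^bsub>A\<^esub> w l j)) = (\<Oplus>\<^bsub>A\<^esub>k\<in>{..<2 * n * p}. Q k i \<otimes>\<^bsub>A\<^esub> Q k j)"
    unfolding gram_def by (simp only:) (elim exE conjE)
  then have Q: "\<And>k j. k < 2 * n * p \<Longrightarrow> j < n \<Longrightarrow> Q k j \<in> carrier A"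
    "\<And>i j. i < n \<Longrightarrow> j < n \<Longrightarrow> (\<Oplus>\<^bsub>A\<^esub>l\<in>{..<n}. b l \<otimes>\<^bsub>A\<^esub> (?e l i \<otimes>\<^bsub>A\<^esub> ?e l j)) \<oplus>\<^bsub>A\<^esub>
      (\<Oplus>\<^bsub>A\<^esub>l\<in>{..<n}. c l \<otimes>\<^bsub>A\<^esub> (w l i \<otimes>\<^bsub>A\<^esub> w l j)) = (\<Oplus>\<^bsub>A\<^esub>k\<in>{..<2 * n * p}. Q k i \<otimes>\<^bsub>A\<^esub> Q k j)"
    by simp_all
  have xc: "x \<in> carrier A" "u \<in> carrier A" using x u A.one_plus_sos_closed by auto
  have eq: "(u \<otimes>\<^bsub>A\<^esub> x) \<otimes>\<^bsub>A\<^esub> M i j =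
    ?e j i \<oplus>\<^bsub>A\<^esub> (\<Oplus>\<^bsub>A\<^esub>k\<in>{..<2 * n * p}. Q k i \<otimes>\<^bsub>A\<^esub> Q k j)" if ij: "i < n" "j < n" for i j
  proof -
    have m: "M i j \<in> carrier A" using ij sym_mat_on_closed[OF symM] by auto
    let ?C = "\<Oplus>\<^bsub>A\<^esub>l\<in>{..<n}. c l \<otimes>\<^bsub>A\<^esub> (w l i \<otimes>\<^bsub>A\<^esub> w l j)"
    have bc: "b l \<in> carrier A" "d l \<in> carrier A" if "l < n" for l
      using b(1)[OF that] d[OF that] A.sos_closed A.one_plus_sos_closed by auto
    have "(\<Oplus>\<^bsub>A\<^esub>l\<in>{..<n}. b l \<otimes>\<^bsub>A\<^esub> (?e l i \<otimes>\<^bsub>A\<^esub> ?e l j)) =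
        (\<Oplus>\<^bsub>A\<^esub>l\<in>{..<n}. if i = l then (if i = j then b l else \<zero>\<^bsub>A\<^esub>) else \<zero>\<^bsub>A\<^esub>)"
      using bc by (intro A.finsum_cong') auto
    also have "\<dots> = (if i = j then b i else \<zero>\<^bsub>A\<^esub>)"
      using A.finsum_singleton[of i "{..<n}" "\<lambda>l. if i = j then b l else \<zero>\<^bsub>A\<^esub>"] ij bc by auto
    finally have B: "(\<Oplus>\<^bsub>A\<^esub>l\<in>{..<n}. b l \<otimes>\<^bsub>A\<^esub> (?e l i \<otimes>\<^bsub>A\<^esub> ?e l j)) = (if i = j then b i else \<zero>\<^bsub>A\<^esub>)" .
    \<comment> \<open>This splits off the diagonal: with \<open>y\<close> an entry of
      \<open>M\<close> and \<open>z\<close> that of the diagonal matrix of \<open>d\<close>, the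
      last summand is an entry of the diagonalized part.\<close>
    have gen: "u \<otimes>\<^bsub>A\<^esub> x \<otimes>\<^bsub>A\<^esub> y = u \<otimes>\<^bsub>A\<^esub> z \<oplus>\<^bsub>A\<^esub> u \<otimes>\<^bsub>A\<^esub> (x \<otimes>\<^bsub>A\<^esub> y \<ominus>\<^bsub>A\<^esub> z)"
      if "y \<in> carrier A" "z \<in> carrier A" for y z
      using that xc by algebra
    have Cc: "?C \<in> carrier A" using ij c w A.sos_closed by (intro A.finsum_closed) auto
    have "(u \<otimes>\<^bsub>A\<^esub> x) \<otimes>\<^bsub>A\<^esub> M i j = u \<otimes>\<^bsub>A\<^esub> (if i = j then d i else \<zero>\<^bsub>A\<^esub>) \<oplus>\<^bsub>A\<^esub> ?C"
      using gen[OF m, of "if i = j then d i else \<zero>\<^bsub>A\<^esub>"] e[OF ij] bc(2)[OF ij(1)] by auto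
    also have "\<dots> = ?e j i \<oplus>\<^bsub>A\<^esub> ((if i = j then b i else \<zero>\<^bsub>A\<^esub>) \<oplus>\<^bsub>A\<^esub> ?C)"
      using b(2)[OF ij(1)] bc[OF ij(1)] xc Cc by (auto simp: A.a_assoc)
    finally show ?thesis using Q(2)[OF ij] unfolding B by simp
  qed
  have "u \<otimes>\<^bsub>A\<^esub> x \<in> sos A" using A.one_plus_sos_sos[OF A.one_plus_sos_mult[OF u x]] .
  moreover have "case pythagoras_number A of enat q \<Rightarrow> 2 * n * p \<le> 2 * n * q | \<infinity> \<Rightarrow> True"
    using pyth by (auto split: enat.splits)
  ultimately show ?thesis using Q(1) eq
    by (intro exI[of _ "u \<otimes>\<^bsub>A\<^esub> x"] exI[of _ "2 * n * p"] exI[of _ Q]) auto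
qed

end
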